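(* Fix an integer $m\ge 1$. For each integer $n\ge 1$ define $$\overline{\zeta}_n^{(m)}(q,t)=\sum_{d=0}^\infty q^{(m-1)\frac{d(d-1)}{2}+(n-1)d}\sum_k\dim H^k({\rm H}_{d,n}^{(m)})\,q^{-k/2}\,t^d .$$ Then $\overline{\zeta}_n^{(m)}(q,t)\in{\bf Q}[q][[t]]$, and, as elements of ${\bf Q}[q][[t]]$, these generating functions are determined by the functional equations $$\overline{\zeta}_n^{(m)}(q,t)=\prod_{i=0}^{n-1}\overline{\zeta}_1^{(m)}(q,q^it)\quad\mbox{ and }\quad\overline{\zeta}_1^{(m)}(q,t)=1+t\cdot\prod_{i=0}^{m-1}\overline{\zeta}_1^{(m)}(q,q^it);$$ that is, they satisfy these equations and are the unique elements of ${\bf Q}[q][[t]]$ doing so. In particular, for all $d\ge 0$ and $n\geq 1$, the cohomological Euler characteristic of ${\rm H}_{d,n}^{(m)}$ is given by $$\chi({\rm H}_{d,n}^{(m)})=\frac{n}{(m-1)d+n}\binom{md+n-1}{d}.$$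
   Context: The ground field is ${\bf C}$. The variety ${\rm H}_{d,n}^{(m)}$: let $W$, $V$ be ${\bf C}$-vector spaces of dimensions $d$ and $n$. The group ${\rm GL}(W)$ acts on $X={\rm Hom}(V,W)\oplus{\rm End}(W)^m$ by $g(f,\varphi_1,\ldots,\varphi_m)=(gf,g\varphi_1g^{-1},\ldots,g\varphi_mg^{-1})$. A tuple $(f,\varphi_1,\ldots,\varphi_m)\in X$ is called stable if the smallest subspace of $W$ containing $f(V)$ and invariant under all $\varphi_i$ is $W$. Let $X^s\subset X$ be the open subset of stable tuples; stabilizers of stable tuples are trivial, and ${\rm H}_{d,n}^{(m)}=X^s/{\rm GL}(W)$ is the (geometric) quotient variety, which is smooth and irreducible of dimension $nd+(m-1)d^2$. $H^k({\rm H}_{d,n}^{(m)})$ denotes the singular cohomology (e.g. with rational coefficients) of the complex variety ${\rm H}_{d,n}^{(m)}({\bf C})$, and $\chi=\sum_k(-1)^k\dim H^k$. *)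

theory Defs
  imports
    "HOL-Homology.Homology"
    "HOL-Computational_Algebra.Computational_Algebra"
    "HOL-Algebra.Group_Action"
    "Jordan_Normal_Form.VS_Connect"
begin

hide_const (open) Multiset.mult Polynomial.smult

section \<open>Singular cohomology with rational coefficients\<close>

text \<open>The module \<open>M / N\<close> of additive cosets; the fields \<open>mult\<close> and \<open>one\<close>, which the record type
  inherits from rings, play no role.\<close>

definition quotient_module ::
  "('a, 'b, 'c) module_scheme \<Rightarrow> 'b set \<Rightarrow> ('a, 'b set) module" where
  "quotient_module M N =
     \<lparr>carrier = a_rcosets\<^bsub>M\<^esub> N, mult = undefined, one = undefined, zero = N, add = set_add M,
      smult = (\<lambda>c A. \<Union>a\<in>A. N +>\<^bsub>M\<^esub> (c \<odot>\<^bsub>M\<^esub> a))\<rparr>"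

definition cochain_space :: "nat \<Rightarrow> 'a topology \<Rightarrow> (rat, ((nat \<Rightarrow> real) \<Rightarrow> 'a) \<Rightarrow> rat) module" where
  "cochain_space k X = ring.func_space class_ring (singular_simplex_set k X)"

definition coboundary ::
  "nat \<Rightarrow> 'a topology \<Rightarrow> (((nat \<Rightarrow> real) \<Rightarrow> 'a) \<Rightarrow> rat) \<Rightarrow> ((nat \<Rightarrow> real) \<Rightarrow> 'a) \<Rightarrow> rat" where
  "coboundary k X c =
     restrict (\<lambda>\<sigma>. \<Sum>i\<le>Suc k. (-1) ^ i * c (singular_face (Suc k) i \<sigma>))
       (singular_simplex_set (Suc k) X)"

definition cocycles :: "nat \<Rightarrow> 'a topology \<Rightarrow> (((nat \<Rightarrow> real) \<Rightarrow> 'a) \<Rightarrow> rat) set" where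
  "cocycles k X =
     {c \<in> carrier (cochain_space k X). coboundary k X c = \<zero>\<^bsub>cochain_space (Suc k) X\<^esub>}"

definition coboundaries :: "nat \<Rightarrow> 'a topology \<Rightarrow> (((nat \<Rightarrow> real) \<Rightarrow> 'a) \<Rightarrow> rat) set" where
  "coboundaries k X =
     (case k of
        0 \<Rightarrow> {\<zero>\<^bsub>cochain_space 0 X\<^esub>}
      | Suc j \<Rightarrow> coboundary j X ` carrier (cochain_space j X))"

definition cohomology ::
  "nat \<Rightarrow> 'a topology \<Rightarrow> (rat, (((nat \<Rightarrow> real) \<Rightarrow> 'a) \<Rightarrow> rat) set) module" where
  "cohomology k X =
     quotient_module (cochain_space k X \<lparr>carrier := cocycles k X\<rparr>) (coboundaries k X)"

section \<open>Stable tuples and the action of the general linear group\<close>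

text \<open>We take \<open>W = \<complex>\<^sup>d\<close> and \<open>V = \<complex>\<^sup>n\<close>, so that a tuple consists of a
  \<open>d \<times> n\<close> matrix and a list of \<open>m\<close> matrices of size \<open>d \<times> d\<close>.\<close>

type_synonym tuple = "complex mat \<times> complex mat list"

definition tuples :: "nat \<Rightarrow> nat \<Rightarrow> nat \<Rightarrow> tuple set" where
  "tuples m d n = carrier_mat d n \<times> {\<phi>s. length \<phi>s = m \<and> set \<phi>s \<subseteq> carrier_mat d d}"

definition GL :: "nat \<Rightarrow> complex mat monoid" where
  "GL d = units_of (ring_mat TYPE(complex) d ())"

definition act :: "nat \<Rightarrow> complex mat \<Rightarrow> tuple \<Rightarrow> tuple" where
  "act d g = (\<lambda>(f, \<phi>s). (g * f, map (\<lambda>\<phi>. g * \<phi> * inv\<^bsub>GL d\<^esub> g) \<phi>s))"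

definition generated_subspace :: "nat \<Rightarrow> nat \<Rightarrow> tuple \<Rightarrow> complex vec set" where
  "generated_subspace d n = (\<lambda>(f, \<phi>s).
     \<Inter>{U. VectorSpace.subspace class_ring U (module_vec TYPE(complex) d)
           \<and> (\<lambda>v. f *\<^sub>v v) ` carrier_vec n \<subseteq> U
           \<and> (\<forall>\<phi>\<in>set \<phi>s. (\<lambda>w. \<phi> *\<^sub>v w) ` U \<subseteq> U)})"

definition stable_tuples :: "nat \<Rightarrow> nat \<Rightarrow> nat \<Rightarrow> tuple set" where
  "stable_tuples m d n = {x \<in> tuples m d n. generated_subspace d n x = carrier_vec d}"

section \<open>The quotient variety and its complex points\<close>

inductive_set polynomial_functions :: "nat \<Rightarrow> nat \<Rightarrow> nat \<Rightarrow> (tuple \<Rightarrow> complex) set"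
  for m d n :: nat where
  const: "(\<lambda>x. c) \<in> polynomial_functions m d n"
| coord_f: "i < d \<Longrightarrow> j < n \<Longrightarrow> (\<lambda>x. fst x $$ (i, j)) \<in> polynomial_functions m d n"
| coord_phi: "l < m \<Longrightarrow> i < d \<Longrightarrow> j < d \<Longrightarrow> (\<lambda>x. (snd x ! l) $$ (i, j)) \<in> polynomial_functions m d n"
| add: "p \<in> polynomial_functions m d n \<Longrightarrow> r \<in> polynomial_functions m d n \<Longrightarrow>
    (\<lambda>x. p x + r x) \<in> polynomial_functions m d n"
| mult: "p \<in> polynomial_functions m d n \<Longrightarrow> r \<in> polynomial_functions m d n \<Longrightarrow>
    (\<lambda>x. p x * r x) \<in> polynomial_functions m d n"

definition zariski_open :: "nat \<Rightarrow> nat \<Rightarrow> nat \<Rightarrow> tuple set \<Rightarrow> bool" where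
  "zariski_open m d n U \<longleftrightarrow>
     (\<exists>P \<subseteq> polynomial_functions m d n. U = {x \<in> tuples m d n. \<exists>p\<in>P. p x \<noteq> 0})"

definition regular_on :: "nat \<Rightarrow> nat \<Rightarrow> nat \<Rightarrow> tuple set \<Rightarrow> (tuple \<Rightarrow> complex) \<Rightarrow> bool" where
  "regular_on m d n U h \<longleftrightarrow>
     (\<forall>x\<in>U. \<exists>U'. zariski_open m d n U' \<and> x \<in> U' \<and> U' \<subseteq> U \<and>
        (\<exists>p\<in>polynomial_functions m d n. \<exists>r\<in>polynomial_functions m d n.
           \<forall>y\<in>U'. r y \<noteq> 0 \<and> h y = p y / r y))"

definition H_points :: "nat \<Rightarrow> nat \<Rightarrow> nat \<Rightarrow> tuple set set" where
  "H_points m d n = orbits (GL d) (stable_tuples m d n) (act d)"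

text \<open>The structure of a geometric quotient: a set of orbits is Zariski open iff its preimage is,
  and a function on it is regular iff its pullback is (pullbacks being exactly the
  functions that are invariant under the group).\<close>

definition H_zariski_open :: "nat \<Rightarrow> nat \<Rightarrow> nat \<Rightarrow> tuple set set \<Rightarrow> bool" where
  "H_zariski_open m d n \<U> \<longleftrightarrow> \<U> \<subseteq> H_points m d n \<and> zariski_open m d n (\<Union>\<U>)"

definition H_regular_on ::
  "nat \<Rightarrow> nat \<Rightarrow> nat \<Rightarrow> tuple set set \<Rightarrow> (tuple set \<Rightarrow> complex) \<Rightarrow> bool" where
  "H_regular_on m d n \<U> F \<longleftrightarrow> regular_on m d n (\<Union>\<U>) (\<lambda>x. F (orbit (GL d) (act d) x))"

text \<open>The complex (analytic) topology on the points of the variety: the coarsest topology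
  for which Zariski open sets are open and the regular functions on them are continuous.\<close>

definition H_space :: "nat \<Rightarrow> nat \<Rightarrow> nat \<Rightarrow> tuple set topology" where
  "H_space m d n = topology_generated_by
     {{P \<in> \<U>. F P \<in> D} | \<U> F D.
        H_zariski_open m d n \<U> \<and> H_regular_on m d n \<U> F \<and> open D}"

definition dim_H :: "nat \<Rightarrow> nat \<Rightarrow> nat \<Rightarrow> nat \<Rightarrow> nat" where
  "dim_H m d n k = vectorspace.dim class_ring (cohomology k (H_space m d n))"

definition euler_char :: "nat \<Rightarrow> nat \<Rightarrow> nat \<Rightarrow> int" where
  "euler_char m d n = Sum_any (\<lambda>k. (-1) ^ k * int (dim_H m d n k))"

section \<open>Generating functions\<close>

text \<open>The a priori home of the generating functions is \<open>\<rat>((s))[[t]]\<close> with \<open>s = q\<^bsup>1/2\<^esup>\<close>.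
  The variable of \<open>fls\<close> is \<open>s\<close>, that of \<open>fps\<close> is \<open>t\<close>, and that of \<open>poly\<close> is \<open>q\<close>.\<close>

definition q_var :: "rat fls" where
  "q_var = fls_X ^ 2"

definition zeta_bar :: "nat \<Rightarrow> nat \<Rightarrow> rat fls fps" where
  "zeta_bar m n = Abs_fps (\<lambda>d.
     q_var ^ ((m - 1) * (d * (d - 1) div 2) + (n - 1) * d) *
     Sum_any (\<lambda>k. of_nat (dim_H m d n k) * fls_X_intpow (- int k)))"

definition embed_gf :: "rat poly fps \<Rightarrow> rat fls fps" where
  "embed_gf Z = Abs_fps (\<lambda>d. poly (map_poly fls_const (fps_nth Z d)) q_var)"

text \<open>\<open>subst_t i Z\<close> is \<open>Z(q, q\<^sup>i t)\<close>.\<close>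

definition subst_t :: "nat \<Rightarrow> rat poly fps \<Rightarrow> rat poly fps" where
  "subst_t i Z = fps_compose Z (fps_const (monom 1 i) * fps_X)"

definition functional_equations :: "nat \<Rightarrow> (nat \<Rightarrow> rat poly fps) \<Rightarrow> bool" where
  "functional_equations m Z \<longleftrightarrow>
     (\<forall>n\<ge>1. Z n = (\<Prod>i<n. subst_t i (Z 1))) \<and>
     Z 1 = 1 + fps_X * (\<Prod>i<m. subst_t i (Z 1))"

end

theory Submission
  imports Defs "HOL-Library.List_Lexorder"
begin

text \<open>
  For a word \<open>w\<close> in the letters \<open>\<phi>\<^sub>1, \<dots>, \<phi>\<^sub>m\<close> applied to one of the \<open>n\<close> vectors
  \<open>f(e\<^sub>j)\<close>, a stable tuple yields a vector of \<open>W\<close>. A prefix-closed set of \<open>d\<close> words (an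
  \<open>m\<close>-ary forest with \<open>n\<close> roots and \<open>d\<close> nodes) whose vectors form a basis of \<open>W\<close> provides a normal form
  of the tuple, so the tuples for which a given forest works form an open chart of the quotient that is
  an affine space; the coordinates express the critical words, that is, the words one step outside the forest, in this basis.
  If forests are ordered lexicographically, a chart minus the charts of all smaller forests is the
  linear subspace where each critical word is a combination of smaller words of the forest.
  Attaching the charts one after another, excision identifies the relative homology with that of an
  affine space modulo the complement of a linear subspace, which is that of a sphere; hence every forest contributes one class
  in degree twice the codimension, and all connecting maps vanish because homology lives in even degrees.
  Decomposing forests into trees and trees into root and forest of subtrees gives the functional equations.
\<close>

section \<open>Cycle bases and the long exact sequence of a pair\<close>

text \<open>Homology is handled through explicit integral cycles: \<open>cycle_basis p X r z\<close>
  says that the classes of \<open>z 0, ..., z (r - 1)\<close> form a basis of the free abelian group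
  H_p(X; Z). In this form exact sequences are manipulations of chains, and the cycles pair directly
  with rational cochains. Since the abelian group of rationals is injective, cocycles are the
  cochains that kill boundaries and coboundaries those that kill cycles, so rational H^k is dual to
  homology.

  Cramer's rule gives the coordinates of a chart as quotients of determinants, hence as invariant
  regular functions. This makes the chart map continuous at once; its inverse needs more care,
  because the topology of the quotient is generated by functions that are quotients of polynomials
  only locally.

  The factors q^i in the functional equations come from counting: if a tree with b nodes is put
  behind a forest with n roots and a nodes, the codimension gains a cross term (n + (m - 1) a) b and
  the exponent in \<open>zeta_bar\<close> gains the same plus a; the surplus q^a is the substitution
  of q t for t.\<close>

definition cycle_basis :: "nat \<Rightarrow> 'a topology \<Rightarrow> nat \<Rightarrow> (nat \<Rightarrow> 'a chain) \<Rightarrow> bool" where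
  "cycle_basis p X r z \<longleftrightarrow>
     (\<forall>i<r. singular_relcycle p X {} (z i)) \<and>
     (\<forall>c. singular_relcycle p X {} c \<longrightarrow>
        (\<exists>a. singular_relboundary p X {} (c - (\<Sum>i<r. frag_cmul (a i) (z i))))) \<and>
     (\<forall>a. singular_relboundary p X {} (\<Sum>i<r. frag_cmul (a i) (z i)) \<longrightarrow> (\<forall>i<r. a i = 0))"

lemma relboundary_of_trivial_homology:
  assumes "trivial_group (relative_homology_group (int p) X A)" "singular_relcycle p X A c"
  shows "singular_relboundary p X A c"
proof -
  have "homologous_rel_set p X A c \<in> carrier (relative_homology_group (int p) X A)"
    using assms(2) by (simp add: carrier_relative_homology_group)
  then have "homologous_rel_set p X A c = singular_relboundary_set p X A"
    using assms(1) by (simp add: trivial_group_def)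
  then show ?thesis
    by (simp add: homologous_rel_set_eq_relboundary)
qed

lemma mult_homologous_rel_set:
  assumes "singular_relcycle p X A y" "singular_relcycle p X A z"
  shows "homologous_rel_set p X A y \<otimes>\<^bsub>relative_homology_group (int p) X A\<^esub> homologous_rel_set p X A z
          = homologous_rel_set p X A (y + z)"
proof -
  interpret normal "singular_relboundary_set p X A" "relcycle_group p X A"
    by (rule normal_subgroup_singular_relboundary_relcycle)
  show ?thesis
    using rcos_sum[of y z] assms
    by (simp add: relative_homology_group_def FactGroup_def right_coset_singular_relboundary)
qed

lemma homologous_rel_set_pow:
  assumes "singular_relcycle p X A z"
  shows "homologous_rel_set p X A z [^]\<^bsub>relative_homology_group (int p) X A\<^esub> (n::nat)
          = homologous_rel_set p X A (frag_cmul (int n) z)"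
proof (induction n)
  case 0
  then show ?case
    by (simp add: one_relative_homology_group) (metis homologous_rel_set_eq_relboundary singular_relboundary_0)
next
  case (Suc n)
  then show ?case
    using assms by (simp add: mult_homologous_rel_set singular_relcycle_cmul frag_cmul_distrib algebra_simps)
qed

text \<open>Powers in the homology group become scalar multiples of chains; this lets an abstract
  isomorphism with \<open>integer_group\<close> be read off on chains.\<close>

lemma homologous_rel_set_int_pow:
  assumes z: "singular_relcycle p X A z"
  shows "homologous_rel_set p X A z [^]\<^bsub>relative_homology_group (int p) X A\<^esub> (n::int)
          = homologous_rel_set p X A (frag_cmul n z)"
proof (cases "n \<ge> 0")
  case True
  then obtain k where "n = int k" using nonneg_int_cases by blast
  then show ?thesis
    using homologous_rel_set_pow[OF z] by (simp add: int_pow_int)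
next
  case False
  then obtain k where n: "n = - int k" by (metis int_cases2 linear of_nat_0_le_iff)
  interpret group "relative_homology_group (int p) X A" by simp
  have c: "homologous_rel_set p X A z \<in> carrier (relative_homology_group (int p) X A)"
    using z by (simp add: carrier_relative_homology_group)
  have kz: "singular_relcycle p X A (frag_cmul (int k) z)" "singular_relcycle p X A (frag_cmul (- int k) z)"
    using z by (auto intro: singular_relcycle_cmul)
  have "homologous_rel_set p X A (frag_cmul (- int k) z)
        \<otimes>\<^bsub>relative_homology_group (int p) X A\<^esub> homologous_rel_set p X A (frag_cmul (int k) z)
      = \<one>\<^bsub>relative_homology_group (int p) X A\<^esub>"
    using mult_homologous_rel_set[OF kz(2,1)]
    by (simp add: frag_cmul_distrib[symmetric]) (metis homologous_rel_set_eq_relboundary singular_relboundary_0)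
  then have "inv\<^bsub>relative_homology_group (int p) X A\<^esub> homologous_rel_set p X A (frag_cmul (int k) z)
      = homologous_rel_set p X A (frag_cmul (- int k) z)"
    by (rule inv_equality) (use kz in \<open>simp_all add: carrier_relative_homology_group\<close>)
  then show ?thesis
    using z c by (simp add: n int_pow_neg_int homologous_rel_set_pow)
qed

text \<open>The generator represents the image of 1 under an isomorphism from
  \<open>integer_group\<close>; surjectivity and injectivity of the isomorphism are the last two
  properties.\<close>

lemma relcycle_generator_of_integer_homology:
  assumes "relative_homology_group (int p) X A \<cong> integer_group"
  obtains z where "singular_relcycle p X A z"
    "\<And>c. singular_relcycle p X A c \<Longrightarrow> \<exists>a. singular_relboundary p X A (c - frag_cmul a z)"
    "\<And>a. singular_relboundary p X A (frag_cmul a z) \<Longrightarrow> a = 0"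
proof -
  interpret G: group "relative_homology_group (int p) X A" by simp
  have "integer_group \<cong> relative_homology_group (int p) X A"
    using assms by (simp add: G.iso_sym)
  then obtain f where f: "f \<in> iso integer_group (relative_homology_group (int p) X A)"
    using is_iso_def by blast
  then have fh: "f \<in> hom integer_group (relative_homology_group (int p) X A)"
    and bij: "bij_betw f UNIV (carrier (relative_homology_group (int p) X A))"
    by (auto simp: iso_def)
  then have "f 1 \<in> carrier (relative_homology_group (int p) X A)"
    using bij_betwE by blast
  then obtain z where z: "singular_relcycle p X A z" "f 1 = homologous_rel_set p X A z"
    by (auto simp: carrier_relative_homology_group)
  have f_eq: "f a = homologous_rel_set p X A (frag_cmul a z)" for a
  proof -
    have "f (1 [^]\<^bsub>integer_group\<^esub> a) = f 1 [^]\<^bsub>relative_homology_group (int p) X A\<^esub> a"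
      by (rule hom_int_pow[OF fh]) auto
    then show ?thesis using homologous_rel_set_int_pow[OF z(1)] z(2) by (simp add: group_int_pow_integer_group)
  qed
  show thesis
  proof
    show "singular_relcycle p X A z" by (rule z)
  next
    fix c assume c: "singular_relcycle p X A c"
    then have "homologous_rel_set p X A c \<in> carrier (relative_homology_group (int p) X A)"
      by (simp add: carrier_relative_homology_group)
    then obtain a where "f a = homologous_rel_set p X A c"
      using bij by (metis bij_betw_imp_surj_on imageE)
    then have "homologous_rel p X A c (frag_cmul a z)"
      using f_eq by (metis homologous_rel_set_eq)
    then show "\<exists>a. singular_relboundary p X A (c - frag_cmul a z)"
      by (auto simp: homologous_rel_def)
  next
    fix a assume "singular_relboundary p X A (frag_cmul a z)"
    then have "f a = f 0"
      by (simp add: f_eq) (metis homologous_rel_set_eq_relboundary singular_relboundary_0)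
    then show "a = 0" using bij by (metis UNIV_I bij_betw_def inj_onD)
  qed
qed

lemma relcycle_absolute:
  "singular_relcycle p X {} c \<Longrightarrow> singular_relcycle p X A c"
  using singular_cycle[of p X c] by (simp add: singular_relcycle)

lemma relboundary_absolute:
  "singular_relboundary p X {} c \<Longrightarrow> singular_relboundary p X A c"
  by (metis add.right_neutral singular_boundary singular_chain_0 singular_relboundary)

lemma boundary_subtopology:
  "singular_relboundary p (subtopology X A) {} c \<Longrightarrow> singular_relboundary p X {} c"
  unfolding singular_boundary by (auto simp: singular_chain_subtopology)

lemma cycle_subtopology:
  "singular_relcycle p (subtopology X A) {} c \<longleftrightarrow>
    singular_relcycle p X {} c \<and> singular_chain p (subtopology X A) c"
  unfolding singular_cycle by (auto simp: singular_chain_subtopology)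

text \<open>Exactness at H_p(X): a relative boundary differs from an absolute one by a chain
  \<open>e\<close> in \<open>A\<close>, and here \<open>e\<close> is itself a cycle of
  \<open>A\<close>.\<close>

lemma cycle_homologous_to_subspace:
  assumes c: "singular_relcycle p X {} c" and rb: "singular_relboundary p X A c"
    and gen: "cycle_basis p (subtopology X A) r z"
  shows "\<exists>a. singular_relboundary p X {} (c - (\<Sum>i<r. frag_cmul (a i) (z i)))"
proof -
  obtain d e where d: "singular_chain (Suc p) X d" and e: "singular_chain p (subtopology X A) e"
    and eq: "chain_boundary (Suc p) d + e = c"
    using rb by (auto simp: singular_relboundary)
  have dd: "singular_relboundary p X {} (chain_boundary (Suc p) d)"
    using d by (auto simp: singular_boundary)
  have "singular_relcycle p X {} e"
    using singular_relcycle_diff[OF c singular_relboundary_imp_relcycle[OF dd]] eq by (metis add_diff_cancel_left')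
  then have "singular_relcycle p (subtopology X A) {} e"
    using e by (simp add: cycle_subtopology)
  then obtain a where "singular_relboundary p (subtopology X A) {} (e - (\<Sum>i<r. frag_cmul (a i) (z i)))"
    using gen unfolding cycle_basis_def by blast
  then have "singular_relboundary p X {} (chain_boundary (Suc p) d + (e - (\<Sum>i<r. frag_cmul (a i) (z i))))"
    using singular_relboundary_add[OF dd boundary_subtopology] by blast
  then show ?thesis using eq by (metis add_diff_eq)
qed

text \<open>Exactness at H_p(A): a chain \<open>d\<close> bounded by \<open>c\<close> is a relative
  cycle; since it bounds relatively, it may be replaced by a chain in \<open>A\<close> with the same
  boundary.\<close>

lemma boundary_in_subspace:
  assumes triv: "\<And>d. singular_relcycle (Suc p) X A d \<Longrightarrow> singular_relboundary (Suc p) X A d"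
    and c: "singular_chain p (subtopology X A) c" and b: "singular_relboundary p X {} c"
  shows "singular_relboundary p (subtopology X A) {} c"
proof -
  obtain d where d: "singular_chain (Suc p) X d" "chain_boundary (Suc p) d = c"
    using b by (auto simp: singular_boundary)
  then have "singular_relcycle (Suc p) X A d" using c by (simp add: singular_relcycle)
  then obtain u e where u: "singular_chain (Suc (Suc p)) X u" and e: "singular_chain (Suc p) (subtopology X A) e"
    and eq: "chain_boundary (Suc (Suc p)) u + e = d"
    using triv unfolding singular_relboundary by blast
  have "chain_boundary (Suc p) (chain_boundary (Suc (Suc p)) u) = 0"
    using chain_boundary_boundary_alt[OF u] by simp
  then have "chain_boundary (Suc p) e = c"
    using d eq by (metis add.left_neutral chain_boundary_add)
  then show ?thesis using e by (auto simp: singular_boundary)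
qed

text \<open>The long exact sequence of the pair \<open>(X, A)\<close>, which splits into short ones because all homology
  lives in even degrees.\<close>

lemma cycle_basis_attach_even:
  fixes b :: "nat \<Rightarrow> nat"
  assumes A: "\<And>k. \<exists>z. cycle_basis k (subtopology X A) (b k) z"
    and odd: "\<And>k. odd k \<Longrightarrow> b k = 0"
    and triv: "\<And>k. k \<noteq> 2 * n \<Longrightarrow> trivial_group (relative_homology_group (int k) X A)"
    and Z: "relative_homology_group (int (2 * n)) X A \<cong> integer_group"
  shows "\<exists>z. cycle_basis k X (b k + (if k = 2 * n then 1 else 0)) z"
proof -
  obtain z where z: "cycle_basis k (subtopology X A) (b k) z" using A by blast
  have zc: "i < b k \<Longrightarrow> singular_relcycle k (subtopology X A) {} (z i)" for i
    using z by (simp add: cycle_basis_def)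
  have zX: "i < b k \<Longrightarrow> singular_relcycle k X {} (z i)" for i
    using zc cycle_subtopology by blast
  have sumA: "singular_chain k (subtopology X A) (\<Sum>i<b k. frag_cmul (a i) (z i))" for a
    using zc by (intro singular_chain_sum singular_chain_cmul) (auto simp: singular_cycle)
  \<comment> \<open>In odd degree there are no cycles in the basis. In even degree
    \<open>Suc k\<close> is odd, so the relative group that could kill a class of \<open>A\<close>
    vanishes.\<close>
  have indep: "\<forall>i<b k. a i = 0" if "singular_relboundary k X {} (\<Sum>i<b k. frag_cmul (a i) (z i))" for a
  proof (cases "odd k")
    case True
    then show ?thesis using odd by simp
  next
    case False
    then have "Suc k \<noteq> 2 * n" by presburger
    then have "singular_relboundary k (subtopology X A) {} (\<Sum>i<b k. frag_cmul (a i) (z i))"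
      using boundary_in_subspace[OF relboundary_of_trivial_homology[OF triv] sumA that] by blast
    then show ?thesis using z by (simp add: cycle_basis_def)
  qed
  show ?thesis
  proof (cases "k = 2 * n")
    case False
    have "cycle_basis k X (b k) z"
      unfolding cycle_basis_def
    proof (intro conjI allI impI)
      fix c assume c: "singular_relcycle k X {} c"
      show "\<exists>a. singular_relboundary k X {} (c - (\<Sum>i<b k. frag_cmul (a i) (z i)))"
        by (rule cycle_homologous_to_subspace[OF c _ z])
          (rule relboundary_of_trivial_homology[OF triv[OF False] relcycle_absolute[OF c]])
    qed (use zX indep in auto)
    then show ?thesis using False by auto
  next
    case k: True
    obtain w0 where w0: "singular_relcycle k X A w0"
      and w0_gen: "\<And>c. singular_relcycle k X A c \<Longrightarrow> \<exists>a. singular_relboundary k X A (c - frag_cmul a w0)"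
      and w0_ind: "\<And>a. singular_relboundary k X A (frag_cmul a w0) \<Longrightarrow> a = 0"
      using relcycle_generator_of_integer_homology[OF Z] unfolding k by metis
    \<comment> \<open>The relative generator lifts to an absolute cycle: its boundary is a cycle of
      \<open>A\<close> in odd degree, hence the boundary of some \<open>d\<close> in
      \<open>A\<close>, and \<open>w0 - d\<close> is closed. In degree 0 every chain is a
      cycle.\<close>
    have "\<exists>w. singular_relcycle k X {} w \<and> singular_chain k (subtopology X A) (w0 - w)"
    proof (cases "k = 0")
      case True
      then have "singular_relcycle k X {} w0"
        using w0 unfolding singular_cycle singular_relcycle by (simp add: chain_boundary_def)
      then show ?thesis
        by (intro exI[of _ w0]) simp
    next
      case False
      then obtain j where j: "k = Suc j" using not0_implies_Suc by blast
      then have "odd j" using k by presburger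
      obtain y where y: "cycle_basis j (subtopology X A) (b j) y" using A by blast
      have "singular_relcycle j (subtopology X A) {} (chain_boundary k w0)"
        unfolding singular_cycle
      proof
        show "singular_chain j (subtopology X A) (chain_boundary k w0)"
          using w0 by (simp add: singular_relcycle j)
        show "chain_boundary j (chain_boundary k w0) = 0"
          using w0 chain_boundary_boundary[of k X w0] by (simp add: singular_relcycle j)
      qed
      then have "singular_relboundary j (subtopology X A) {} (chain_boundary k w0)"
        using y odd[OF \<open>odd j\<close>] by (auto simp: cycle_basis_def)
      then obtain d where d: "singular_chain k (subtopology X A) d" "chain_boundary k d = chain_boundary k w0"
        by (auto simp: singular_boundary j)
      then have "singular_relcycle k X {} (w0 - d)"
        using w0 unfolding singular_cycle
        by (metis chain_boundary_diff diff_self singular_chain_diff singular_chain_subtopology singular_relcycle)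
      then show ?thesis using d by (intro exI[of _ "w0 - d"]) auto
    qed
    then obtain w where w: "singular_relcycle k X {} w" and ww: "singular_chain k (subtopology X A) (w0 - w)" by blast
    have diff: "frag_cmul a (w0 - w) = frag_cmul a w0 - frag_cmul a w" for a
      using frag_cmul_distrib2[of a "w0 - w" w] by (simp add: algebra_simps)
    have w_gen: "\<exists>a. singular_relboundary k X A (c - frag_cmul a w)" if c: "singular_relcycle k X {} c" for c
    proof -
      obtain a where a: "singular_relboundary k X A (c - frag_cmul a w0)"
        using w0_gen relcycle_absolute[OF c] by blast
      have "singular_relboundary k X A (frag_cmul a (w0 - w))"
        using ww by (simp add: singular_chain_cmul singular_chain_imp_relboundary)
      then have "singular_relboundary k X A (c - frag_cmul a w0 + frag_cmul a (w0 - w))"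
        by (rule singular_relboundary_add[OF a])
      then show ?thesis
        unfolding diff by (simp only: add_diff_eq diff_add_cancel) blast
    qed
    have w_ind: "a = 0" if "singular_relboundary k X A (frag_cmul a w)" for a
    proof -
      have "singular_relboundary k X A (frag_cmul a (w0 - w))"
        using ww by (simp add: singular_chain_cmul singular_chain_imp_relboundary)
      from singular_relboundary_add[OF this that] show ?thesis
        by (intro w0_ind) (simp add: diff)
    qed
    define z' where "z' = (\<lambda>i. if i < b k then z i else w)"
    have sum': "(\<Sum>i<Suc (b k). frag_cmul (a i) (z' i)) =
        (\<Sum>i<b k. frag_cmul (a i) (z i)) + frag_cmul (a (b k)) w" for a
      by (simp add: z'_def)
    have "cycle_basis k X (Suc (b k)) z'"
      unfolding cycle_basis_def
    proof (intro conjI allI impI)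
      fix i assume "i < Suc (b k)"
      then show "singular_relcycle k X {} (z' i)" using zX w by (auto simp: z'_def)
    next
      fix c assume c: "singular_relcycle k X {} c"
      then obtain a0 where a0: "singular_relboundary k X A (c - frag_cmul a0 w)" using w_gen by blast
      have "singular_relcycle k X {} (c - frag_cmul a0 w)"
        using c w by (simp add: singular_relcycle_cmul singular_relcycle_diff)
      then obtain a where a: "singular_relboundary k X {} (c - frag_cmul a0 w - (\<Sum>i<b k. frag_cmul (a i) (z i)))"
        using cycle_homologous_to_subspace[OF _ a0 z] by blast
      have "(\<Sum>i<b k. frag_cmul ((a(b k := a0)) i) (z i)) = (\<Sum>i<b k. frag_cmul (a i) (z i))"
        by (intro sum.cong) auto
      then have "singular_relboundary k X {} (c - (\<Sum>i<Suc (b k). frag_cmul ((a(b k := a0)) i) (z' i)))"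
        unfolding sum' using a by (simp add: diff_diff_eq add.commute)
      then show "\<exists>a. singular_relboundary k X {} (c - (\<Sum>i<Suc (b k). frag_cmul (a i) (z' i)))" by blast
    next
      fix a i assume rb: "singular_relboundary k X {} (\<Sum>i<Suc (b k). frag_cmul (a i) (z' i))" and i: "i < Suc (b k)"
      \<comment> \<open>The old cycles lie in \<open>A\<close>, so modulo \<open>A\<close> only the
        coefficient of \<open>w\<close> survives.\<close>
      have "singular_relboundary k X A (\<Sum>i<b k. frag_cmul (a i) (z i))"
        by (rule singular_chain_imp_relboundary[OF sumA])
      from singular_relboundary_diff[OF relboundary_absolute[OF rb] this]
      have a0: "a (b k) = 0" unfolding sum' by (intro w_ind) simp
      then have "\<forall>i<b k. a i = 0" using indep rb unfolding sum' by simp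
      then show "a i = 0" using a0 i less_antisym by blast
    qed
    then show ?thesis using k by auto
  qed
qed

section \<open>Attaching a chart\<close>

text \<open>Dividing the first \<open>Suc j\<close> coordinates by their norm and dropping the
  others is a homotopy inverse of the inclusion of the sphere. The straight-line homotopy stays in
  the space because it multiplies the first \<open>Suc j\<close> coordinates by a positive
  number.\<close>

lemma nonzero_space_homotopy_equivalent_nsphere:
  assumes "Suc j \<le> M"
  shows "subtopology (Euclidean_space M) {x. \<exists>i<Suc j. x i \<noteq> 0} homotopy_equivalent_space nsphere j"
proof -
  define P where "P = {x::nat \<Rightarrow> real. \<exists>i\<le>j. x i \<noteq> 0}"
  have P_eq: "{x. \<exists>i<Suc j. x i \<noteq> 0} = P" by (simp add: P_def less_Suc_eq_le)
  define N where "N = (\<lambda>x::nat \<Rightarrow> real. sqrt (\<Sum>i\<le>j. (x i)\<^sup>2))"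
  define r where "r = (\<lambda>x i. if i \<le> j then x i / N x else (0::real))"
  have Npos: "N x > 0" if x: "x \<in> P" for x
  proof -
    obtain i where i: "i \<le> j" "x i \<noteq> 0" using x by (auto simp: P_def)
    have "0 < (x i)\<^sup>2" using i by simp
    also have "\<dots> \<le> (\<Sum>i\<le>j. (x i)\<^sup>2)" using i by (intro member_le_sum) auto
    finally show ?thesis by (simp add: N_def)
  qed
  have E: "subtopology (Euclidean_space M) P = subtopology (powertop_real UNIV) ({x. \<forall>i\<ge>M. x i = 0} \<inter> P)"
    by (simp add: Euclidean_space_def subtopology_subtopology)
  have proj: "continuous_map (subtopology (Euclidean_space M) P) euclideanreal (\<lambda>x. x i)" for i
    unfolding E by (intro continuous_map_from_subtopology continuous_map_product_projection) simp
  have Ncont: "continuous_map (subtopology (Euclidean_space M) P) euclideanreal N"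
    unfolding N_def by (intro continuous_map_sqrt continuous_map_sum continuous_map_real_pow proj) auto
  have Nnz: "x \<in> topspace (subtopology (Euclidean_space M) P) \<Longrightarrow> N x \<noteq> 0" for x
    using Npos[of x] by simp
  have rcomp: "continuous_map (subtopology (Euclidean_space M) P) euclideanreal (\<lambda>x. r x i)" for i
    unfolding r_def
    by (cases "i \<le> j") (auto intro!: continuous_map_real_divide proj Ncont dest: Nnz)
  have r_cont: "continuous_map (subtopology (Euclidean_space M) P) (nsphere j) r"
  proof -
    have "(\<Sum>i\<le>j. (r x i)\<^sup>2) = 1" if "x \<in> P" for x
    proof -
      have "(\<Sum>i\<le>j. (r x i)\<^sup>2) = (\<Sum>i\<le>j. (x i)\<^sup>2) / (N x)\<^sup>2"
        by (simp add: r_def power_divide sum_divide_distrib)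
      moreover have "(N x)\<^sup>2 = (\<Sum>i\<le>j. (x i)\<^sup>2)" by (simp add: N_def sum_nonneg)
      ultimately show ?thesis using Npos[OF that] by (metis divide_self less_numeral_extra(3) zero_less_power)
    qed
    then show ?thesis
      unfolding nsphere continuous_map_in_subtopology continuous_map_componentwise_UNIV
      using rcomp by (auto simp: r_def)
  qed
  have in_P: "x \<in> P" if "(\<Sum>i\<le>j. (x i)\<^sup>2) = 1" for x
  proof (rule ccontr)
    assume "x \<notin> P"
    then have "(\<Sum>i\<le>j. (x i)\<^sup>2) = 0" by (intro sum.neutral) (auto simp: P_def)
    then show False using that by simp
  qed
  have id_cont: "continuous_map (nsphere j) (subtopology (Euclidean_space M) P) id"
    unfolding E continuous_map_in_subtopology
    using assms in_P continuous_map_nsphere_projection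
    by (auto simp: continuous_map_componentwise_UNIV nsphere intro: continuous_map_from_subtopology)
  have "homotopic_with (\<lambda>x. True) (nsphere j) (nsphere j) (r \<circ> id) id"
  proof (rule homotopic_with_equal)
    show "continuous_map (nsphere j) (nsphere j) (r \<circ> id)"
      by (rule continuous_map_compose[OF id_cont r_cont])
    fix x assume "x \<in> topspace (nsphere j)"
    then show "(r \<circ> id) x = id x" by (auto simp: nsphere r_def N_def)
  qed auto
  moreover have "homotopic_with (\<lambda>x. True) (subtopology (Euclidean_space M) P)
      (subtopology (Euclidean_space M) P) (id \<circ> r) id"
    unfolding homotopic_with_def
  proof (intro exI conjI allI ballI)
    define h where "h = (\<lambda>(t, x) i. (1 - t) * r x i + t * x i :: real)"
    show "h (0, x) = (id \<circ> r) x" "h (1, x) = id x" for x by (auto simp: h_def)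
    have cr: "continuous_map (prod_topology (top_of_set {0..1::real}) (subtopology (Euclidean_space M) P)) euclideanreal
        (\<lambda>p. r (snd p) i)" for i
      using continuous_map_compose[OF continuous_map_snd rcomp[of i]] by (simp add: o_def)
    have cp: "continuous_map (prod_topology (top_of_set {0..1::real}) (subtopology (Euclidean_space M) P)) euclideanreal
        (\<lambda>p. snd p i)" for i
      using continuous_map_compose[OF continuous_map_snd proj[of i]] by (simp add: o_def)
    have ct: "continuous_map (prod_topology (top_of_set {0..1::real}) (subtopology (Euclidean_space M) P)) euclideanreal fst"
      by (rule continuous_map_into_fulltopology[OF continuous_map_fst])
    have "continuous_map (prod_topology (top_of_set {0..1::real}) (subtopology (Euclidean_space M) P)) euclideanreal
        (\<lambda>p. h p i)" for i
      unfolding h_def case_prod_unfold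
      by (intro continuous_intros cr cp ct) simp
    moreover have "h (t, x) \<in> {x. \<forall>i\<ge>M. x i = 0} \<inter> P" if t: "t \<in> {0..1}" and x: "x \<in> P" "\<forall>i\<ge>M. x i = 0" for t x
    proof
      show "h (t, x) \<in> {x. \<forall>i\<ge>M. x i = 0}" using x assms by (auto simp: h_def r_def)
      obtain i where i: "i \<le> j" "x i \<noteq> 0" using x by (auto simp: P_def)
      have "h (t, x) i = ((1 - t) / N x + t) * x i"
        using i by (simp add: h_def r_def distrib_right)
      moreover have "(1 - t) / N x + t > 0"
        using t Npos[OF x(1)] by (cases "t = 0") (auto intro: add_nonneg_pos)
      ultimately show "h (t, x) \<in> P" using i by (auto simp: P_def intro!: exI[of _ i])
    qed
    ultimately show "continuous_map (prod_topology (top_of_set {0..1}) (subtopology (Euclidean_space M) P))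
        (subtopology (Euclidean_space M) P) h"
      unfolding E continuous_map_in_subtopology continuous_map_componentwise_UNIV
      by (auto simp: image_subset_iff Pi_iff)
  qed auto
  ultimately show ?thesis
    unfolding homotopy_equivalent_space_def P_eq using r_cont id_cont by blast
qed

lemma homology_group_contractible:
  fixes p :: int
  assumes "contractible_space X" "topspace X \<noteq> {}"
  shows "homology_group 0 X \<cong> integer_group" "p \<noteq> 0 \<Longrightarrow> trivial_group (homology_group p X)"
proof -
  show "homology_group 0 X \<cong> integer_group"
    using assms isomorphic_integer_zeroth_homology_group contractible_imp_path_connected_space by blast
  show "trivial_group (homology_group p X)" if "p \<noteq> 0"
    using trivial_reduced_homology_group_contractible_space[OF assms(1), of p] un_reduced_homology_group[OF that] by metis
qed

text \<open>For positive \<open>j\<close>, contractibility of the ambient space identifies the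
  relative group with the reduced homology, one degree lower, of a space equivalent to the sphere of
  dimension \<open>j - 1\<close>. For \<open>j = 0\<close> the subspace is empty and the group is
  the homology of a contractible space.\<close>

lemma relative_homology_group_Euclidean:
  assumes "j \<le> M"
  shows "relative_homology_group (int j) (Euclidean_space M) {x. \<exists>i<j. x i \<noteq> 0} \<cong> integer_group"
    and "p \<noteq> int j \<Longrightarrow> trivial_group (relative_homology_group p (Euclidean_space M) {x. \<exists>i<j. x i \<noteq> 0})"
proof -
  have ne: "topspace (Euclidean_space M) \<noteq> {}" by (auto simp: topspace_Euclidean_space)
  have "relative_homology_group (int j) (Euclidean_space M) {x. \<exists>i<j. x i \<noteq> 0} \<cong> integer_group \<and>
    (p \<noteq> int j \<longrightarrow> trivial_group (relative_homology_group p (Euclidean_space M) {x. \<exists>i<j. x i \<noteq> 0}))"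
  proof (cases j)
    case 0
    then show ?thesis using homology_group_contractible[OF contractible_Euclidean_space ne] by simp
  next
    case (Suc k)
    define S where "S = subtopology (Euclidean_space M) {x. \<exists>i<j. x i \<noteq> 0}"
    have heq: "S homotopy_equivalent_space nsphere k"
      using nonzero_space_homotopy_equivalent_nsphere[of k M] assms Suc unfolding S_def by simp
    have "(\<lambda>i. if i = 0 then 1 else 0) \<in> topspace (Euclidean_space M) \<inter> {x. \<exists>i<j. x i \<noteq> 0}"
      using assms Suc by (auto simp: topspace_Euclidean_space intro: exI[of _ 0])
    then have iso1: "relative_homology_group q (Euclidean_space M) {x. \<exists>i<j. x i \<noteq> 0} \<cong>
        reduced_homology_group (q - 1) S" for q
      unfolding S_def by (intro isomorphic_group_relative_homology_of_contractible) auto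
    have iso2: "reduced_homology_group q S \<cong> reduced_homology_group q (nsphere k)" for q
      by (rule homotopy_equivalent_space_imp_isomorphic_reduced_homology_groups[OF heq])
    have iso: "relative_homology_group q (Euclidean_space M) {x. \<exists>i<j. x i \<noteq> 0} \<cong>
        reduced_homology_group (q - 1) (nsphere k)" for q
      using iso_trans[OF iso1 iso2] .
    have k: "int j - 1 = int k" using Suc by simp
    have "relative_homology_group (int j) (Euclidean_space M) {x. \<exists>i<j. x i \<noteq> 0} \<cong> integer_group"
      using iso_trans[OF iso[of "int j", unfolded k] reduced_homology_group_nsphere(1)] .
    moreover have "trivial_group (relative_homology_group p (Euclidean_space M) {x. \<exists>i<j. x i \<noteq> 0})"
      if "p \<noteq> int j"
    proof -
      have "p - 1 \<noteq> int k" using that Suc by simp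
      then have "trivial_group (reduced_homology_group (p - 1) (nsphere k))"
        by (rule reduced_homology_group_nsphere(2))
      then show ?thesis using isomorphic_group_triviality[OF iso[of p]] by simp
    qed
    ultimately show ?thesis by blast
  qed
  then show "relative_homology_group (int j) (Euclidean_space M) {x. \<exists>i<j. x i \<noteq> 0} \<cong> integer_group"
    "p \<noteq> int j \<Longrightarrow> trivial_group (relative_homology_group p (Euclidean_space M) {x. \<exists>i<j. x i \<noteq> 0})" by auto
qed

text \<open>Excise the complement of \<open>U\<close>: it is closed and, since \<open>A\<close> and
  \<open>U\<close> cover the space, contained in the open set \<open>A\<close>. What remains is the
  pair that \<open>f\<close> carries to Euclidean space and the complement of a coordinate
  subspace.\<close>

lemma relative_homology_group_attach_chart:
  assumes A: "openin X A" and U: "openin X U" and un: "topspace X = A \<union> U"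
    and f: "homeomorphic_map (subtopology X U) (Euclidean_space M) f"
    and fA: "f ` (U \<inter> A) = {x \<in> topspace (Euclidean_space M). \<exists>i<j. x i \<noteq> 0}"
    and j: "j \<le> M"
  shows "relative_homology_group (int j) X A \<cong> integer_group"
    and "p \<noteq> int j \<Longrightarrow> trivial_group (relative_homology_group p X A)"
proof -
  define V where "V = topspace X - U"
  have UA: "U \<subseteq> topspace X" "A \<subseteq> topspace X" using U A openin_subset by auto
  have V: "X closure_of V \<subseteq> X interior_of A"
  proof -
    have "closedin X V" using U by (auto simp: V_def)
    then have "X closure_of V = V" by (rule closure_of_closedin)
    moreover have "X interior_of A = A" using A by (rule interior_of_openin)
    ultimately show ?thesis using un by (auto simp: V_def)
  qed
  have eqs: "topspace X - V = U" "A - V = U \<inter> A" using UA by (auto simp: V_def)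
  have "relative_homology_group q (subtopology X U) (U \<inter> A) \<cong> relative_homology_group q X A" for q
    using homology_excision_axiom[OF V UA(2), of q] unfolding eqs subtopology_topspace by (rule is_isoI)
  then have 1: "relative_homology_group q X A \<cong> relative_homology_group q (subtopology X U) (U \<inter> A)" for q
    by (meson group.iso_sym group_relative_homology_group)
  have 0: "relative_homology_group q (subtopology X U) (U \<inter> A) \<cong>
      relative_homology_group q (Euclidean_space M) {x \<in> topspace (Euclidean_space M). \<exists>i<j. x i \<noteq> 0}" for q
    by (rule is_isoI[OF homeomorphic_map_relative_homology_iso[OF f _ fA]]) (use UA in auto)
  have eq: "{x \<in> topspace (Euclidean_space M). \<exists>i<j. x i \<noteq> 0} = topspace (Euclidean_space M) \<inter> {x. \<exists>i<j. x i \<noteq> 0}"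
    by auto
  have 2: "relative_homology_group q (subtopology X U) (U \<inter> A) \<cong>
      relative_homology_group q (Euclidean_space M) {x. \<exists>i<j. x i \<noteq> 0}" for q
    using 0[of q] unfolding eq relative_homology_group_restrict .
  have 3: "relative_homology_group q X A \<cong> relative_homology_group q (Euclidean_space M) {x. \<exists>i<j. x i \<noteq> 0}" for q
    using iso_trans[OF 1 2] .
  show "relative_homology_group (int j) X A \<cong> integer_group"
    using iso_trans[OF 3 relative_homology_group_Euclidean(1)[OF j]] .
  show "p \<noteq> int j \<Longrightarrow> trivial_group (relative_homology_group p X A)"
    using isomorphic_group_triviality[OF 3[of p]] relative_homology_group_Euclidean(2)[OF j, of p] by simp
qed

lemma cycle_basis_empty:
  "topspace X = {} \<Longrightarrow> cycle_basis k X 0 z"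
  by (auto simp: cycle_basis_def singular_relcycle singular_chain_empty)

text \<open>Induction on the number of charts attached. The real codimension \<open>2 * c l\<close>
  of the part of \<open>U l\<close> outside the earlier charts is even, so every attachment meets
  the hypotheses of \<open>cycle_basis_attach_even\<close> and adds one class in that
  degree.\<close>

lemma cycle_basis_even_cells:
  fixes U :: "nat \<Rightarrow> 'a set"
  assumes top: "topspace X = (\<Union>l<r. U l)"
    and op: "\<And>l. l < r \<Longrightarrow> openin X (U l)"
    and f: "\<And>l. l < r \<Longrightarrow> homeomorphic_map (subtopology X (U l)) (Euclidean_space (M l)) (f l)"
    and fA: "\<And>l. l < r \<Longrightarrow> f l ` (U l \<inter> (\<Union>j<l. U j)) =
               {x \<in> topspace (Euclidean_space (M l)). \<exists>i<2 * c l. x i \<noteq> 0}"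
    and cM: "\<And>l. l < r \<Longrightarrow> 2 * c l \<le> M l"
  shows "\<exists>z. cycle_basis k X (card {l. l < r \<and> 2 * c l = k}) z"
proof -
  have "\<exists>z. cycle_basis k (subtopology X (\<Union>l<s. U l)) (card {l. l < s \<and> 2 * c l = k}) z" if "s \<le> r" for s k
    using that
  proof (induction s arbitrary: k)
    case 0
    show ?case using cycle_basis_empty[of "subtopology X (\<Union>l<0. U l)"] by auto
  next
    case (Suc s)
    define Y where "Y = subtopology X (\<Union>l<Suc s. U l)"
    define A where "A = (\<Union>l<s. U l)"
    have s: "s < r" using Suc by simp
    have Un: "(\<Union>l<Suc s. U l) = A \<union> U s" by (auto simp: A_def less_Suc_eq)
    have "openin X A" unfolding A_def using op s by (intro openin_Union) auto
    then have A: "openin Y A" unfolding Y_def Un using op[OF s] by (simp add: openin_open_subtopology openin_Un)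
    have Us: "openin Y (U s)" unfolding Y_def Un using \<open>openin X A\<close> op[OF s] by (simp add: openin_open_subtopology openin_Un)
    have topY: "topspace Y = A \<union> U s"
      using openin_subset[OF \<open>openin X A\<close>] openin_subset[OF op[OF s]] by (auto simp: Y_def Un)
    have subA: "subtopology Y A = subtopology X (\<Union>l<s. U l)" "subtopology Y (U s) = subtopology X (U s)"
      unfolding Y_def Un subtopology_subtopology A_def[symmetric] by (simp_all add: Int_absorb1)
    note att = relative_homology_group_attach_chart[OF A Us topY _ _ cM[OF s], unfolded subA, OF f[OF s] fA[OF s, folded A_def]]
    have "\<exists>z. cycle_basis k Y (card {l. l < s \<and> 2 * c l = k} + (if k = 2 * c s then 1 else 0)) z"
    proof (rule cycle_basis_attach_even)
      show "\<exists>z. cycle_basis k (subtopology Y A) (card {l. l < s \<and> 2 * c l = k}) z" for k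
        unfolding subA using Suc by simp
      show "card {l. l < s \<and> 2 * c l = k} = 0" if "odd k" for k
      proof -
        have "{l. l < s \<and> 2 * c l = k} = {}" using that by auto
        then show ?thesis by (simp only: card.empty)
      qed
      show "trivial_group (relative_homology_group (int k) Y A)" if "k \<noteq> 2 * c s" for k
        using att(2)[of "int k"] that by simp
      show "relative_homology_group (int (2 * c s)) Y A \<cong> integer_group" by (rule att(1))
    qed
    moreover have "{l. l < Suc s \<and> 2 * c l = k} = {l. l < s \<and> 2 * c l = k} \<union> (if k = 2 * c s then {s} else {})"
      by (auto simp: less_Suc_eq)
    then have "card {l. l < Suc s \<and> 2 * c l = k} = card {l. l < s \<and> 2 * c l = k} + (if k = 2 * c s then 1 else 0)"
      by (auto simp: card_insert_if)
    ultimately show ?case by (simp add: Y_def)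
  qed
  from this[of r k] show ?thesis unfolding top[symmetric] subtopology_topspace by simp
qed

section \<open>Rational cochains\<close>

text \<open>The pairing of a rational cochain with an integral chain. The cochain is an arbitrary
  function, so the algebra of this section can be done before any space is fixed.\<close>

definition cochain_eval :: "('s \<Rightarrow> rat) \<Rightarrow> ('s \<Rightarrow>\<^sub>0 int) \<Rightarrow> rat" where
  "cochain_eval c x = (\<Sum>\<sigma>\<in>Poly_Mapping.keys x. of_int (Poly_Mapping.lookup x \<sigma>) * c \<sigma>)"

lemma cochain_eval_superset:
  "finite S \<Longrightarrow> Poly_Mapping.keys x \<subseteq> S \<Longrightarrow>
     cochain_eval c x = (\<Sum>\<sigma>\<in>S. of_int (Poly_Mapping.lookup x \<sigma>) * c \<sigma>)"
  unfolding cochain_eval_def by (rule sum.mono_neutral_left) (auto simp: in_keys_iff)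

lemma cochain_eval_0 [simp]: "cochain_eval c 0 = 0"
  by (simp add: cochain_eval_def)

lemma cochain_eval_of [simp]: "cochain_eval c (frag_of \<sigma>) = c \<sigma>"
  by (simp add: cochain_eval_def)

lemma cochain_eval_add: "cochain_eval c (x + y) = cochain_eval c x + cochain_eval c y"
proof -
  let ?S = "Poly_Mapping.keys x \<union> Poly_Mapping.keys y"
  have "Poly_Mapping.keys (x + y) \<subseteq> ?S" by (rule Poly_Mapping.keys_add)
  then show ?thesis
    by (simp add: cochain_eval_superset[of ?S] lookup_add distrib_right sum.distrib)
qed

lemma cochain_eval_cmul: "cochain_eval c (frag_cmul a x) = of_int a * cochain_eval c x"
proof -
  have "Poly_Mapping.keys (frag_cmul a x) \<subseteq> Poly_Mapping.keys x" by (rule keys_cmul)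
  then show ?thesis
    by (simp add: cochain_eval_superset[of "Poly_Mapping.keys x"] sum_distrib_left mult.assoc)
qed

lemma cochain_eval_minus: "cochain_eval c (- x) = - cochain_eval c x"
  using cochain_eval_cmul[of c "-1" x] by simp

lemma cochain_eval_diff: "cochain_eval c (x - y) = cochain_eval c x - cochain_eval c y"
  using cochain_eval_add[of c x "- y"] by (simp add: cochain_eval_minus)

lemma cochain_eval_sum: "cochain_eval c (sum f I) = (\<Sum>i\<in>I. cochain_eval c (f i))"
  by (induction I rule: infinite_finite_induct) (auto simp: cochain_eval_add)

lemma cochain_eval_cong:
  "(\<And>\<sigma>. \<sigma> \<in> Poly_Mapping.keys x \<Longrightarrow> b \<sigma> = c \<sigma>) \<Longrightarrow> cochain_eval b x = cochain_eval c x"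
  unfolding cochain_eval_def by (rule sum.cong) auto

lemma cochain_eval_lincomb:
  "cochain_eval (\<lambda>\<sigma>. \<Sum>j\<in>J. v j * f j \<sigma>) x = (\<Sum>j\<in>J. v j * cochain_eval (f j) x)"
  unfolding cochain_eval_def
  by (simp add: sum_distrib_left sum.swap[of _ J] mult.left_commute)

text \<open>Finitely supported rational functions are the rational chains. Integral chains embed
  into them by \<open>rat_chain\<close>, which turns the extension of homomorphisms into the
  extension of linear maps.\<close>

definition rat_scale :: "rat \<Rightarrow> ('s \<Rightarrow>\<^sub>0 rat) \<Rightarrow> ('s \<Rightarrow>\<^sub>0 rat)" where
  "rat_scale q v = Poly_Mapping.map ((*) q) v"

definition rat_chain :: "('s \<Rightarrow>\<^sub>0 int) \<Rightarrow> ('s \<Rightarrow>\<^sub>0 rat)" where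
  "rat_chain x = Poly_Mapping.map rat_of_int x"

lemma lookup_rat_scale [simp]: "Poly_Mapping.lookup (rat_scale q v) \<sigma> = q * Poly_Mapping.lookup v \<sigma>"
  by (simp add: rat_scale_def Poly_Mapping.map.rep_eq when_def)

lemma lookup_rat_chain [simp]: "Poly_Mapping.lookup (rat_chain x) \<sigma> = of_int (Poly_Mapping.lookup x \<sigma>)"
  by (simp add: rat_chain_def Poly_Mapping.map.rep_eq when_def)

lemma rat_chain_add: "rat_chain (x + y) = rat_chain x + rat_chain y"
  by (rule poly_mapping_eqI) (simp add: lookup_add)

lemma rat_chain_0 [simp]: "rat_chain 0 = 0"
  by (rule poly_mapping_eqI) simp

lemma rat_chain_cmul: "rat_chain (frag_cmul a x) = rat_scale (of_int a) (rat_chain x)"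
  by (rule poly_mapping_eqI) simp

lemma rat_chain_inj: "rat_chain x = rat_chain y \<Longrightarrow> x = y"
  by (rule poly_mapping_eqI) (metis lookup_rat_chain of_int_eq_iff)

interpretation rat_chains: vector_space "rat_scale :: rat \<Rightarrow> ('s \<Rightarrow>\<^sub>0 rat) \<Rightarrow> _"
  by unfold_locales (auto intro!: poly_mapping_eqI simp: lookup_add algebra_simps)

interpretation rat_functionals: vector_space_pair "rat_scale :: rat \<Rightarrow> ('s \<Rightarrow>\<^sub>0 rat) \<Rightarrow> _" "(*) :: rat \<Rightarrow> rat \<Rightarrow> rat"
  by unfold_locales (auto simp: algebra_simps)

text \<open>Injectivity of the abelian group \<open>\<rat>\<close>, in the only case that is needed.\<close>

lemma additive_extension_to_cochain:
  fixes H :: "('s \<Rightarrow>\<^sub>0 int) set" and h :: "('s \<Rightarrow>\<^sub>0 int) \<Rightarrow> rat"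
  assumes H0: "0 \<in> H"
    and Hadd: "\<And>x y. x \<in> H \<Longrightarrow> y \<in> H \<Longrightarrow> x + y \<in> H"
    and Hcmul: "\<And>a x. x \<in> H \<Longrightarrow> frag_cmul a x \<in> H"
    and hadd: "\<And>x y. x \<in> H \<Longrightarrow> y \<in> H \<Longrightarrow> h (x + y) = h x + h y"
    and hcmul: "\<And>a x. x \<in> H \<Longrightarrow> h (frag_cmul a x) = of_int a * h x"
  obtains c where "\<And>x. x \<in> H \<Longrightarrow> cochain_eval c x = h x"
proof -
  \<comment> \<open>\<open>B\<close> is a basis of the rational span of \<open>H\<close> made of
    elements of \<open>H\<close>; the linear functional \<open>g\<close> below is prescribed on it
    by \<open>h\<close>.\<close>
  obtain B where B: "B \<subseteq> rat_chain ` H" "rat_chains.independent B" "rat_chain ` H \<subseteq> rat_chains.span B"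
    by (rule rat_chains.maximal_independent_subset)
  define h' where "h' v = h (the_inv_into UNIV rat_chain v)" for v
  have inj: "inj rat_chain" by (rule injI) (rule rat_chain_inj)
  have h': "h' (rat_chain x) = h x" for x by (simp add: h'_def the_inv_into_f_f[OF inj])
  obtain g where g: "Vector_Spaces.linear rat_scale (*) g" and gB: "\<And>v. v \<in> B \<Longrightarrow> g v = h' v"
    using rat_functionals.linear_independent_extend[OF B(2), of h'] by blast
  have g_add: "g (u + v) = g u + g v" for u v
    using rat_functionals.linear_add[OF g] .
  have g_scale: "g (rat_scale q v) = q * g v" for q v
    using rat_functionals.linear_scale[OF g] .
  have gsum: "g (sum f I) = (\<Sum>i\<in>I. g (f i))" for f :: "'s \<Rightarrow> _" and I
    using rat_functionals.linear_sum[OF g] .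
  \<comment> \<open>A linear functional is determined by its values on single simplices, and these
    values form the cochain that is sought.\<close>
  have g_eval: "g (rat_chain x) = cochain_eval (\<lambda>\<sigma>. g (rat_chain (frag_of \<sigma>))) x" for x
  proof -
    have "rat_chain x = (\<Sum>\<sigma>\<in>Poly_Mapping.keys x. rat_scale (of_int (Poly_Mapping.lookup x \<sigma>)) (rat_chain (frag_of \<sigma>)))"
    proof (rule poly_mapping_eqI)
      fix \<tau>
      have "(\<Sum>\<sigma>\<in>Poly_Mapping.keys x. rat_of_int (Poly_Mapping.lookup x \<sigma>) * rat_of_int (if \<tau> = \<sigma> then 1 else 0)) =
          (\<Sum>\<sigma>\<in>Poly_Mapping.keys x. if \<tau> = \<sigma> then rat_of_int (Poly_Mapping.lookup x \<sigma>) else 0)"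
        by (rule sum.cong) auto
      then show "Poly_Mapping.lookup (rat_chain x) \<tau> = Poly_Mapping.lookup
          (\<Sum>\<sigma>\<in>Poly_Mapping.keys x. rat_scale (of_int (Poly_Mapping.lookup x \<sigma>)) (rat_chain (frag_of \<sigma>))) \<tau>"
        by (simp add: lookup_sum in_keys_iff)
    qed
    then have "g (rat_chain x) = g (\<Sum>\<sigma>\<in>Poly_Mapping.keys x. rat_scale (of_int (Poly_Mapping.lookup x \<sigma>)) (rat_chain (frag_of \<sigma>)))"
      by (rule arg_cong)
    then show ?thesis by (simp add: gsum g_scale cochain_eval_def)
  qed
  \<comment> \<open>Clearing denominators: some positive multiple of any \<open>v\<close> in the
    span comes from \<open>H\<close>, and there \<open>g\<close> and \<open>h\<close> agree.
    Agreement on \<open>B\<close> thus spreads to all of \<open>H\<close>.\<close>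
  have span: "\<exists>n x. n > 0 \<and> x \<in> H \<and> rat_scale (of_int n) v = rat_chain x \<and> of_int n * g v = h x"
    if "v \<in> rat_chains.span B" for v
    using that
  proof (induction rule: rat_chains.span_induct_alt)
    case base
    have "h 0 = 0" using hcmul[OF H0, of 0] by simp
    then show ?case
      using H0 rat_functionals.linear_0[OF g] by (intro exI[of _ "1::int"] exI[of _ "0 :: 's \<Rightarrow>\<^sub>0 int"]) simp
  next
    case (step q b v)
    from step(2) obtain n x where n: "n > 0" "x \<in> H" "rat_scale (of_int n) v = rat_chain x" "of_int n * g v = h x"
      by (elim exE conjE)
    from step(1) B(1) obtain y where y: "y \<in> H" "b = rat_chain y" by blast
    have gb: "g b = h y" using gB[OF step(1)] h' y by simp
    obtain s t where st: "q = of_int s / of_int t" "t > 0" using quotient_of_div[of q "fst (quotient_of q)" "snd (quotient_of q)"] quotient_of_denom_pos'[of q] by simp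
    \<comment> \<open>\<open>n\<close> clears the denominators of \<open>v\<close> and
      \<open>t\<close> that of \<open>q\<close>, so \<open>n * t\<close> serves for the sum.\<close>
    have e1: "frag_cmul (n * s) y + frag_cmul t x \<in> H" by (rule Hadd[OF Hcmul[OF y(1)] Hcmul[OF n(2)]])
    have "rat_scale (of_int (n * t)) (rat_scale q b + v) =
        rat_scale (of_int (n * t) * q) b + rat_scale (of_int t) (rat_scale (of_int n) v)"
      by (rule poly_mapping_eqI) (simp add: lookup_add algebra_simps)
    also have "of_int (n * t) * q = of_int (n * s)" using st by simp
    finally have e2: "rat_scale (of_int (n * t)) (rat_scale q b + v) = rat_chain (frag_cmul (n * s) y + frag_cmul t x)"
      by (simp only: n(3) y(2) rat_chain_add rat_chain_cmul)
    have "of_int (n * t) * g (rat_scale q b + v) = of_int (n * t) * q * g b + of_int t * (of_int n * g v)"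
      by (simp only: g_add g_scale of_int_mult distrib_left mult.assoc mult.left_commute[of "of_int t" "of_int n"])
    also have "\<dots> = h (frag_cmul (n * s) y + frag_cmul t x)"
    proof -
      have "of_int (n * t) * q = of_int (n * s)" using st by simp
      then show ?thesis
        by (simp only: hadd[OF Hcmul[OF y(1)] Hcmul[OF n(2)]] hcmul[OF y(1)] hcmul[OF n(2)] gb n(4))
    qed
    finally show ?case
      by (intro exI[of _ "n * t"] exI[of _ "frag_cmul (n * s) y + frag_cmul t x"] conjI
          mult_pos_pos[OF n(1) st(2)] e1 e2)
  qed
  have "cochain_eval (\<lambda>\<sigma>. g (rat_chain (frag_of \<sigma>))) x = h x" if x: "x \<in> H" for x
  proof -
    have "rat_chain x \<in> rat_chains.span B" using B(3) x by blast
    from span[OF this] obtain n y where ny: "n > 0" "y \<in> H" "rat_scale (of_int n) (rat_chain x) = rat_chain y" "of_int n * g (rat_chain x) = h y"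
      by (elim exE conjE)
    \<comment> \<open>By injectivity of \<open>rat_chain\<close> the element of \<open>H\<close>
      found above is \<open>n\<close> times \<open>x\<close>, and \<open>n\<close> can be cancelled
      in the rationals.\<close>
    have "rat_chain (frag_cmul n x) = rat_chain y" using ny(3) by (simp add: rat_chain_cmul)
    then have "y = frag_cmul n x" by (rule rat_chain_inj[symmetric])
    then have "of_int n * g (rat_chain x) = of_int n * h x" using ny(4) hcmul[OF x, of n] by simp
    then have "g (rat_chain x) = h x" using ny(1) by simp
    then show ?thesis unfolding g_eval[of x] .
  qed
  then show thesis by (rule that)
qed

text \<open>A cochain that kills cycles depends on a chain only through its boundary: two chains
  with the same boundary differ by a cycle. The function induced on boundaries extends to a cochain
  by \<open>additive_extension_to_cochain\<close>. This is the vanishing of the Ext term in the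
  universal coefficient theorem.\<close>

lemma cochain_factors_through_boundary:
  assumes c: "\<And>x. singular_relcycle k X {} x \<Longrightarrow> cochain_eval c x = 0"
  obtains b where "\<And>x. singular_chain k X x \<Longrightarrow> cochain_eval c x = cochain_eval b (chain_boundary k x)"
proof -
  define H where "H = chain_boundary k ` singular_chain_set k X"
  define h where "h y = cochain_eval c (SOME x. singular_chain k X x \<and> chain_boundary k x = y)" for y
  have h: "h (chain_boundary k x) = cochain_eval c x" if x: "singular_chain k X x" for x
  proof -
    define x' where "x' = (SOME x'. singular_chain k X x' \<and> chain_boundary k x' = chain_boundary k x)"
    have "singular_chain k X x' \<and> chain_boundary k x' = chain_boundary k x"
      unfolding x'_def by (rule someI[of _ x]) (use x in simp)
    then have "singular_relcycle k X {} (x' - x)"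
      using x by (simp add: singular_cycle singular_chain_diff chain_boundary_diff)
    then have "cochain_eval c x' = cochain_eval c x" using c[of "x' - x"] by (simp add: cochain_eval_diff)
    then show ?thesis by (simp add: h_def x'_def)
  qed
  obtain b where b: "\<And>y. y \<in> H \<Longrightarrow> cochain_eval b y = h y"
  proof (rule additive_extension_to_cochain[of H h])
    show "0 \<in> H" unfolding H_def by (rule image_eqI[of _ _ 0]) auto
  next
    fix x y assume "x \<in> H" "y \<in> H"
    then obtain u v where uv: "singular_chain k X u" "singular_chain k X v" "x = chain_boundary k u" "y = chain_boundary k v"
      by (auto simp: H_def)
    then have e: "x + y = chain_boundary k (u + v)" "singular_chain k X (u + v)"
      by (auto simp: chain_boundary_add singular_chain_add)
    then show "x + y \<in> H" by (auto simp: H_def)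
    show "h (x + y) = h x + h y" using uv e by (simp add: h cochain_eval_add)
  next
    fix a x assume "x \<in> H"
    then obtain u where u: "singular_chain k X u" "x = chain_boundary k u" by (auto simp: H_def)
    then have e: "frag_cmul a x = chain_boundary k (frag_cmul a u)" "singular_chain k X (frag_cmul a u)"
      by (auto simp: chain_boundary_cmul singular_chain_cmul)
    then show "frag_cmul a x \<in> H" by (auto simp: H_def)
    show "h (frag_cmul a x) = of_int a * h x" using u e by (simp add: h cochain_eval_cmul)
  qed (rule that)
  have "cochain_eval c x = cochain_eval b (chain_boundary k x)" if "singular_chain k X x" for x
    using b h that by (simp add: H_def)
  then show thesis by (rule that)
qed

text \<open>On the group \<open>H\<close> of chains homologous to a combination of the
  \<open>z i\<close>, reading off the coefficients is well defined by independence of the basis and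
  kills boundaries. Weighting the coefficients by \<open>q\<close> and extending to all chains gives
  the cochain.\<close>

lemma cochain_with_values_on_cycle_basis:
  assumes z: "cycle_basis k X r z"
  obtains c where "\<And>i. i < r \<Longrightarrow> cochain_eval c (z i) = q i"
    "\<And>x. singular_relboundary k X {} x \<Longrightarrow> cochain_eval c x = 0"
proof -
  define S where "S a = (\<Sum>i<r. frag_cmul (a i) (z i))" for a :: "nat \<Rightarrow> int"
  have S_add: "S a + S b = S (\<lambda>i. a i + b i)" for a b
    by (simp add: S_def frag_cmul_distrib sum.distrib)
  have S_diff: "S a - S b = S (\<lambda>i. a i - b i)" for a b
    by (simp add: S_def frag_cmul_diff_distrib sum_subtractf)
  have S_cmul: "frag_cmul m (S a) = S (\<lambda>i. m * a i)" for a m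
    by (simp add: S_def frag_cmul_sum)
  have S_inj: "\<forall>i<r. a i = 0" if "singular_relboundary k X {} (S a)" for a
    using z that by (simp add: cycle_basis_def S_def)
  define Q where "Q a = (\<Sum>i<r. of_int (a i) * q i)" for a :: "nat \<Rightarrow> int"
  define H where "H = {x. \<exists>a. singular_relboundary k X {} (x - S a)}"
  define h where "h x = Q (SOME a. singular_relboundary k X {} (x - S a))" for x
  have h: "h x = Q a" if a: "singular_relboundary k X {} (x - S a)" for x a
  proof -
    define b where "b = (SOME a. singular_relboundary k X {} (x - S a))"
    have b: "singular_relboundary k X {} (x - S b)" unfolding b_def by (rule someI[of _ a]) (rule a)
    have "singular_relboundary k X {} (S (\<lambda>i. a i - b i))"
      using singular_relboundary_diff[OF b a] by (simp add: S_diff[symmetric])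
    then have "\<forall>i<r. a i = b i" using S_inj[of "\<lambda>i. a i - b i"] by simp
    then show ?thesis by (simp add: h_def b_def[symmetric] Q_def)
  qed
  obtain c where c: "\<And>x. x \<in> H \<Longrightarrow> cochain_eval c x = h x"
  proof (rule additive_extension_to_cochain[of H h])
    have "S (\<lambda>_. 0) = 0" by (simp add: S_def)
    then show "0 \<in> H" unfolding H_def by (auto intro!: exI[of _ "\<lambda>_. 0"])
  next
    fix x y assume "x \<in> H" "y \<in> H"
    then obtain a b where ab: "singular_relboundary k X {} (x - S a)" "singular_relboundary k X {} (y - S b)"
      by (auto simp: H_def)
    have sum: "singular_relboundary k X {} (x + y - S (\<lambda>i. a i + b i))"
      using singular_relboundary_add[OF ab] by (simp add: S_add[symmetric] add_diff_add)
    then show "x + y \<in> H" by (auto simp: H_def)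
    show "h (x + y) = h x + h y"
      unfolding h[OF ab(1)] h[OF ab(2)] h[OF sum] by (simp add: Q_def distrib_right sum.distrib)
  next
    fix m x assume "x \<in> H"
    then obtain a where a: "singular_relboundary k X {} (x - S a)" by (auto simp: H_def)
    have "frag_cmul m (x - S a) + frag_cmul m (S a) = frag_cmul m x"
      by (simp flip: frag_cmul_distrib2)
    then have "frag_cmul m x - S (\<lambda>i. m * a i) = frag_cmul m (x - S a)"
      unfolding S_cmul by (rule add_implies_diff[symmetric])
    then have mult: "singular_relboundary k X {} (frag_cmul m x - S (\<lambda>i. m * a i))"
      using singular_relboundary_cmul[OF a] by simp
    then show "frag_cmul m x \<in> H" by (auto simp: H_def)
    show "h (frag_cmul m x) = of_int m * h x"
      unfolding h[OF a] h[OF mult] by (simp add: Q_def sum_distrib_left mult.assoc)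
  qed (rule that)
  show thesis
  proof (rule that[of c])
    fix i assume i: "i < r"
    have "S (\<lambda>j. if j = i then 1 else 0) = z i"
      using i by (simp add: S_def if_distrib[of "\<lambda>n. frag_cmul n _"] cong: if_cong)
    then have "singular_relboundary k X {} (z i - S (\<lambda>j. if j = i then 1 else 0))" by simp
    then show "cochain_eval c (z i) = q i"
      using c[of "z i"] h[of "z i" "\<lambda>j. if j = i then 1 else 0"] i
      by (auto simp: H_def Q_def if_distrib[of of_int] if_distrib[of "\<lambda>n. n * _"] cong: if_cong)
  next
    fix x assume "singular_relboundary k X {} x"
    then have "singular_relboundary k X {} (x - S (\<lambda>_. 0))" by (simp add: S_def)
    then show "cochain_eval c x = 0" using c[of x] h[of x "\<lambda>_. 0"] by (auto simp: H_def Q_def)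
  qed
qed

section \<open>The universal coefficient theorem\<close>

context
  fixes R :: "('r, 'm) ring_scheme" and M :: "('r, 'a, 'n) module_scheme" and N :: "'a set"
  assumes modM: "module R M" and subN: "submodule R N M"
begin

interpretation M: module R M by (rule modM)
interpretation N: submodule R N M by (rule subN)

lemma submodule_abelian_subgroup: "abelian_subgroup N M"
proof (rule abelian_subgroupI3)
  show "additive_subgroup N M"
  proof (rule additive_subgroup.intro, rule M.add.subgroupI)
    show "N \<subseteq> carrier M" by (rule N.subset)
    show "N \<noteq> {}" using N.zero_closed by blast
  next
    fix v assume v: "v \<in> N"
    then have "\<ominus>\<^bsub>M\<^esub> v = (\<ominus>\<^bsub>R\<^esub> \<one>\<^bsub>R\<^esub>) \<odot>\<^bsub>M\<^esub> v"
      using M.smult_minus_1[of v] N.subset by auto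
    then show "\<ominus>\<^bsub>M\<^esub> v \<in> N" using v N.smult_closed by simp
  qed (rule N.m_closed)
qed (rule M.abelian_group_axioms)

interpretation AN: abelian_subgroup N M by (rule submodule_abelian_subgroup)

lemma coset_eq_iff:
  assumes "x \<in> carrier M" "y \<in> carrier M"
  shows "N +>\<^bsub>M\<^esub> x = N +>\<^bsub>M\<^esub> y \<longleftrightarrow> (\<exists>h\<in>N. x = h \<oplus>\<^bsub>M\<^esub> y)"
proof -
  have "N +>\<^bsub>M\<^esub> x = N +>\<^bsub>M\<^esub> y \<longleftrightarrow> x \<in> N +>\<^bsub>M\<^esub> y"
    using AN.a_repr_independence'[of x y] AN.a_rcos_self[OF assms(1)] assms by auto
  then show ?thesis by (auto simp: a_r_coset_def')
qed

lemma carrier_quotient_module: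
  "carrier (quotient_module M N) = (\<lambda>x. N +>\<^bsub>M\<^esub> x) ` carrier M"
  by (auto simp: quotient_module_def A_RCOSETS_def')

lemma add_quotient_module:
  "x \<in> carrier M \<Longrightarrow> y \<in> carrier M \<Longrightarrow>
    (N +>\<^bsub>M\<^esub> x) \<oplus>\<^bsub>quotient_module M N\<^esub> (N +>\<^bsub>M\<^esub> y) = N +>\<^bsub>M\<^esub> (x \<oplus>\<^bsub>M\<^esub> y)"
  by (simp add: quotient_module_def AN.a_rcos_sum)

lemma zero_quotient_module: "\<zero>\<^bsub>quotient_module M N\<^esub> = N +>\<^bsub>M\<^esub> \<zero>\<^bsub>M\<^esub>"
  using AN.a_rcos_const[OF N.zero_closed] by (simp add: quotient_module_def)

text \<open>The union in \<open>quotient_module\<close> runs over the representatives of a coset.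
  They all give the same coset because \<open>N\<close> is closed under scalars, and there is at
  least one of them.\<close>

lemma smult_quotient_module:
  assumes c: "c \<in> carrier R" and x: "x \<in> carrier M"
  shows "c \<odot>\<^bsub>quotient_module M N\<^esub> (N +>\<^bsub>M\<^esub> x) = N +>\<^bsub>M\<^esub> (c \<odot>\<^bsub>M\<^esub> x)"
proof -
  have "N +>\<^bsub>M\<^esub> (c \<odot>\<^bsub>M\<^esub> a) = N +>\<^bsub>M\<^esub> (c \<odot>\<^bsub>M\<^esub> x)" if a: "a \<in> N +>\<^bsub>M\<^esub> x" for a
  proof -
    obtain h where h: "h \<in> N" "a = h \<oplus>\<^bsub>M\<^esub> x" using a by (auto simp: a_r_coset_def')
    then have "c \<odot>\<^bsub>M\<^esub> a = c \<odot>\<^bsub>M\<^esub> h \<oplus>\<^bsub>M\<^esub> c \<odot>\<^bsub>M\<^esub> x"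
      using N.subset c x by (auto simp: M.smult_r_distr)
    moreover have "a \<in> carrier M" using h x N.subset by auto
    ultimately show ?thesis
      using coset_eq_iff[of "c \<odot>\<^bsub>M\<^esub> a" "c \<odot>\<^bsub>M\<^esub> x"] N.smult_closed[OF c h(1)] c x by auto
  qed
  moreover have "N +>\<^bsub>M\<^esub> x \<noteq> {}" using AN.a_rcos_self[OF x] by blast
  ultimately have "(\<Union>a\<in>N +>\<^bsub>M\<^esub> x. N +>\<^bsub>M\<^esub> (c \<odot>\<^bsub>M\<^esub> a)) = N +>\<^bsub>M\<^esub> (c \<odot>\<^bsub>M\<^esub> x)"
    by (intro SUP_eq_const)
  then show ?thesis by (simp only: quotient_module_def module.simps)
qed

lemma module_quotient_module: "module R (quotient_module M N)"
proof (rule module_criteria)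
  show "cring R" by (rule M.R.is_cring)
  let ?Q = "quotient_module M N"
  show "\<zero>\<^bsub>?Q\<^esub> \<in> carrier ?Q" by (simp add: zero_quotient_module carrier_quotient_module)
  show "\<forall>v\<in>carrier ?Q. \<exists>w\<in>carrier ?Q. v \<oplus>\<^bsub>?Q\<^esub> w = \<zero>\<^bsub>?Q\<^esub>"
  proof
    fix v assume "v \<in> carrier ?Q"
    then obtain x where x: "x \<in> carrier M" "v = N +>\<^bsub>M\<^esub> x" by (auto simp: carrier_quotient_module)
    show "\<exists>w\<in>carrier ?Q. v \<oplus>\<^bsub>?Q\<^esub> w = \<zero>\<^bsub>?Q\<^esub>"
      by (rule bexI[of _ "N +>\<^bsub>M\<^esub> (\<ominus>\<^bsub>M\<^esub> x)"])
        (use x in \<open>auto simp: zero_quotient_module carrier_quotient_module add_quotient_module M.M.r_neg\<close>)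
  qed
qed (auto simp: zero_quotient_module carrier_quotient_module add_quotient_module smult_quotient_module
    M.M.a_assoc M.M.a_comm M.M.a_lcomm M.smult_assoc1 M.smult_l_distr M.smult_r_distr)

end

section \<open>Cocycles and coboundaries as annihilators\<close>

lemma cring_class_ring_rat: "cring (class_ring :: rat ring)"
  by (rule domain.axioms(1)[OF field.axioms(1)[OF class_field]])

lemma module_cochain_space:
  "module (class_ring :: rat ring) (cochain_space k X)"
  unfolding cochain_space_def by (rule cring.func_space_is_module) (rule cring_class_ring_rat)

lemma cochain_space_simps:
  "carrier (cochain_space k X) = singular_simplex_set k X \<rightarrow>\<^sub>E UNIV"
  "\<zero>\<^bsub>cochain_space k X\<^esub> = (\<lambda>\<sigma>\<in>singular_simplex_set k X. 0)"
  "f \<oplus>\<^bsub>cochain_space k X\<^esub> g = (\<lambda>\<sigma>\<in>singular_simplex_set k X. f \<sigma> + g \<sigma>)"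
  "q \<odot>\<^bsub>cochain_space k X\<^esub> f = (\<lambda>\<sigma>\<in>singular_simplex_set k X. q * f \<sigma>)"
proof -
  show "carrier (cochain_space k X) = singular_simplex_set k X \<rightarrow>\<^sub>E UNIV"
    "\<zero>\<^bsub>cochain_space k X\<^esub> = (\<lambda>\<sigma>\<in>singular_simplex_set k X. 0)"
    "f \<oplus>\<^bsub>cochain_space k X\<^esub> g = (\<lambda>\<sigma>\<in>singular_simplex_set k X. f \<sigma> + g \<sigma>)"
    "q \<odot>\<^bsub>cochain_space k X\<^esub> f = (\<lambda>\<sigma>\<in>singular_simplex_set k X. q * f \<sigma>)"
    unfolding cochain_space_def ring.func_space_def[OF cring.axioms(1)[OF cring_class_ring_rat]]
    by (simp_all add: class_ring_simps)
qed

lemma cochain_eval_coboundary: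
  assumes "singular_chain (Suc k) X x"
  shows "cochain_eval (coboundary k X c) x = cochain_eval c (chain_boundary (Suc k) x)"
proof -
  have "cochain_eval (coboundary k X c) x =
      (\<Sum>\<sigma>\<in>Poly_Mapping.keys x. of_int (Poly_Mapping.lookup x \<sigma>) *
         cochain_eval c (chain_boundary (Suc k) (frag_of \<sigma>)))"
    unfolding cochain_eval_def[of _ x]
  proof (rule sum.cong[OF refl])
    fix \<sigma> assume "\<sigma> \<in> Poly_Mapping.keys x"
    then have \<sigma>: "singular_simplex (Suc k) X \<sigma>" using assms by (auto simp: singular_chain_def)
    have "cochain_eval c (chain_boundary (Suc k) (frag_of \<sigma>)) = coboundary k X c \<sigma>"
      using \<sigma> by (simp add: chain_boundary_of coboundary_def cochain_eval_sum cochain_eval_cmul del: sum.atMost_Suc)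
    then show "of_int (Poly_Mapping.lookup x \<sigma>) * coboundary k X c \<sigma> =
        of_int (Poly_Mapping.lookup x \<sigma>) * cochain_eval c (chain_boundary (Suc k) (frag_of \<sigma>))" by simp
  qed
  also have "\<dots> = cochain_eval c (\<Sum>\<sigma>\<in>Poly_Mapping.keys x.
      frag_cmul (Poly_Mapping.lookup x \<sigma>) (chain_boundary (Suc k) (frag_of \<sigma>)))"
    by (simp add: cochain_eval_sum cochain_eval_cmul)
  also have "(\<Sum>\<sigma>\<in>Poly_Mapping.keys x. frag_cmul (Poly_Mapping.lookup x \<sigma>) (chain_boundary (Suc k) (frag_of \<sigma>))) =
      chain_boundary (Suc k) x"
    by (simp add: chain_boundary_def frag_extend_def)
  finally show ?thesis .
qed

lemma chain_of_simplex: "singular_simplex k X \<sigma> \<Longrightarrow> singular_chain k X (frag_of \<sigma>)"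
  by (simp add: singular_chain_of)

text \<open>By adjointness of \<open>coboundary\<close> and \<open>chain_boundary\<close>, the
  coboundary vanishes on a simplex exactly when the cochain kills the boundary of that
  simplex.\<close>

lemma cocycles_iff:
  "c \<in> cocycles k X \<longleftrightarrow> c \<in> singular_simplex_set k X \<rightarrow>\<^sub>E UNIV \<and>
     (\<forall>x. singular_relboundary k X {} x \<longrightarrow> cochain_eval c x = 0)"
proof -
  have "coboundary k X c = (\<lambda>\<sigma>\<in>singular_simplex_set (Suc k) X. 0) \<longleftrightarrow>
      (\<forall>x. singular_relboundary k X {} x \<longrightarrow> cochain_eval c x = 0)"
  proof
    assume L: "coboundary k X c = (\<lambda>\<sigma>\<in>singular_simplex_set (Suc k) X. 0)"
    show "\<forall>x. singular_relboundary k X {} x \<longrightarrow> cochain_eval c x = 0"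
    proof (intro allI impI)
      fix x assume "singular_relboundary k X {} x"
      then obtain d where d: "singular_chain (Suc k) X d" "chain_boundary (Suc k) d = x"
        by (auto simp: singular_boundary)
      have "cochain_eval (coboundary k X c) d = 0"
        unfolding cochain_eval_def L using d(1) by (intro sum.neutral) (auto simp: singular_chain_def)
      then show "cochain_eval c x = 0" using cochain_eval_coboundary[OF d(1), of c] d(2) by simp
    qed
  next
    assume R: "\<forall>x. singular_relboundary k X {} x \<longrightarrow> cochain_eval c x = 0"
    show "coboundary k X c = (\<lambda>\<sigma>\<in>singular_simplex_set (Suc k) X. 0)"
    proof
      fix \<sigma>
      show "coboundary k X c \<sigma> = (\<lambda>\<sigma>\<in>singular_simplex_set (Suc k) X. 0) \<sigma>"
      proof (cases "singular_simplex (Suc k) X \<sigma>")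
        case True
        then have "singular_relboundary k X {} (chain_boundary (Suc k) (frag_of \<sigma>))"
          using chain_of_simplex singular_boundary by blast
        then show ?thesis
          using R cochain_eval_coboundary[OF chain_of_simplex[OF True], of c] True by simp
      qed (simp add: coboundary_def)
    qed
  qed
  then show ?thesis by (simp add: cocycles_def cochain_space_simps)
qed

text \<open>One direction is adjointness. The converse is where rational coefficients matter: a
  cochain that kills cycles factors through the boundary map. In degree 0 every chain is a cycle, so
  only the zero cochain qualifies.\<close>

lemma coboundaries_iff:
  "c \<in> coboundaries k X \<longleftrightarrow> c \<in> singular_simplex_set k X \<rightarrow>\<^sub>E UNIV \<and>
     (\<forall>x. singular_relcycle k X {} x \<longrightarrow> cochain_eval c x = 0)"
proof (intro iffI conjI allI impI)
  assume c: "c \<in> coboundaries k X"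
  show "c \<in> singular_simplex_set k X \<rightarrow>\<^sub>E UNIV"
  proof (cases k)
    case 0
    then show ?thesis using c by (simp add: coboundaries_def cochain_space_simps)
  next
    case (Suc j)
    then obtain b where "c = coboundary j X b" using c by (auto simp: coboundaries_def)
    then show ?thesis using Suc by (simp add: coboundary_def)
  qed
  fix x assume x: "singular_relcycle k X {} x"
  show "cochain_eval c x = 0"
  proof (cases k)
    case 0
    then show ?thesis
      using c x unfolding cochain_eval_def
      by (intro sum.neutral) (auto simp: coboundaries_def cochain_space_simps singular_cycle singular_chain_def)
  next
    case (Suc j)
    then obtain b where "c = coboundary j X b" using c by (auto simp: coboundaries_def)
    then show ?thesis using cochain_eval_coboundary[of j X x b] x Suc by (simp add: singular_cycle)
  qed
next
  assume c: "c \<in> singular_simplex_set k X \<rightarrow>\<^sub>E UNIV \<and> (\<forall>x. singular_relcycle k X {} x \<longrightarrow> cochain_eval c x = 0)"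
  show "c \<in> coboundaries k X"
  proof (cases k)
    case 0
    have "c = (\<lambda>\<sigma>\<in>singular_simplex_set k X. 0)"
    proof
      fix \<sigma>
      show "c \<sigma> = (\<lambda>\<sigma>\<in>singular_simplex_set k X. 0) \<sigma>"
      proof (cases "singular_simplex k X \<sigma>")
        case True
        then have "singular_relcycle k X {} (frag_of \<sigma>)"
          using 0 by (simp add: singular_cycle chain_of_simplex chain_boundary_def)
        then have "cochain_eval c (frag_of \<sigma>) = 0" using c by blast
        then show ?thesis using True by simp
      qed (use c in \<open>auto simp: PiE_def extensional_def\<close>)
    qed
    then show ?thesis using 0 by (simp add: coboundaries_def cochain_space_simps)
  next
    case (Suc j)
    obtain b where b: "\<And>x. singular_chain k X x \<Longrightarrow> cochain_eval c x = cochain_eval b (chain_boundary k x)"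
      using cochain_factors_through_boundary[of k X c] c by blast
    \<comment> \<open>Elements of \<open>cochain_space\<close> are \<open>undefined\<close> off the
      singular simplices, whereas \<open>b\<close> has arbitrary values there.\<close>
    define b' where "b' = restrict b (singular_simplex_set j X)"
    have "c \<sigma> = coboundary j X b' \<sigma>" for \<sigma>
    proof (cases "singular_simplex k X \<sigma>")
      case True
      note ch = chain_of_simplex[OF True]
      have chb: "singular_chain j X (chain_boundary k (frag_of \<sigma>))"
        using singular_chain_boundary[OF ch] Suc by simp
      have "c \<sigma> = cochain_eval b (chain_boundary k (frag_of \<sigma>))" using b[OF ch] by simp
      also have "\<dots> = cochain_eval b' (chain_boundary k (frag_of \<sigma>))"
        by (rule cochain_eval_cong) (use chb in \<open>auto simp: b'_def singular_chain_def\<close>)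
      also have "\<dots> = coboundary j X b' \<sigma>"
        using cochain_eval_coboundary[of j X "frag_of \<sigma>" b'] ch Suc by simp
      finally show ?thesis .
    qed (use c Suc in \<open>auto simp: coboundary_def PiE_def extensional_def\<close>)
    then have "c = coboundary j X b'" by blast
    moreover have "b' \<in> carrier (cochain_space j X)" by (simp add: b'_def cochain_space_simps)
    ultimately show ?thesis using Suc by (simp add: coboundaries_def)
  qed
qed

lemma cochain_eval_restrict:
  "singular_chain k X x \<Longrightarrow> cochain_eval (restrict c (singular_simplex_set k X)) x = cochain_eval c x"
  by (rule cochain_eval_cong) (auto simp: singular_chain_def)

lemma cochain_eval_plus: "cochain_eval (\<lambda>\<sigma>. b \<sigma> + c \<sigma>) x = cochain_eval b x + cochain_eval c x"
  by (simp add: cochain_eval_def distrib_left sum.distrib)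

lemma cochain_eval_times: "cochain_eval (\<lambda>\<sigma>. q * c \<sigma>) x = q * cochain_eval c x"
  by (simp add: cochain_eval_def sum_distrib_left mult.left_commute)

lemma cocycles_submodule: "submodule class_ring (cocycles k X) (cochain_space k X)"
proof (rule submodule.intro)
  show "\<zero>\<^bsub>cochain_space k X\<^esub> \<in> cocycles k X"
    by (auto simp: cocycles_iff cochain_space_simps cochain_eval_restrict singular_boundary_imp_chain)
      (simp add: cochain_eval_def)
qed (auto simp: module_cochain_space cocycles_iff cochain_space_simps cochain_eval_restrict
      singular_boundary_imp_chain cochain_eval_plus cochain_eval_times)

lemma coboundaries_submodule:
  "submodule class_ring (coboundaries k X) (cochain_space k X\<lparr>carrier := cocycles k X\<rparr>)"
proof (rule submodule.intro)
  show "module class_ring (cochain_space k X\<lparr>carrier := cocycles k X\<rparr>)"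
    by (rule module.submodule_is_module[OF module_cochain_space cocycles_submodule])
  show "coboundaries k X \<subseteq> carrier (cochain_space k X\<lparr>carrier := cocycles k X\<rparr>)"
    by (auto simp: cocycles_iff coboundaries_iff singular_relboundary_imp_relcycle)
  show "\<zero>\<^bsub>cochain_space k X\<lparr>carrier := cocycles k X\<rparr>\<^esub> \<in> coboundaries k X"
    by (auto simp: coboundaries_iff cochain_space_simps cochain_eval_restrict singular_cycle)
      (simp add: cochain_eval_def)
qed (auto simp: coboundaries_iff cochain_space_simps cochain_eval_restrict singular_cycle
       cochain_eval_plus cochain_eval_times)

text \<open>The cochains \<open>e j\<close> are dual to the cycles \<open>z i\<close>. Sending a
  coordinate vector to the class of the corresponding combination of the \<open>e j\<close> is shown
  to be an isomorphism from the space of rational vectors of length \<open>r\<close>.\<close>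

theorem cohomology_of_cycle_basis:
  assumes z: "cycle_basis k X r z"
  shows "vectorspace.fin_dim class_ring (cohomology k X)" (is ?fin)
    and "vectorspace.dim class_ring (cohomology k X) = r" (is ?dim)
proof -
  let ?S = "singular_simplex_set k X"
  let ?M = "cochain_space k X\<lparr>carrier := cocycles k X\<rparr>"
  let ?B = "coboundaries k X"
  have modM: "module class_ring ?M"
    by (rule module.submodule_is_module[OF module_cochain_space cocycles_submodule])
  note subB = coboundaries_submodule[of k X]
  have field: "field (class_ring :: rat ring)" by (rule class_field)
  have vsQ: "vectorspace class_ring (cohomology k X)"
    unfolding cohomology_def vectorspace_def using field module_quotient_module[OF modM subB] by blast
  have "\<exists>c. (\<forall>i<r. cochain_eval c (z i) = (if i = j then 1 else 0)) \<and>
      (\<forall>x. singular_relboundary k X {} x \<longrightarrow> cochain_eval c x = 0)" for j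
  proof -
    obtain c where "\<And>i. i < r \<Longrightarrow> cochain_eval c (z i) = (if i = j then 1 else 0)"
      "\<And>x. singular_relboundary k X {} x \<Longrightarrow> cochain_eval c x = 0"
      by (rule cochain_with_values_on_cycle_basis[OF z, of "\<lambda>i. if i = j then 1 else 0"]) (rule that)
    then show ?thesis by (intro exI[of _ c]) simp
  qed
  then obtain e where "\<forall>j. (\<forall>i<r. cochain_eval (e j) (z i) = (if i = j then 1 else 0)) \<and>
      (\<forall>x. singular_relboundary k X {} x \<longrightarrow> cochain_eval (e j) x = 0)"
    using choice[of "\<lambda>j c. (\<forall>i<r. cochain_eval c (z i) = (if i = j then 1 else 0)) \<and>
      (\<forall>x. singular_relboundary k X {} x \<longrightarrow> cochain_eval c x = 0)"] by blast
  then have e: "\<And>i j. i < r \<Longrightarrow> cochain_eval (e j) (z i) = (if i = j then 1 else 0)"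
    and e_bd: "\<And>j x. singular_relboundary k X {} x \<Longrightarrow> cochain_eval (e j) x = 0"
    by simp_all
  define C where "C v = (\<lambda>\<sigma>\<in>?S. \<Sum>j<r. v $ j * e j \<sigma>)" for v :: "rat vec"
  have C_eval: "cochain_eval (C v) x = (\<Sum>j<r. v $ j * cochain_eval (e j) x)" if "singular_chain k X x" for v x
    using that by (simp add: C_def cochain_eval_restrict cochain_eval_lincomb)
  have C_z: "cochain_eval (C v) (z i) = v $ i" if "i < r" for v i
  proof -
    have "singular_chain k X (z i)" using z that by (simp add: cycle_basis_def singular_cycle)
    then show ?thesis using e that by (simp add: C_eval if_distrib[of "\<lambda>x. _ * x"] cong: if_cong)
  qed
  have C_cocycle: "C v \<in> cocycles k X" for v
  proof -
    have "cochain_eval (C v) x = 0" if x: "singular_relboundary k X {} x" for x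
      unfolding C_eval[OF singular_boundary_imp_chain[OF x]] using e_bd[OF x] by (intro sum.neutral) auto
    then show ?thesis by (simp add: cocycles_iff C_def)
  qed
  define T where "T v = ?B +>\<^bsub>?M\<^esub> C v" for v
  have "mod_hom class_ring (module_vec TYPE(rat) r) (cohomology k X) T"
  proof (rule mod_hom.intro[OF vec_module vectorspace.axioms(1)[OF vsQ] mod_hom_axioms.intro])
    have add: "C (v + w) = C v \<oplus>\<^bsub>?M\<^esub> C w" if "v \<in> carrier_vec r" "w \<in> carrier_vec r" for v w
      using that by (auto simp: C_def cochain_space_simps sum.distrib distrib_right)
    have smult: "C (q \<cdot>\<^sub>v v) = q \<odot>\<^bsub>?M\<^esub> C v" if "v \<in> carrier_vec r" for q v
      using that by (auto simp: C_def cochain_space_simps sum_distrib_left mult.assoc)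
    show "T \<in> module_hom class_ring (module_vec TYPE(rat) r) (cohomology k X)"
      unfolding module_hom_def T_def cohomology_def
      by (auto simp: module_vec_simps class_ring_simps carrier_quotient_module[OF modM subB]
            add_quotient_module[OF modM subB] smult_quotient_module[OF modM subB] C_cocycle add smult)
  qed
  then have lin: "linear_map class_ring (module_vec TYPE(rat) r) (cohomology k X) T"
    using vsQ vec_vs[where 'a = rat, of r] by (simp add: linear_map_def)
  \<comment> \<open>Coboundaries vanish on the cycles \<open>z i\<close>, so the class of a cocycle
    determines its values there, and these are the coordinates.\<close>
  have inj: "inj_on T (carrier (module_vec TYPE(rat) r))"
  proof (rule inj_onI)
    fix v w assume v: "v \<in> carrier (module_vec TYPE(rat) r)" and w: "w \<in> carrier (module_vec TYPE(rat) r)"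
      and eq: "T v = T w"
    then obtain b where b: "b \<in> ?B" "C v = b \<oplus>\<^bsub>?M\<^esub> C w"
      unfolding T_def using coset_eq_iff[OF modM subB, of "C v" "C w"] C_cocycle by auto
    have "v $ i = w $ i" if i: "i < r" for i
    proof -
      have zi: "singular_relcycle k X {} (z i)" using z i by (simp add: cycle_basis_def)
      then have "cochain_eval (C v) (z i) = cochain_eval b (z i) + cochain_eval (C w) (z i)"
        by (simp add: b(2) cochain_space_simps cochain_eval_restrict singular_cycle cochain_eval_plus)
      moreover have "cochain_eval b (z i) = 0" using b(1) zi by (simp add: coboundaries_iff)
      ultimately show ?thesis using C_z i by simp
    qed
    then show "v = w" using v w by (intro eq_vecI) (auto simp: module_vec_simps)
  qed
  have surj: "T ` carrier (module_vec TYPE(rat) r) = carrier (cohomology k X)"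
  proof
    show "T ` carrier (module_vec TYPE(rat) r) \<subseteq> carrier (cohomology k X)"
      unfolding T_def cohomology_def by (auto simp: carrier_quotient_module[OF modM subB] C_cocycle)
    show "carrier (cohomology k X) \<subseteq> T ` carrier (module_vec TYPE(rat) r)"
    proof
      fix A assume "A \<in> carrier (cohomology k X)"
      then obtain c where c: "c \<in> cocycles k X" "A = ?B +>\<^bsub>?M\<^esub> c"
        unfolding cohomology_def by (auto simp: carrier_quotient_module[OF modM subB])
      define v where "v = vec r (\<lambda>i. cochain_eval c (z i))"
      \<comment> \<open>Subtracting the combination with the same values on all \<open>z i\<close>
        leaves a cochain that kills every cycle, hence a coboundary.\<close>
      define b where "b = (\<lambda>\<sigma>\<in>?S. c \<sigma> + (-1) * C v \<sigma>)"
      have b_eval: "cochain_eval b x = cochain_eval c x - cochain_eval (C v) x" if "singular_chain k X x" for x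
        unfolding b_def cochain_eval_restrict[OF that] cochain_eval_plus cochain_eval_times by simp
      have "cochain_eval b x = 0" if x: "singular_relcycle k X {} x" for x
      proof -
        obtain a where a: "singular_relboundary k X {} (x - (\<Sum>i<r. frag_cmul (a i) (z i)))"
          using z x unfolding cycle_basis_def by blast
        have b_bd: "cochain_eval b y = 0" if y: "singular_relboundary k X {} y" for y
          using b_eval[OF singular_boundary_imp_chain[OF y]] c(1) C_cocycle[of v] y by (simp add: cocycles_iff)
        have b_z: "cochain_eval b (z i) = 0" if i: "i < r" for i
        proof -
          have "singular_chain k X (z i)" using z i by (simp add: cycle_basis_def singular_cycle)
          then show ?thesis using b_eval C_z[OF i] i by (simp add: v_def)
        qed
        have "cochain_eval b x = cochain_eval b (x - (\<Sum>i<r. frag_cmul (a i) (z i))) + (\<Sum>i<r. of_int (a i) * cochain_eval b (z i))"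
          by (simp add: cochain_eval_diff cochain_eval_sum cochain_eval_cmul)
        then show ?thesis using b_bd[OF a] b_z by simp
      qed
      then have "b \<in> ?B" by (simp add: coboundaries_iff b_def)
      moreover have "c = b \<oplus>\<^bsub>?M\<^esub> C v"
      proof
        fix \<sigma> show "c \<sigma> = (b \<oplus>\<^bsub>?M\<^esub> C v) \<sigma>"
          using c(1) by (cases "\<sigma> \<in> ?S") (auto simp: cochain_space_simps b_def cocycles_iff PiE_def extensional_def)
      qed
      ultimately have "A = T v"
        unfolding T_def c(2) using coset_eq_iff[OF modM subB, of c "C v"] c(1) C_cocycle by auto
      then show "A \<in> T ` carrier (module_vec TYPE(rat) r)" by (auto simp: v_def module_vec_simps)
    qed
  qed
  show ?fin by (rule linear_map.surj_fin_dim[OF lin vec_space.fin_dim surj])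
  show ?dim using linear_map.dim_eq[OF lin vec_space.fin_dim inj surj] unfolding vec_space.dim_is_n by (rule sym)
qed

section \<open>Coordinates with respect to a basis\<close>

text \<open>Indexed by positions and not by a set of vectors, so that it matches the product of a
  matrix of columns with a vector.\<close>

definition lcomb :: "nat \<Rightarrow> nat \<Rightarrow> (nat \<Rightarrow> complex) \<Rightarrow> (nat \<Rightarrow> complex vec) \<Rightarrow> complex vec" where
  "lcomb d r a u = vec d (\<lambda>i. \<Sum>k<r. a k * u k $ i)"

lemma lcomb_carrier [simp]: "lcomb d r a u \<in> carrier_vec d"
  by (simp add: lcomb_def)

lemma lcomb_cong:
  "(\<And>k. k < r \<Longrightarrow> a k = b k) \<Longrightarrow> (\<And>k. k < r \<Longrightarrow> u k = v k) \<Longrightarrow> lcomb d r a u = lcomb d r b v"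
  unfolding lcomb_def by (intro eq_vecI) auto

lemma mat_of_cols_mult_vec:
  assumes "length us = r" "y \<in> carrier_vec r"
  shows "mat_of_cols d us *\<^sub>v y = lcomb d r (\<lambda>k. y $ k) (\<lambda>k. us ! k)"
proof (rule eq_vecI)
  fix i assume "i < dim_vec (lcomb d r (\<lambda>k. y $ k) (\<lambda>k. us ! k))"
  then show "(mat_of_cols d us *\<^sub>v y) $ i = lcomb d r (\<lambda>k. y $ k) (\<lambda>k. us ! k) $ i"
    using assms by (auto simp: lcomb_def scalar_prod_def mat_of_cols_index atLeast0LessThan mult.commute intro!: sum.cong)
qed (simp add: lcomb_def)

lemma mult_mat_vec_lcomb:
  assumes A: "A \<in> carrier_mat d d" and u: "\<And>k. k < r \<Longrightarrow> u k \<in> carrier_vec d"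
  shows "A *\<^sub>v lcomb d r a u = lcomb d r a (\<lambda>k. A *\<^sub>v u k)"
proof (rule eq_vecI)
  fix i assume "i < dim_vec (lcomb d r a (\<lambda>k. A *\<^sub>v u k))"
  then have i: "i < d" by (simp add: lcomb_def)
  have dim: "k < r \<Longrightarrow> dim_vec (u k) = d" for k using u by auto
  have "(A *\<^sub>v lcomb d r a u) $ i = (\<Sum>j<d. A $$ (i, j) * (\<Sum>k<r. a k * u k $ j))"
    using i A by (simp add: lcomb_def scalar_prod_def atLeast0LessThan)
  also have "\<dots> = (\<Sum>k<r. a k * (\<Sum>j<d. A $$ (i, j) * u k $ j))"
    by (simp add: sum_distrib_left sum.swap[of _ "{..<r}"] mult.left_commute)
  also have "\<dots> = lcomb d r a (\<lambda>k. A *\<^sub>v u k) $ i"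
    unfolding lcomb_def using i A by (simp add: scalar_prod_def atLeast0LessThan dim)
  finally show "(A *\<^sub>v lcomb d r a u) $ i = lcomb d r a (\<lambda>k. A *\<^sub>v u k) $ i" .
qed (use A in \<open>simp add: lcomb_def\<close>)

abbreviation vec_subspace :: "nat \<Rightarrow> complex vec set \<Rightarrow> bool" where
  "vec_subspace d U \<equiv> VectorSpace.subspace class_ring U (module_vec TYPE(complex) d)"

lemma vec_subspace_iff:
  "vec_subspace d U \<longleftrightarrow> U \<subseteq> carrier_vec d \<and> 0\<^sub>v d \<in> U \<and> (\<forall>v\<in>U. \<forall>w\<in>U. v + w \<in> U) \<and>
     (\<forall>c. \<forall>v\<in>U. c \<cdot>\<^sub>v v \<in> U)"
  using vec_vs[where 'a = complex, of d] vec_module[where 'a = complex, of d]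
  by (auto simp: subspace_def submodule_def module_vec_simps class_ring_simps)

lemma lcomb_in_subspace:
  assumes U: "vec_subspace d U" and u: "\<And>k. k < r \<Longrightarrow> a k = 0 \<or> u k \<in> U"
  shows "lcomb d r a u \<in> U"
  using u
proof (induction r)
  case 0
  have "lcomb d 0 a u = 0\<^sub>v d" by (auto simp: lcomb_def)
  then show ?case using U by (simp add: vec_subspace_iff)
next
  case (Suc r)
  have IH: "lcomb d r a u \<in> U" using Suc by simp
  show ?case
  proof (cases "a r = 0")
    case True
    then have "lcomb d (Suc r) a u = lcomb d r a u" by (simp add: lcomb_def)
    then show ?thesis using IH by simp
  next
    case False
    then have ur: "u r \<in> U" using Suc.prems[of r] by simp
    then have "u r \<in> carrier_vec d" using U by (auto simp: vec_subspace_iff)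
    then have "lcomb d (Suc r) a u = lcomb d r a u + a r \<cdot>\<^sub>v u r"
      by (intro eq_vecI) (auto simp: lcomb_def)
    then show ?thesis using IH ur U by (simp add: vec_subspace_iff)
  qed
qed

text \<open>Cramer's rule. As a quotient of determinants, a coordinate is visibly a regular function
  wherever the denominator is nonzero.\<close>

definition coef :: "nat \<Rightarrow> complex vec list \<Rightarrow> complex vec \<Rightarrow> nat \<Rightarrow> complex" where
  "coef d us v k = det (mat_of_cols d (us[k := v])) / det (mat_of_cols d us)"

definition vec_basis :: "nat \<Rightarrow> complex vec list \<Rightarrow> bool" where
  "vec_basis d us \<longleftrightarrow> length us = d \<and> set us \<subseteq> carrier_vec d \<and> det (mat_of_cols d us) \<noteq> 0"

lemma coef_lcomb:
  assumes us: "vec_basis d us" and k: "k < d"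
  shows "coef d us (lcomb d d a (\<lambda>k. us ! k)) k = a k"
proof -
  let ?A = "mat_of_cols d us" and ?v = "lcomb d d a (\<lambda>k. us ! k)"
  have A: "?A \<in> carrier_mat d d" using us mat_of_cols_carrier(1)[of d us] by (simp add: vec_basis_def)
  have Av: "?A *\<^sub>v vec d a = ?v"
    using us mat_of_cols_mult_vec[of us d "vec d a" d] by (auto simp: vec_basis_def intro: lcomb_cong)
  have "det (replace_col ?A ?v k) = a k * det ?A"
    using cramer_lemma_mat[OF A, of "vec d a" k] k unfolding Av by simp
  moreover have "replace_col ?A ?v k = mat_of_cols d (us[k := ?v])"
    using us k by (intro eq_matI) (auto simp: replace_col_def mat_of_cols_index vec_basis_def)
  ultimately show ?thesis using us by (simp add: coef_def vec_basis_def)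
qed

lemma vec_basis_invertible:
  assumes "vec_basis d us"
  obtains B where "B \<in> carrier_mat d d" "mat_of_cols d us * B = 1\<^sub>m d" "B * mat_of_cols d us = 1\<^sub>m d"
proof -
  have "mat_of_cols d us \<in> Units (ring_mat TYPE(complex) d ())"
    using assms by (intro det_non_zero_imp_unit) (auto simp: vec_basis_def)
  then show thesis by (auto simp: Units_def ring_mat_simps intro: that)
qed

lemma lcomb_coef:
  assumes us: "vec_basis d us" and v: "v \<in> carrier_vec d"
  shows "lcomb d d (coef d us v) (\<lambda>k. us ! k) = v"
proof -
  let ?A = "mat_of_cols d us"
  have A: "?A \<in> carrier_mat d d" using us mat_of_cols_carrier(1)[of d us] by (simp add: vec_basis_def)
  obtain B where B: "B \<in> carrier_mat d d" "?A * B = 1\<^sub>m d" using vec_basis_invertible[OF us] by metis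
  define y where "y = B *\<^sub>v v"
  have y: "y \<in> carrier_vec d" using B v by (simp add: y_def)
  have "?A *\<^sub>v y = v" unfolding y_def using assoc_mult_mat_vec[OF A B(1) v] B(2) v by simp
  then have eq: "v = lcomb d d (\<lambda>k. y $ k) (\<lambda>k. us ! k)"
    using mat_of_cols_mult_vec[of us d y d] us y by (simp add: vec_basis_def)
  have "coef d us v k = y $ k" if "k < d" for k
    using coef_lcomb[OF us that, of "\<lambda>k. y $ k"] eq by simp
  then show ?thesis by (subst (2) eq) (rule lcomb_cong, auto)
qed

lemma coef_nth:
  assumes us: "vec_basis d us" and k: "k < d" "l < d"
  shows "coef d us (us ! l) k = (if k = l then 1 else 0)"
proof -
  have "us ! l \<in> carrier_vec d" using us k by (auto simp: vec_basis_def)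
  then have "us ! l = lcomb d d (\<lambda>k. if k = l then 1 else 0) (\<lambda>k. us ! k)"
    using k by (intro eq_vecI) (auto simp: lcomb_def if_distrib[of "\<lambda>x. x * _"] cong: if_cong)
  then show ?thesis using coef_lcomb[OF us k(1), of "\<lambda>k. if k = l then 1 else 0"] by simp
qed

text \<open>The exchange step: the new determinant is the old one times the coefficient.\<close>

lemma vec_basis_update:
  assumes us: "vec_basis d us" and v: "v \<in> carrier_vec d" and k: "k < d" and nz: "coef d us v k \<noteq> 0"
  shows "vec_basis d (us[k := v])"
  using us nz v set_update_subset_insert[of us k v] by (auto simp: vec_basis_def coef_def)

text \<open>A kernel vector of one matrix of columns becomes, with its entries permuted, a kernel
  vector of the other.\<close>

lemma vec_basis_perm:
  assumes us: "vec_basis d us" and perm: "mset us' = mset us"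
  shows "vec_basis d us'"
proof -
  have len: "length us' = d" "length us = d" and set: "set us' = set us" and car: "set us \<subseteq> carrier_vec d"
    using us perm by (auto simp: vec_basis_def dest: mset_eq_length mset_eq_setD)
  obtain p where p: "p permutes {..<length us}" "permute_list p us = us'"
    using mset_eq_permutation[OF perm] .
  have nth: "us' ! k = us ! p k" if "k < d" for k
    using permute_list_nth[OF p(1)] p(2) len that by auto
  have pl: "p k < d" if "k < d" for k using permutes_in_image[OF p(1), of k] that len by auto
  have bij: "bij_betw p {..<d} {..<d}" using p(1) len by (simp add: permutes_imp_bij)
  have "det (mat_of_cols d us') \<noteq> 0"
  proof
    assume "det (mat_of_cols d us') = 0"
    then obtain y where y: "y \<in> carrier_vec d" "y \<noteq> 0\<^sub>v d" "mat_of_cols d us' *\<^sub>v y = 0\<^sub>v d"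
      using det_0_iff_vec_prod_zero_field[of "mat_of_cols d us'" d] mat_of_cols_carrier(1)[of d us'] len by auto
    define z where "z = vec d (\<lambda>k. y $ inv_into {..<d} p k)"
    have "lcomb d d (\<lambda>k. z $ k) (\<lambda>k. us ! k) = lcomb d d (\<lambda>k. y $ k) (\<lambda>k. us' ! k)"
    proof (rule eq_vecI)
      fix i assume "i < dim_vec (lcomb d d (\<lambda>k. y $ k) (\<lambda>k. us' ! k))"
      then have i: "i < d" by (simp add: lcomb_def)
      have "(\<Sum>k<d. z $ k * us ! k $ i) = (\<Sum>k<d. z $ p k * us ! p k $ i)"
        using sum.reindex_bij_betw[OF bij, of "\<lambda>k. z $ k * us ! k $ i"] by simp
      also have "\<dots> = (\<Sum>k<d. y $ k * us' ! k $ i)"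
        using bij by (intro sum.cong) (auto simp: z_def pl nth bij_betw_def inv_into_f_f)
      finally show "lcomb d d (\<lambda>k. z $ k) (\<lambda>k. us ! k) $ i = lcomb d d (\<lambda>k. y $ k) (\<lambda>k. us' ! k) $ i"
        using i by (simp add: lcomb_def)
    qed (simp add: lcomb_def)
    also have "\<dots> = 0\<^sub>v d" using mat_of_cols_mult_vec[OF len(1) y(1)] y(3) by simp
    finally have 0: "mat_of_cols d us *\<^sub>v z = 0\<^sub>v d" using mat_of_cols_mult_vec[OF len(2), of z d] by (simp add: z_def)
    have "z \<noteq> 0\<^sub>v d"
    proof
      assume z0: "z = 0\<^sub>v d"
      have "y $ k = 0" if k: "k < d" for k
      proof -
        have "y $ k = z $ p k" using k pl[OF k] bij by (simp add: z_def bij_betw_def inv_into_f_f)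
        then show ?thesis using z0 pl[OF k] by simp
      qed
      then show False using y by (auto intro!: eq_vecI)
    qed
    moreover have "z \<in> carrier_vec d" by (simp add: z_def)
    ultimately have "det (mat_of_cols d us) = 0"
      using det_0_iff_vec_prod_zero_field[of "mat_of_cols d us" d] mat_of_cols_carrier(1)[of d us] len 0
      by auto
    then show False using us by (simp add: vec_basis_def)
  qed
  then show ?thesis using len set car by (simp add: vec_basis_def)
qed

text \<open>Lexicographic comparison of sorted lists of equal length amounts to asking which set
  owns the least element of the symmetric difference. This lemma and the next provide the two
  directions.\<close>

lemma sorted_first_difference:
  fixes xs ys :: "'a::linorder list"
  assumes "sorted_wrt (<) xs" "sorted_wrt (<) ys" "length xs = length ys" "xs < ys"
  shows "\<exists>w\<in>set xs. w \<notin> set ys \<and> (\<forall>v<w. v \<in> set xs \<longleftrightarrow> v \<in> set ys)"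
  using assms(3,1,2,4)
proof (induction xs ys rule: list_induct2)
  case (Cons x xs y ys)
  show ?case
  proof (cases "x < y")
    case True
    then show ?thesis using Cons.prems by (intro bexI[of _ x]) auto
  next
    case False
    then have xy: "x = y" "xs < ys" using Cons.prems by auto
    then obtain w where w: "w \<in> set xs" "w \<notin> set ys" "\<forall>v<w. v \<in> set xs \<longleftrightarrow> v \<in> set ys"
      using Cons by auto
    then show ?thesis using xy Cons.prems by (intro bexI[of _ w]) auto
  qed
qed auto

lemma sorted_less_of_first_difference:
  fixes xs ys :: "'a::linorder list"
  assumes "sorted_wrt (<) xs" "sorted_wrt (<) ys" "length xs = length ys"
    "w \<in> set xs" "w \<notin> set ys" "\<And>v. v \<in> set ys \<Longrightarrow> v \<notin> set xs \<Longrightarrow> w < v"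
  shows "xs < ys"
  using assms(3,1,2,4,5,6)
proof (induction xs ys rule: list_induct2)
  case (Cons x xs y ys)
  consider "x < y" | "x = y" | "y < x" by fastforce
  then show ?case
  proof cases
    case 2
    have "w < v" if "v \<in> set ys" "v \<notin> set xs" for v
      using Cons.prems(5)[of v] that Cons.prems(2) 2 by auto
    then have "xs < ys" using Cons 2 by auto
    then show ?thesis using 2 by simp
  next
    case 3
    then have "y \<notin> set (x # xs)" using Cons.prems(1) by auto
    then have "w < y" using Cons.prems by simp
    moreover have "x \<le> w" using Cons.prems(1,3) by auto
    ultimately show ?thesis using 3 by auto
  qed simp
qed auto

section \<open>Words, forests and stable tuples\<close>

text \<open>The word \<open>j # [i\<^sub>1, \<dots>, i\<^sub>r]\<close> stands for the vector
  \<open>\<phi>\<^sub>i\<^sub>r \<cdots> \<phi>\<^sub>i\<^sub>1 f(e\<^sub>j)\<close>.\<close>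

definition words :: "nat \<Rightarrow> nat \<Rightarrow> nat list set" where
  "words m n = {w. w \<noteq> [] \<and> hd w < n \<and> set (tl w) \<subseteq> {..<m}}"

text \<open>The empty prefix is excluded because roots are one-letter words; different trees have no
  common ancestor.\<close>

definition prefix_closed :: "nat list set \<Rightarrow> bool" where
  "prefix_closed S \<longleftrightarrow> (\<forall>w i. w \<noteq> [] \<longrightarrow> w @ [i] \<in> S \<longrightarrow> w \<in> S)"

definition forests :: "nat \<Rightarrow> nat \<Rightarrow> nat \<Rightarrow> nat list set set" where
  "forests m n d = {S. finite S \<and> card S = d \<and> S \<subseteq> words m n \<and> prefix_closed S}"

text \<open>A missing root is critical too: for a one-letter word the only possible \<open>v\<close>
  is empty and the last condition is vacuous.\<close>

definition critical :: "nat \<Rightarrow> nat \<Rightarrow> nat list set \<Rightarrow> nat list set" where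
  "critical m n S = {w \<in> words m n. w \<notin> S \<and> (\<forall>v i. v \<noteq> [] \<longrightarrow> w = v @ [i] \<longrightarrow> v \<in> S)}"

lemma words_single [simp]: "[j] \<in> words m n \<longleftrightarrow> j < n"
  by (simp add: words_def)

lemma words_snoc [simp]: "w \<noteq> [] \<Longrightarrow> w @ [i] \<in> words m n \<longleftrightarrow> w \<in> words m n \<and> i < m"
  by (cases w) (auto simp: words_def)

lemma words_nonempty: "w \<in> words m n \<Longrightarrow> w \<noteq> []"
  by (simp add: words_def)

lemma words_induct [consumes 1, case_names single snoc]:
  assumes "w \<in> words m n"
    and "\<And>j. j < n \<Longrightarrow> P [j]"
    and "\<And>w i. w \<in> words m n \<Longrightarrow> i < m \<Longrightarrow> P w \<Longrightarrow> P (w @ [i])"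
  shows "P w"
  using assms(1)
proof (induction w rule: rev_induct)
  case (snoc i w)
  then show ?case using assms(2,3) by (cases "w = []") auto
qed (simp add: words_def)

text \<open>Since ancestors precede descendants, the words of a forest below a given bound are again
  closed under prefixes.\<close>

lemma less_snoc: "w < w @ [i :: 'a :: linorder]"
  by (induction w) auto

lemma finite_critical:
  assumes "finite S"
  shows "finite (critical m n S)"
proof (rule finite_subset)
  show "critical m n S \<subseteq> (\<lambda>j. [j]) ` {..<n} \<union> (\<lambda>(v, i). v @ [i]) ` (S \<times> {..<m})"
  proof
    fix w assume w: "w \<in> critical m n S"
    then have "w \<in> words m n" by (simp add: critical_def)
    then show "w \<in> (\<lambda>j. [j]) ` {..<n} \<union> (\<lambda>(v, i). v @ [i]) ` (S \<times> {..<m})"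
    proof (cases w rule: rev_cases)
      case (snoc v i)
      then show ?thesis
        using w by (cases "v = []") (auto simp: critical_def image_iff words_def)
    qed (simp add: words_def)
  qed
qed (use assms in auto)

section \<open>Vectors of words, the group action and stability\<close>

definition word_vec :: "tuple \<Rightarrow> nat list \<Rightarrow> complex vec" where
  "word_vec x w = foldl (\<lambda>v i. snd x ! i *\<^sub>v v) (col (fst x) (hd w)) (tl w)"

lemma word_vec_single [simp]: "word_vec x [j] = col (fst x) j"
  by (simp add: word_vec_def)

lemma word_vec_snoc [simp]: "w \<noteq> [] \<Longrightarrow> word_vec x (w @ [i]) = snd x ! i *\<^sub>v word_vec x w"
  by (cases w) (simp_all add: word_vec_def)

lemma tuples_fst: "x \<in> tuples m d n \<Longrightarrow> fst x \<in> carrier_mat d n"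
  and tuples_snd: "x \<in> tuples m d n \<Longrightarrow> i < m \<Longrightarrow> snd x ! i \<in> carrier_mat d d"
  and tuples_length: "x \<in> tuples m d n \<Longrightarrow> length (snd x) = m"
  by (auto simp: tuples_def)

lemma word_vec_carrier:
  assumes x: "x \<in> tuples m d n" and w: "w \<in> words m n"
  shows "word_vec x w \<in> carrier_vec d"
  using w
proof (induction rule: words_induct)
  case (single j)
  then show ?case using tuples_fst[OF x] by simp
next
  case (snoc w i)
  then show ?case using tuples_snd[OF x] words_nonempty[OF snoc(1)] by (auto intro: mult_mat_vec_carrier)
qed

lemma carrier_GL: "carrier (GL d) = {g \<in> carrier_mat d d. det g \<noteq> 0}"
  unfolding GL_def units_of_carrier
proof (intro equalityI subsetI)
  fix g assume g: "g \<in> Units (ring_mat TYPE(complex) d ())"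
  then have "g \<in> carrier_mat d d" by (simp add: Units_def ring_mat_simps)
  then show "g \<in> {g \<in> carrier_mat d d. det g \<noteq> 0}" using unit_imp_det_non_zero[OF g] by simp
next
  fix g :: "complex mat" assume "g \<in> {g \<in> carrier_mat d d. det g \<noteq> 0}"
  then show "g \<in> Units (ring_mat TYPE(complex) d ())" by (auto intro: det_non_zero_imp_unit)
qed

lemma group_GL: "group (GL d)"
proof -
  interpret R: ring "ring_mat TYPE(complex) d ()" by (rule ring_mat)
  show ?thesis unfolding GL_def by (rule R.units_group)
qed

lemma GL_simps: "x \<otimes>\<^bsub>GL d\<^esub> y = x * y" "\<one>\<^bsub>GL d\<^esub> = 1\<^sub>m d"
  by (simp_all add: GL_def units_of_def ring_mat_simps)

lemma inv_GL:
  assumes "g \<in> carrier (GL d)"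
  shows "inv\<^bsub>GL d\<^esub> g \<in> carrier_mat d d" "g * inv\<^bsub>GL d\<^esub> g = 1\<^sub>m d" "inv\<^bsub>GL d\<^esub> g * g = 1\<^sub>m d"
proof -
  interpret G: group "GL d" by (rule group_GL)
  show "inv\<^bsub>GL d\<^esub> g \<in> carrier_mat d d" using G.inv_closed[OF assms] by (simp add: carrier_GL)
  show "g * inv\<^bsub>GL d\<^esub> g = 1\<^sub>m d" using G.r_inv[OF assms] by (simp add: GL_simps)
  show "inv\<^bsub>GL d\<^esub> g * g = 1\<^sub>m d" using G.l_inv[OF assms] by (simp add: GL_simps)
qed

lemma fst_act [simp]: "fst (act d g x) = g * fst x"
  and snd_act [simp]: "snd (act d g x) = map (\<lambda>\<phi>. g * \<phi> * inv\<^bsub>GL d\<^esub> g) (snd x)"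
  by (simp_all add: act_def case_prod_unfold)

lemma act_in_tuples:
  assumes "g \<in> carrier (GL d)" "x \<in> tuples m d n"
  shows "act d g x \<in> tuples m d n"
proof -
  have g: "g \<in> carrier_mat d d" using assms(1) by (simp add: carrier_GL)
  have "fst (act d g x) \<in> carrier_mat d n" using tuples_fst[OF assms(2)] g by auto
  moreover have "set (snd (act d g x)) \<subseteq> carrier_mat d d"
    using assms(2) g inv_GL(1)[OF assms(1)] by (auto simp: tuples_def)
  ultimately show ?thesis using tuples_length[OF assms(2)] by (auto simp: tuples_def mem_Times_iff)
qed

lemma word_vec_act:
  assumes g: "g \<in> carrier (GL d)" and x: "x \<in> tuples m d n" and w: "w \<in> words m n"
  shows "word_vec (act d g x) w = g *\<^sub>v word_vec x w"
  using w
proof (induction rule: words_induct)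
  case (single j)
  then show ?case using tuples_fst[OF x] g by (auto simp: carrier_GL)
next
  case (snoc w i)
  have gc: "g \<in> carrier_mat d d" using g by (simp add: carrier_GL)
  have p: "snd x ! i \<in> carrier_mat d d" using tuples_snd[OF x] snoc by simp
  have wc: "word_vec x w \<in> carrier_vec d" by (rule word_vec_carrier[OF x snoc(1)])
  have "word_vec (act d g x) (w @ [i]) = (g * (snd x ! i) * inv\<^bsub>GL d\<^esub> g) *\<^sub>v (g *\<^sub>v word_vec x w)"
    using snoc words_nonempty[OF snoc(1)] tuples_length[OF x] by simp
  also have "\<dots> = (g * (snd x ! i)) *\<^sub>v ((inv\<^bsub>GL d\<^esub> g * g) *\<^sub>v word_vec x w)"
    using gc p wc inv_GL(1)[OF g]
    by (simp add: assoc_mult_mat_vec[of _ d d _ d])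
  also have "\<dots> = g *\<^sub>v (snd x ! i *\<^sub>v word_vec x w)"
    using gc p wc inv_GL(3)[OF g] by (simp add: assoc_mult_mat_vec[of _ d d _ d])
  finally show ?case using words_nonempty[OF snoc(1)] by simp
qed

lemma act_act:
  assumes g: "g \<in> carrier (GL d)" and h: "h \<in> carrier (GL d)" and x: "x \<in> tuples m d n"
  shows "act d g (act d h x) = act d (g * h) x"
proof -
  interpret G: group "GL d" by (rule group_GL)
  have gc: "g \<in> carrier_mat d d" "h \<in> carrier_mat d d" using g h by (auto simp: carrier_GL)
  note ic = inv_GL(1)[OF g] inv_GL(1)[OF h]
  have inv: "inv\<^bsub>GL d\<^esub> (g * h) = inv\<^bsub>GL d\<^esub> h * inv\<^bsub>GL d\<^esub> g"
    using G.inv_mult_group[OF g h] by (simp add: GL_simps)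
  have "g * (h * p * inv\<^bsub>GL d\<^esub> h) * inv\<^bsub>GL d\<^esub> g = g * h * p * (inv\<^bsub>GL d\<^esub> h * inv\<^bsub>GL d\<^esub> g)"
    if p: "p \<in> carrier_mat d d" for p
  proof -
    have "g * h * p * (inv\<^bsub>GL d\<^esub> h * inv\<^bsub>GL d\<^esub> g) = g * h * p * inv\<^bsub>GL d\<^esub> h * inv\<^bsub>GL d\<^esub> g"
      using gc ic p by (simp add: assoc_mult_mat[of _ d d _ d _ d])
    also have "\<dots> = g * (h * p * inv\<^bsub>GL d\<^esub> h) * inv\<^bsub>GL d\<^esub> g"
      using gc ic p by (simp add: assoc_mult_mat[of _ d d _ d _ d])
    finally show ?thesis by simp
  qed
  moreover have "g * (h * fst x) = g * h * fst x"
    using gc tuples_fst[OF x] by (simp add: assoc_mult_mat[of _ d d _ d _ n])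
  ultimately show ?thesis
    using x by (intro prod_eqI) (auto simp: inv tuples_def)
qed

lemma act_one:
  assumes x: "x \<in> tuples m d n"
  shows "act d (1\<^sub>m d) x = x"
proof -
  interpret G: group "GL d" by (rule group_GL)
  have "inv\<^bsub>GL d\<^esub> (1\<^sub>m d) = 1\<^sub>m d" using G.inv_one by (simp add: GL_simps)
  then show ?thesis
    using x by (intro prod_eqI) (auto simp: tuples_def intro!: map_idI)
qed

lemma orbit_self: "x \<in> tuples m d n \<Longrightarrow> x \<in> orbit (GL d) (act d) x"
  using act_one[of x m d n] group.is_monoid[OF group_GL[of d]]
  by (auto simp: orbit_def GL_simps(2)[symmetric] intro!: exI[of _ "\<one>\<^bsub>GL d\<^esub>"] monoid.one_closed)

lemma orbit_act:
  assumes x: "x \<in> tuples m d n" and g: "g \<in> carrier (GL d)"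
  shows "orbit (GL d) (act d) (act d g x) = orbit (GL d) (act d) x"
proof -
  interpret G: group "GL d" by (rule group_GL)
  have "act d h x = act d (h * inv\<^bsub>GL d\<^esub> g) (act d g x)" if h: "h \<in> carrier (GL d)" for h
  proof -
    have hc: "h \<in> carrier_mat d d" "g \<in> carrier_mat d d" using h g by (auto simp: carrier_GL)
    then have "h * inv\<^bsub>GL d\<^esub> g * g = h * 1\<^sub>m d"
      using inv_GL[OF g] by (simp add: assoc_mult_mat[of _ d d _ d _ d])
    then have "h * inv\<^bsub>GL d\<^esub> g * g = h" using right_mult_one_mat[OF hc(1)] by simp
    then show ?thesis using act_act[OF _ g x, of "h * inv\<^bsub>GL d\<^esub> g"] G.m_closed[OF h G.inv_closed[OF g]]
      by (simp add: GL_simps)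
  qed
  moreover have "h * inv\<^bsub>GL d\<^esub> g \<in> carrier (GL d)" if "h \<in> carrier (GL d)" for h
    using G.m_closed[OF that G.inv_closed[OF g]] by (simp add: GL_simps)
  moreover have "act d h (act d g x) = act d (h * g) x" "h * g \<in> carrier (GL d)" if "h \<in> carrier (GL d)" for h
    using act_act[OF that g x] G.m_closed[OF that g] by (simp_all add: GL_simps)
  ultimately show ?thesis unfolding orbit_def by blast
qed

definition word_det :: "nat \<Rightarrow> nat list list \<Rightarrow> tuple \<Rightarrow> complex" where
  "word_det d us x = det (mat_of_cols d (map (word_vec x) us))"

lemma vec_basis_words:
  assumes "x \<in> tuples m d n" "set us \<subseteq> words m n" "length us = d"
  shows "vec_basis d (map (word_vec x) us) \<longleftrightarrow> word_det d us x \<noteq> 0"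
  using assms word_vec_carrier[OF assms(1)] by (auto simp: vec_basis_def word_det_def)

lemma mat_of_cols_words_act:
  assumes g: "g \<in> carrier (GL d)" and x: "x \<in> tuples m d n" and us: "set us \<subseteq> words m n" "length us = d"
  shows "mat_of_cols d (map (word_vec (act d g x)) us) = g * mat_of_cols d (map (word_vec x) us)"
proof (rule eq_matI)
  have gc: "g \<in> carrier_mat d d" using g by (simp add: carrier_GL)
  fix i k assume "i < dim_row (g * mat_of_cols d (map (word_vec x) us))" "k < dim_col (g * mat_of_cols d (map (word_vec x) us))"
  then have i: "i < d" and k: "k < d" using gc us by auto
  have uk: "us ! k \<in> words m n" using us k by auto
  have "col (mat_of_cols d (map (word_vec x) us)) k = word_vec x (us ! k)"
    using word_vec_carrier[OF x uk] us k by (simp add: col_mat_of_cols)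
  then show "mat_of_cols d (map (word_vec (act d g x)) us) $$ (i, k) = (g * mat_of_cols d (map (word_vec x) us)) $$ (i, k)"
    using i k us gc word_vec_act[OF g x uk] by (simp add: mat_of_cols_index)
qed (use g us in \<open>auto simp: carrier_GL\<close>)

text \<open>All word determinants are semi-invariants with the same character, so their vanishing is
  a property of orbits and their quotients are invariant.\<close>

lemma word_det_act:
  assumes g: "g \<in> carrier (GL d)" and x: "x \<in> tuples m d n" and us: "set us \<subseteq> words m n" "length us = d"
  shows "word_det d us (act d g x) = det g * word_det d us x"
  unfolding word_det_def mat_of_cols_words_act[OF assms]
  using g us mat_of_cols_carrier(1)[of d "map (word_vec x) us"] by (intro det_mult) (auto simp: carrier_GL)

lemma vec_subspace_carrier: "vec_subspace d (carrier_vec d)"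
  by (simp add: vec_subspace_iff)

lemma generated_subspace_eq:
  "generated_subspace d n x = \<Inter>{U. vec_subspace d U \<and> (\<lambda>v. fst x *\<^sub>v v) ` carrier_vec n \<subseteq> U \<and>
     (\<forall>\<phi>\<in>set (snd x). (\<lambda>w. \<phi> *\<^sub>v w) ` U \<subseteq> U)}"
  by (simp add: generated_subspace_def case_prod_unfold)

lemma generated_subspace_carrier:
  assumes x: "x \<in> tuples m d n"
  shows "generated_subspace d n x \<subseteq> carrier_vec d"
proof -
  have "(\<lambda>v. fst x *\<^sub>v v) ` carrier_vec n \<subseteq> carrier_vec d"
    using tuples_fst[OF x] by (auto intro: mult_mat_vec_carrier)
  moreover have "\<forall>\<phi>\<in>set (snd x). (\<lambda>w. \<phi> *\<^sub>v w) ` carrier_vec d \<subseteq> carrier_vec d"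
    using x by (auto simp: tuples_def intro: mult_mat_vec_carrier)
  ultimately show ?thesis
    unfolding generated_subspace_eq using vec_subspace_carrier[of d] by blast
qed

text \<open>An invariant subspace containing the image of \<open>f\<close> contains the vector of
  every word, by induction along the word, and here \<open>d\<close> of these vectors span.\<close>

lemma stable_of_word_basis:
  assumes x: "x \<in> tuples m d n" and us: "set us \<subseteq> words m n" "length us = d" and nz: "word_det d us x \<noteq> 0"
  shows "x \<in> stable_tuples m d n"
proof -
  have "v \<in> U" if v: "v \<in> carrier_vec d" and U: "vec_subspace d U"
    and f: "(\<lambda>v. fst x *\<^sub>v v) ` carrier_vec n \<subseteq> U" and \<phi>: "\<forall>\<phi>\<in>set (snd x). (\<lambda>w. \<phi> *\<^sub>v w) ` U \<subseteq> U" for v U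
  proof -
    have "word_vec x w \<in> U" if "w \<in> words m n" for w
      using that
    proof (induction rule: words_induct)
      case (single j)
      have "col (fst x) j = fst x *\<^sub>v unit_vec n j"
        using tuples_fst[OF x] single by (intro eq_vecI) auto
      then show ?case using f by auto
    next
      case (snoc w i)
      have "snd x ! i \<in> set (snd x)" using tuples_length[OF x] snoc by simp
      then show ?case using snoc \<phi> words_nonempty[OF snoc(1)] by auto
    qed
    then have "map (word_vec x) us ! k \<in> U" if "k < d" for k
    proof -
      have "us ! k \<in> words m n" using that us nth_mem[of k us] by blast
      then show ?thesis using \<open>\<And>w. w \<in> words m n \<Longrightarrow> word_vec x w \<in> U\<close> that us by simp
    qed
    then have "lcomb d d (coef d (map (word_vec x) us) v) (\<lambda>k. map (word_vec x) us ! k) \<in> U"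
      by (intro lcomb_in_subspace[OF U]) auto
    then show ?thesis using lcomb_coef[of d "map (word_vec x) us", OF _ v] vec_basis_words[OF x us] nz by simp
  qed
  then have "carrier_vec d \<subseteq> generated_subspace d n x" unfolding generated_subspace_eq by blast
  then show ?thesis using generated_subspace_carrier[OF x] x by (auto simp: stable_tuples_def)
qed

text \<open>This subspace is the span of the basis vectors at positions outside \<open>J\<close>,
  described by equations so that membership can be tested with \<open>coef\<close>.\<close>

lemma coef_zero_subspace:
  assumes us: "vec_basis d us" and J: "J \<subseteq> {..<d}"
  shows "vec_subspace d {v \<in> carrier_vec d. \<forall>k\<in>J. coef d us v k = 0}" (is "vec_subspace d ?W")
proof -
  have coef: "coef d us (lcomb d d a (\<lambda>k. us ! k)) k = a k" if "k \<in> J" for a k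
    using coef_lcomb[OF us] J that by auto
  have "v + w \<in> ?W" if v: "v \<in> ?W" and w: "w \<in> ?W" for v w
  proof -
    have "v + w = lcomb d d (coef d us v) (\<lambda>k. us ! k) + lcomb d d (coef d us w) (\<lambda>k. us ! k)"
      using lcomb_coef[OF us] v w by simp
    also have "\<dots> = lcomb d d (\<lambda>k. coef d us v k + coef d us w k) (\<lambda>k. us ! k)"
      by (intro eq_vecI) (auto simp: lcomb_def distrib_right sum.distrib)
    finally show ?thesis using v w coef by auto
  qed
  moreover have "c \<cdot>\<^sub>v v \<in> ?W" if v: "v \<in> ?W" for v c
  proof -
    have "c \<cdot>\<^sub>v v = c \<cdot>\<^sub>v lcomb d d (coef d us v) (\<lambda>k. us ! k)" using lcomb_coef[OF us] v by simp
    also have "\<dots> = lcomb d d (\<lambda>k. c * coef d us v k) (\<lambda>k. us ! k)"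
      by (intro eq_vecI) (auto simp: lcomb_def sum_distrib_left mult.assoc)
    finally show ?thesis using v coef by auto
  qed
  moreover have "0\<^sub>v d = lcomb d d (\<lambda>_. 0) (\<lambda>k. us ! k)" by (auto simp: lcomb_def)
  then have "0\<^sub>v d \<in> ?W" using coef by auto
  ultimately show ?thesis unfolding vec_subspace_iff by blast
qed

text \<open>A forest whose vectors are part of a basis grows, one critical word at a time, into a forest whose
  vectors form a basis: as long as vectors outside the forest remain in the basis, some critical word has a
  nonzero coefficient along one of them, because their common kernel cannot contain the image of \<open>f\<close>
  and be stable under all \<open>\<phi>\<^sub>i\<close>.\<close>

lemma extend_to_forest_basis:
  assumes x: "x \<in> stable_tuples m d n" and us: "vec_basis d us"
    and K: "K \<subseteq> {..<d}" "inj_on l K" "\<And>k. k \<in> K \<Longrightarrow> us ! k = word_vec x (l k)"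
    and P: "l ` K \<subseteq> words m n" "prefix_closed (l ` K)"
  shows "\<exists>S\<in>forests m n d. l ` K \<subseteq> S \<and> word_det d (sorted_list_of_set S) x \<noteq> 0"
  using us K P
\<comment> \<open>\<open>K\<close> holds the positions already occupied by word vectors and
  \<open>l\<close> the words standing there; each round exchanges the vector at one further
  position.\<close>
proof (induction "card ({..<d} - K)" arbitrary: us K l)
  case 0
  then have K: "K = {..<d}" by auto
  define S where "S = l ` K"
  have fin: "finite S" and card: "card S = d" using 0 by (auto simp: S_def K card_image)
  then have S: "S \<in> forests m n d" using 0 by (auto simp: forests_def S_def)
  have us: "us = map (word_vec x) (map l [0..<d])"
    using 0 K by (intro nth_equalityI) (auto simp: vec_basis_def)
  have "mset (map l [0..<d]) = mset_set S"
  proof -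
    have "distinct (map l [0..<d])" using 0 K by (simp add: distinct_map lessThan_atLeast0)
    then have "mset_set (set (map l [0..<d])) = mset (map l [0..<d])" by (rule mset_set_set)
    then show ?thesis by (simp add: S_def K lessThan_atLeast0)
  qed
  also have "\<dots> = mset (sorted_list_of_set S)"
    using mset_set_set[of "sorted_list_of_set S"] fin by simp
  finally have "mset (map (word_vec x) (sorted_list_of_set S)) = mset us"
    unfolding us by (metis mset_map)
  then have "vec_basis d (map (word_vec x) (sorted_list_of_set S))" using 0 vec_basis_perm by blast
  then have "word_det d (sorted_list_of_set S) x \<noteq> 0" by (simp add: vec_basis_def word_det_def)
  then show ?case using S by (auto simp: S_def)
next
  case (Suc r)
  have xt: "x \<in> tuples m d n" using x by (simp add: stable_tuples_def)
  let ?Q = "l ` K"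
  note us = Suc.prems(1)
  obtain k0 where k0: "k0 < d" "k0 \<notin> K" using Suc(2) 
  proof -
    have "{..<d} - K \<noteq> {}" using Suc(2) by (metis card.empty nat.distinct(1))
    then show thesis using that by blast
  qed
  have "\<exists>w\<in>critical m n ?Q. \<exists>k\<in>{..<d} - K. coef d us (word_vec x w) k \<noteq> 0"
  proof (rule ccontr)
    assume no: "\<not> ?thesis"
    define W where "W = {v \<in> carrier_vec d. \<forall>k\<in>{..<d} - K. coef d us v k = 0}"
    have sub: "vec_subspace d W"
      unfolding W_def by (rule coef_zero_subspace[OF us]) auto
    have QW: "word_vec x w \<in> W" if "w \<in> ?Q \<union> critical m n ?Q" for w
    proof -
      have "w \<in> words m n" using that Suc.prems(5) by (auto simp: critical_def)
      then have car: "word_vec x w \<in> carrier_vec d" by (rule word_vec_carrier[OF xt])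
      show ?thesis
      proof (cases "w \<in> ?Q")
        case True
        then obtain j where j: "j \<in> K" "w = l j" by blast
        then have "word_vec x w = us ! j" "j < d" using Suc.prems by auto
        then show ?thesis using car j coef_nth[OF us] by (auto simp: W_def)
      next
        case False
        then show ?thesis using that no car by (auto simp: W_def)
      qed
    qed
    have fW: "(\<lambda>v. fst x *\<^sub>v v) ` carrier_vec n \<subseteq> W"
    proof (rule image_subsetI)
      fix v :: "complex vec" assume v: "v \<in> carrier_vec n"
      have F: "fst x \<in> carrier_mat d n" by (rule tuples_fst[OF xt])
      have eq: "fst x *\<^sub>v v = lcomb d n (\<lambda>j. v $ j) (\<lambda>j. word_vec x [j])"
        using F v by (intro eq_vecI) (auto simp: lcomb_def scalar_prod_def atLeast0LessThan mult.commute intro!: sum.cong)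
      have "[j] \<in> ?Q \<union> critical m n ?Q" if "j < n" for j
        using that by (auto simp: critical_def Cons_eq_append_conv)
      then show "fst x *\<^sub>v v \<in> W"
        unfolding eq using QW by (intro lcomb_in_subspace[OF sub]) blast
    qed
    have \<phi>W: "\<forall>\<phi>\<in>set (snd x). (\<lambda>w. \<phi> *\<^sub>v w) ` W \<subseteq> W"
    proof (intro ballI image_subsetI)
      fix \<phi> v assume "\<phi> \<in> set (snd x)" and v: "v \<in> W"
      then obtain i where i: "i < m" "\<phi> = snd x ! i" using tuples_length[OF xt] by (metis in_set_conv_nth)
      have \<phi>: "\<phi> \<in> carrier_mat d d" using tuples_snd[OF xt] i by simp
      have uk: "us ! k \<in> carrier_vec d" if "k < d" for k using us that by (auto simp: vec_basis_def)
      have "v \<in> carrier_vec d" using v by (simp add: W_def)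
      then have "\<phi> *\<^sub>v v = \<phi> *\<^sub>v lcomb d d (coef d us v) (\<lambda>k. us ! k)" using lcomb_coef[OF us] by simp
      also have "\<dots> = lcomb d d (coef d us v) (\<lambda>k. \<phi> *\<^sub>v us ! k)" by (rule mult_mat_vec_lcomb[OF \<phi> uk])
      also have "\<dots> \<in> W"
      proof (rule lcomb_in_subspace[OF sub])
        fix k assume k: "k < d"
        show "coef d us v k = 0 \<or> \<phi> *\<^sub>v us ! k \<in> W"
        proof (cases "k \<in> K")
          case True
          then have lk: "l k \<in> words m n" "l k \<in> ?Q" using Suc.prems(5) by auto
          then have "l k @ [i] \<in> ?Q \<union> critical m n ?Q"
            using i words_nonempty[OF lk(1)] by (auto simp: critical_def)
          then have "word_vec x (l k @ [i]) \<in> W" by (rule QW)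
          then show ?thesis using Suc.prems(4)[OF True] i words_nonempty[OF lk(1)] by simp
        next
          case False
          then show ?thesis using v k by (auto simp: W_def)
        qed
      qed
      finally show "\<phi> *\<^sub>v v \<in> W" .
    qed
    have "generated_subspace d n x \<subseteq> W"
      unfolding generated_subspace_eq using sub fW \<phi>W by blast
    \<comment> \<open>Stability forces \<open>W\<close> to be the whole space, although the basis
      vector at the unoccupied position \<open>k0\<close> has coordinate 1 along itself.\<close>
    then have "carrier_vec d \<subseteq> W" using x by (simp add: stable_tuples_def)
    moreover have "us ! k0 \<in> carrier_vec d" using us k0 by (auto simp: vec_basis_def)
    ultimately have "coef d us (us ! k0) k0 = 0" using k0 by (auto simp: W_def)
    then show False using coef_nth[OF us k0(1) k0(1)] by simp
  qed
  then obtain w k where w: "w \<in> critical m n ?Q" and k: "k < d" "k \<notin> K" and nz: "coef d us (word_vec x w) k \<noteq> 0"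
    by blast
  have ww: "w \<in> words m n" "w \<notin> ?Q" using w by (auto simp: critical_def)
  define K' where "K' = insert k K"
  define l' where "l' = l(k := w)"
  have im: "l' ` K' = insert w ?Q" using k by (auto simp: l'_def K'_def)
  have "\<exists>S\<in>forests m n d. l' ` K' \<subseteq> S \<and> word_det d (sorted_list_of_set S) x \<noteq> 0"
  proof (rule Suc.hyps(1))
    have eq: "insert k ({..<d} - K') = {..<d} - K" using k by (auto simp: K'_def)
    have "k \<notin> {..<d} - K'" by (simp add: K'_def)
    then have "card ({..<d} - K) = Suc (card ({..<d} - K'))"
      using card_insert_disjoint[of "{..<d} - K'" k] unfolding eq by simp
    then show "r = card ({..<d} - K')" using Suc.hyps(2) by simp
    show "vec_basis d (us[k := word_vec x w])"
      by (rule vec_basis_update[OF us word_vec_carrier[OF xt ww(1)] k(1) nz])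
    show "K' \<subseteq> {..<d}" using Suc.prems(2) k by (auto simp: K'_def)
    show "inj_on l' K'" using Suc.prems(3) k ww by (auto simp: l'_def K'_def inj_on_def)
    show "us[k := word_vec x w] ! j = word_vec x (l' j)" if "j \<in> K'" for j
      using that Suc.prems(2,4) k us by (auto simp: K'_def l'_def vec_basis_def)
    show "l' ` K' \<subseteq> words m n" using im ww Suc.prems(5) by auto
    show "prefix_closed (l' ` K')"
      using Suc.prems(6) w unfolding im by (auto simp: prefix_closed_def critical_def)
  qed
  then show ?case using im by auto
qed

section \<open>Normal forms on the chart of a forest\<close>

lemma forestsD:
  assumes "S \<in> forests m n d"
  shows "finite S" "card S = d" "S \<subseteq> words m n" "prefix_closed S"
    "set (sorted_list_of_set S) = S" "length (sorted_list_of_set S) = d"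
    "distinct (sorted_list_of_set S)" "sorted_wrt (<) (sorted_list_of_set S)"
  using assms by (auto simp: forests_def)

text \<open>The coordinate of the vector of \<open>w\<close> along the \<open>k\<close>-th word of
  \<open>ws\<close>, by Cramer's rule. It is written with word determinants so that invariance and
  regularity are immediate.\<close>

definition wcoord :: "nat \<Rightarrow> nat list list \<Rightarrow> nat list \<Rightarrow> nat \<Rightarrow> tuple \<Rightarrow> complex" where
  "wcoord d ws w k x = word_det d (ws[k := w]) x / word_det d ws x"

lemma wcoord_eq_coef: "wcoord d ws w k x = coef d (map (word_vec x) ws) (word_vec x w) k"
  by (simp add: wcoord_def coef_def word_det_def map_update)

lemma wcoord_act:
  assumes g: "g \<in> carrier (GL d)" and x: "x \<in> tuples m d n" and ws: "set ws \<subseteq> words m n" "length ws = d"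
    and w: "w \<in> words m n"
  shows "wcoord d ws w k (act d g x) = wcoord d ws w k x"
proof -
  have "set (ws[k := w]) \<subseteq> words m n" using ws w set_update_subset_insert[of ws k w] by auto
  then show ?thesis
    using g word_det_act[OF g x, of "ws[k := w]"] word_det_act[OF g x ws] ws
    by (simp add: wcoord_def carrier_GL)
qed

text \<open>A word of the forest gets the standard basis vector of its position; for other words the
  parameters \<open>c\<close> are free.\<close>

definition coordvec :: "nat \<Rightarrow> nat list list \<Rightarrow> (nat list \<times> nat \<Rightarrow> complex) \<Rightarrow> nat list \<Rightarrow> complex vec" where
  "coordvec d ws c w = vec d (\<lambda>k. if w \<in> set ws then if ws ! k = w then 1 else 0 else c (w, k))"

text \<open>With the forest words as standard basis, each column of the tuple is the vector of a
  root or of a child of a node. These words are in the forest or critical, so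
  \<open>coordvec\<close> prescribes all columns.\<close>

definition normal_form :: "nat \<Rightarrow> nat \<Rightarrow> nat \<Rightarrow> nat list list \<Rightarrow> (nat list \<times> nat \<Rightarrow> complex) \<Rightarrow> tuple" where
  "normal_form m d n ws c =
     (mat d n (\<lambda>(i, j). coordvec d ws c [j] $ i),
      map (\<lambda>l. mat d d (\<lambda>(i, k). coordvec d ws c (ws ! k @ [l]) $ i)) [0..<m])"

lemma coordvec_carrier [simp]: "coordvec d ws c w \<in> carrier_vec d" "dim_vec (coordvec d ws c w) = d"
  by (simp_all add: coordvec_def)

lemma coordvec_nth:
  assumes "distinct ws" "length ws = d" "k < d"
  shows "coordvec d ws c (ws ! k) = unit_vec d k"
  using assms by (intro eq_vecI) (auto simp: coordvec_def nth_eq_iff_index_eq)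

lemma normal_form_in_tuples: "normal_form m d n ws c \<in> tuples m d n"
  by (auto simp: normal_form_def tuples_def)

text \<open>Induction along the word: the parent lies in the forest, so its vector is a standard
  basis vector, and the last endomorphism picks out exactly the prescribed column.\<close>

lemma word_vec_normal_form:
  assumes S: "S \<in> forests m n d" and w: "w \<in> S \<union> critical m n S"
  shows "word_vec (normal_form m d n (sorted_list_of_set S) c) w = coordvec d (sorted_list_of_set S) c w"
proof -
  note F = forestsD[OF S]
  let ?ws = "sorted_list_of_set S"
  have "w \<in> words m n" using w F by (auto simp: critical_def)
  then show ?thesis using w
  proof (induction rule: words_induct)
    case (single j)
    then show ?case by (intro eq_vecI) (auto simp: normal_form_def)
  next
    case (snoc w i)
    have ne: "w \<noteq> []" by (rule words_nonempty[OF snoc(1)])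
    have wS: "w \<in> S" using snoc.prems F(4) ne unfolding prefix_closed_def critical_def by blast
    then obtain k where k: "k < d" "?ws ! k = w" using F by (metis in_set_conv_nth)
    have "word_vec (normal_form m d n ?ws c) (w @ [i]) = snd (normal_form m d n ?ws c) ! i *\<^sub>v unit_vec d k"
      using snoc.IH wS ne coordvec_nth[OF F(7,6) k(1), of c] k(2) by simp
    also have "\<dots> = coordvec d ?ws c (w @ [i])"
      using snoc(2) k by (intro eq_vecI) (auto simp: normal_form_def)
    finally show ?case .
  qed
qed

lemma normal_form_basis:
  assumes S: "S \<in> forests m n d"
  shows "mat_of_cols d (map (word_vec (normal_form m d n (sorted_list_of_set S) c)) (sorted_list_of_set S)) = 1\<^sub>m d"
proof (rule eq_matI)
  note F = forestsD[OF S]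
  let ?ws = "sorted_list_of_set S"
  fix i k assume "i < dim_row (1\<^sub>m d :: complex mat)" "k < dim_col (1\<^sub>m d :: complex mat)"
  then have ik: "i < d" "k < d" by auto
  then have "?ws ! k \<in> S" using F by (metis nth_mem)
  then show "mat_of_cols d (map (word_vec (normal_form m d n ?ws c)) ?ws) $$ (i, k) = 1\<^sub>m d $$ (i, k)"
    using ik F word_vec_normal_form[OF S, of "?ws ! k" c] coordvec_nth[OF F(7,6) ik(2), of c]
    by (simp add: mat_of_cols_index)
qed (use forestsD[OF S] in auto)

lemma word_det_normal_form:
  "S \<in> forests m n d \<Longrightarrow> word_det d (sorted_list_of_set S) (normal_form m d n (sorted_list_of_set S) c) = 1"
  by (simp add: word_det_def normal_form_basis)

text \<open>The parameters are recovered by invariant functions, so normal forms with different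
  parameters on critical words lie in different orbits.\<close>

lemma wcoord_normal_form:
  assumes S: "S \<in> forests m n d" and w: "w \<in> critical m n S" and k: "k < d"
  shows "wcoord d (sorted_list_of_set S) w k (normal_form m d n (sorted_list_of_set S) c) = c (w, k)"
proof -
  note F = forestsD[OF S]
  let ?ws = "sorted_list_of_set S" and ?y = "normal_form m d n (sorted_list_of_set S) c"
  have B: "vec_basis d (map (word_vec ?y) ?ws)"
    using vec_basis_words[OF normal_form_in_tuples] F word_det_normal_form[OF S, of c] by simp
  have nS: "w \<notin> S" using w by (simp add: critical_def)
  have nth: "map (word_vec ?y) ?ws ! k = unit_vec d k" if "k < d" for k
  proof -
    have "?ws ! k \<in> S" using F that by (metis nth_mem)
    then show ?thesis using that F word_vec_normal_form[OF S, of "?ws ! k" c] coordvec_nth[OF F(7,6) that, of c] by simp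
  qed
  have "word_vec ?y w = coordvec d ?ws c w" using word_vec_normal_form[OF S] w by simp
  also have "\<dots> = lcomb d d (\<lambda>k. c (w, k)) (\<lambda>k. map (word_vec ?y) ?ws ! k)"
  proof (rule eq_vecI)
    fix i assume "i < dim_vec (lcomb d d (\<lambda>k. c (w, k)) (\<lambda>k. map (word_vec ?y) ?ws ! k))"
    then have i: "i < d" by (simp add: lcomb_def)
    have "(\<Sum>k<d. c (w, k) * map (word_vec ?y) ?ws ! k $ i) = (\<Sum>k<d. if k = i then c (w, k) else 0)"
      using i by (intro sum.cong) (auto simp: nth simp del: nth_map)
    then show "coordvec d ?ws c w $ i = lcomb d d (\<lambda>k. c (w, k)) (\<lambda>k. map (word_vec ?y) ?ws ! k) $ i"
      using i nS F by (simp add: lcomb_def coordvec_def)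
  qed (simp add: lcomb_def)
  finally show ?thesis unfolding wcoord_eq_coef using coef_lcomb[OF B k, of "\<lambda>k. c (w, k)"] by simp
qed

text \<open>The matrix with the vectors of the forest words as columns is the change of basis from
  the normal form to \<open>x\<close>: it carries the prescribed coordinates of each forest or
  critical word to the vector of that word, and these words account for all columns.\<close>

lemma act_normal_form:
  assumes S: "S \<in> forests m n d" and x: "x \<in> tuples m d n" and nz: "word_det d (sorted_list_of_set S) x \<noteq> 0"
    and c: "\<And>w k. w \<in> critical m n S \<Longrightarrow> k < d \<Longrightarrow> c (w, k) = wcoord d (sorted_list_of_set S) w k x"
  shows "mat_of_cols d (map (word_vec x) (sorted_list_of_set S)) \<in> carrier (GL d)"
    and "act d (mat_of_cols d (map (word_vec x) (sorted_list_of_set S)))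
           (normal_form m d n (sorted_list_of_set S) c) = x"
proof -
  note F = forestsD[OF S]
  let ?ws = "sorted_list_of_set S" and ?y = "normal_form m d n (sorted_list_of_set S) c"
  let ?g = "mat_of_cols d (map (word_vec x) ?ws)"
  have gc: "?g \<in> carrier_mat d d" using F mat_of_cols_carrier(1)[of d "map (word_vec x) ?ws"] by simp
  then show g: "?g \<in> carrier (GL d)" using nz by (simp add: carrier_GL word_det_def)
  have B: "vec_basis d (map (word_vec x) ?ws)" using vec_basis_words[OF x] F nz by simp
  have gv: "?g *\<^sub>v v = lcomb d d (\<lambda>k. v $ k) (\<lambda>k. map (word_vec x) ?ws ! k)" if "v \<in> carrier_vec d" for v
    using mat_of_cols_mult_vec[of "map (word_vec x) ?ws" d v d] F that by simp
  have gcoord: "?g *\<^sub>v coordvec d ?ws c w = word_vec x w" if w: "w \<in> S \<union> critical m n S" for w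
  proof -
    have ww: "w \<in> words m n" using w F by (auto simp: critical_def)
    have xw: "word_vec x w \<in> carrier_vec d" by (rule word_vec_carrier[OF x ww])
    have "coordvec d ?ws c w $ k = coef d (map (word_vec x) ?ws) (word_vec x w) k" if k: "k < d" for k
    proof (cases "w \<in> S")
      case True
      then obtain j where j: "j < d" "w = ?ws ! j" using F by (metis in_set_conv_nth)
      then show ?thesis using coef_nth[OF B k j(1)] coordvec_nth[OF F(7,6) j(1), of c] F k by (auto simp: unit_vec_def)
    next
      case False
      then show ?thesis using w c k F by (simp add: coordvec_def wcoord_eq_coef)
    qed
    then have "lcomb d d (\<lambda>k. coordvec d ?ws c w $ k) (\<lambda>k. map (word_vec x) ?ws ! k) =
        lcomb d d (coef d (map (word_vec x) ?ws) (word_vec x w)) (\<lambda>k. map (word_vec x) ?ws ! k)"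
      by (rule lcomb_cong) auto
    then show ?thesis unfolding gv[OF coordvec_carrier(1)] lcomb_coef[OF B xw] .
  qed
  have root: "[j] \<in> S \<union> critical m n S" if "j < n" for j
    using that by (auto simp: critical_def Cons_eq_append_conv)
  have child: "?ws ! k @ [l] \<in> S \<union> critical m n S" "?ws ! k \<in> words m n" if "k < d" "l < m" for k l
  proof -
    have "?ws ! k \<in> S" using F that by (metis nth_mem)
    then show "?ws ! k \<in> words m n" using F by auto
    then show "?ws ! k @ [l] \<in> S \<union> critical m n S"
      using \<open>?ws ! k \<in> S\<close> that words_nonempty by (auto simp: critical_def)
  qed
  have fst: "?g * fst ?y = fst x"
  proof (rule eq_matI)
    fix i j assume "i < dim_row (fst x)" "j < dim_col (fst x)"
    then have ij: "i < d" "j < n" using tuples_fst[OF x] by auto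
    have "col (fst ?y) j = coordvec d ?ws c [j]" using ij by (intro eq_vecI) (auto simp: normal_form_def)
    then have "(?g * fst ?y) $$ (i, j) = (?g *\<^sub>v coordvec d ?ws c [j]) $ i"
      using ij gc F by (simp add: normal_form_def)
    then show "(?g * fst ?y) $$ (i, j) = fst x $$ (i, j)"
      using gcoord[OF root[OF ij(2)]] ij tuples_fst[OF x] by simp
  qed (use gc tuples_fst[OF x] in \<open>auto simp: normal_form_def\<close>)
  have snd: "?g * (snd ?y ! l) * inv\<^bsub>GL d\<^esub> ?g = snd x ! l" if l: "l < m" for l
  proof -
    have X: "snd x ! l \<in> carrier_mat d d" and Y: "snd ?y ! l \<in> carrier_mat d d"
      using tuples_snd[OF x l] tuples_snd[OF normal_form_in_tuples l] by auto
    \<comment> \<open>The \<open>k\<close>-th column of either side is the vector of the child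
      \<open>?ws ! k @ [l]\<close>.\<close>
    have "?g * (snd ?y ! l) = snd x ! l * ?g"
    proof (rule eq_matI)
      fix i k assume "i < dim_row (snd x ! l * ?g)" "k < dim_col (snd x ! l * ?g)"
      then have ik: "i < d" "k < d" using X gc by auto
      have colY: "col (snd ?y ! l) k = coordvec d ?ws c (?ws ! k @ [l])"
        using ik l by (intro eq_vecI) (auto simp: normal_form_def)
      have colg: "col ?g k = word_vec x (?ws ! k)"
        using F ik word_vec_carrier[OF x child(2)[OF ik(2) l]] by (simp add: col_mat_of_cols)
      have "(?g * (snd ?y ! l)) $$ (i, k) = (?g *\<^sub>v col (snd ?y ! l) k) $ i"
        using ik gc Y by simp
      also have "\<dots> = word_vec x (?ws ! k @ [l]) $ i"
        unfolding colY using gcoord[OF child(1)[OF ik(2) l]] by simp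
      also have "\<dots> = (snd x ! l *\<^sub>v col ?g k) $ i"
        unfolding colg using words_nonempty[OF child(2)[OF ik(2) l]] by simp
      also have "\<dots> = (snd x ! l * ?g) $$ (i, k)" using ik X gc F by simp
      finally show "(?g * (snd ?y ! l)) $$ (i, k) = (snd x ! l * ?g) $$ (i, k)" .
    qed (use X Y gc in auto)
    then have "?g * (snd ?y ! l) * inv\<^bsub>GL d\<^esub> ?g = snd x ! l * (?g * inv\<^bsub>GL d\<^esub> ?g)"
      using X gc inv_GL(1)[OF g] by (simp add: assoc_mult_mat[of _ d d _ d _ d])
    then show ?thesis using inv_GL(2)[OF g] X right_mult_one_mat[OF X] by simp
  qed
  have len: "length (snd ?y) = m" by (simp add: normal_form_def)
  show "act d ?g ?y = x"
  proof (rule prod_eqI)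
    show "fst (act d ?g ?y) = fst x" by (simp add: fst)
    show "snd (act d ?g ?y) = snd x"
      using snd len tuples_length[OF x] by (intro nth_equalityI) auto
  qed
qed

text \<open>On the chart of the forest \<open>S\<close>, the union of the charts of the lexicographically smaller forests
  is the complement of a linear subspace.\<close>

lemma smaller_forest_iff:
  assumes S: "S \<in> forests m n d" and x: "x \<in> tuples m d n" and nz: "word_det d (sorted_list_of_set S) x \<noteq> 0"
  shows "(\<exists>S'\<in>forests m n d. sorted_list_of_set S' < sorted_list_of_set S \<and> word_det d (sorted_list_of_set S') x \<noteq> 0)
    \<longleftrightarrow> (\<exists>w\<in>critical m n S. \<exists>k<d. w < sorted_list_of_set S ! k \<and> wcoord d (sorted_list_of_set S) w k x \<noteq> 0)"
    (is "?L \<longleftrightarrow> ?R")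
proof
  note F = forestsD[OF S]
  let ?ws = "sorted_list_of_set S"
  have B: "vec_basis d (map (word_vec x) ?ws)" using vec_basis_words[OF x] F nz by simp
  {
    assume ?L
    then obtain S' where S': "S' \<in> forests m n d" "sorted_list_of_set S' < ?ws" "word_det d (sorted_list_of_set S') x \<noteq> 0"
      by blast
    note F' = forestsD[OF S'(1)]
    let ?ws' = "sorted_list_of_set S'"
    have B': "vec_basis d (map (word_vec x) ?ws')" using vec_basis_words[OF x] F' S'(3) by simp
    \<comment> \<open>\<open>w\<close> is the first word at which the forests differ. Its parent is
      smaller, hence in both forests, so \<open>w\<close> is critical for \<open>S\<close>.\<close>
    obtain w where w: "w \<in> S'" "w \<notin> S" "\<And>v. v < w \<Longrightarrow> v \<in> S' \<longleftrightarrow> v \<in> S"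
      using sorted_first_difference[OF F'(8) F(8) _ S'(2)] F F' by auto
    have crit: "w \<in> critical m n S"
      using w F'(3,4) less_snoc unfolding critical_def prefix_closed_def by blast
    have xw: "word_vec x w \<in> carrier_vec d" using word_vec_carrier[OF x] w(1) F'(3) by auto
    show ?R
    proof (rule ccontr)
      assume no: "\<not> ?R"
      obtain t where t: "t < d" "?ws' ! t = w" using w(1) F' by (metis in_set_conv_nth)
      \<comment> \<open>Otherwise the vector of \<open>w\<close> is a combination of vectors of
        words of \<open>S\<close> below \<open>w\<close>. These words all belong to
        \<open>S'\<close>, so in the basis of \<open>S'\<close> the coordinate along
        \<open>w\<close> would be 0 and not 1.\<close>
      let ?W = "{v \<in> carrier_vec d. \<forall>k\<in>{t}. coef d (map (word_vec x) ?ws') v k = 0}"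
      have sub: "vec_subspace d ?W" by (rule coef_zero_subspace[OF B']) (use t in auto)
      have "lcomb d d (coef d (map (word_vec x) ?ws) (word_vec x w)) (\<lambda>k. map (word_vec x) ?ws ! k) \<in> ?W"
      proof (rule lcomb_in_subspace[OF sub])
        fix k assume k: "k < d"
        have kS: "?ws ! k \<in> S" using F k by (metis nth_mem)
        show "coef d (map (word_vec x) ?ws) (word_vec x w) k = 0 \<or> map (word_vec x) ?ws ! k \<in> ?W"
        proof (cases "?ws ! k < w")
          case True
          then have "?ws ! k \<in> S'" using w(3) kS by blast
          then obtain s where s: "s < d" "?ws' ! s = ?ws ! k" using F' by (metis in_set_conv_nth)
          have "s \<noteq> t" using s t True by auto
          then have "coef d (map (word_vec x) ?ws') (map (word_vec x) ?ws' ! s) t = 0"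
            using coef_nth[OF B' t(1) s(1)] by simp
          moreover have "map (word_vec x) ?ws' ! s = map (word_vec x) ?ws ! k" using s F F' k by simp
          moreover have "map (word_vec x) ?ws ! k \<in> carrier_vec d"
            using word_vec_carrier[OF x] kS F k by auto
          ultimately show ?thesis by simp
        next
          case False
          then have "w < ?ws ! k" using w(2) kS by (metis linorder_cases)
          then have "wcoord d ?ws w k x = 0" using no crit k by blast
          then show ?thesis by (simp add: wcoord_eq_coef)
        qed
      qed
      then have "coef d (map (word_vec x) ?ws') (word_vec x w) t = 0" using lcomb_coef[OF B xw] by simp
      moreover have "coef d (map (word_vec x) ?ws') (word_vec x w) t = 1"
        using coef_nth[OF B' t(1) t(1)] t F' by simp
      ultimately show False by simp
    qed
  next
    assume ?R
    then obtain w k where w: "w \<in> critical m n S" and k: "k < d" "w < ?ws ! k" and cnz: "wcoord d ?ws w k x \<noteq> 0"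
      by blast
    have ww: "w \<in> words m n" "w \<notin> S" using w by (auto simp: critical_def)
    have us: "vec_basis d (map (word_vec x) (?ws[k := w]))"
      using vec_basis_update[OF B word_vec_carrier[OF x ww(1)] k(1)] cnz by (simp add: wcoord_eq_coef map_update)
    \<comment> \<open>Position \<open>k\<close> now carries \<open>w\<close>, and of the old words
      only those below \<open>w\<close> are kept. Every word of \<open>S\<close> that gets lost
      later lies above \<open>w\<close>, so the resulting forest is smaller.\<close>
    define K where "K = insert k {j. j < d \<and> ?ws ! j < w}"
    define l where "l j = ?ws[k := w] ! j" for j
    have lk: "l k = w" using k F by (simp add: l_def)
    have lj: "l j = ?ws ! j" if "j \<noteq> k" for j using that by (simp add: l_def)
    have im: "l ` K = insert w {s \<in> S. s < w}"
    proof -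
      have "l ` {j. j < d \<and> ?ws ! j < w} = {s \<in> S. s < w}"
      proof (rule equalityI; rule subsetI)
        fix s assume "s \<in> l ` {j. j < d \<and> ?ws ! j < w}"
        then obtain j where j: "j < d" "?ws ! j < w" "s = l j" by blast
        then have "s = ?ws ! j" using lj k by (metis order_less_asym)
        moreover have "?ws ! j \<in> S" using F j by (metis nth_mem)
        ultimately show "s \<in> {s \<in> S. s < w}" using j by simp
      next
        fix s assume s: "s \<in> {s \<in> S. s < w}"
        then obtain j where j: "j < d" "?ws ! j = s" using F by (metis (no_types, lifting) in_set_conv_nth mem_Collect_eq)
        have "s < w" using s by simp
        then have "j \<noteq> k" using j(2) k(2) by (metis order_less_asym)
        then show "s \<in> l ` {j. j < d \<and> ?ws ! j < w}" using j lj[of j] s by (intro image_eqI[of _ _ j]) auto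
      qed
      then show ?thesis using lk by (simp add: K_def)
    qed
    have xs: "x \<in> stable_tuples m d n" using stable_of_word_basis[OF x _ _ nz] F by simp
    have "\<exists>S'\<in>forests m n d. l ` K \<subseteq> S' \<and> word_det d (sorted_list_of_set S') x \<noteq> 0"
    proof (rule extend_to_forest_basis[OF xs us])
      show "K \<subseteq> {..<d}" using k by (auto simp: K_def)
      show "inj_on l K"
      proof (rule inj_onI)
        fix i j assume ij: "i \<in> K" "j \<in> K" "l i = l j"
        have d: "i < d" "j < d" using ij k by (auto simp: K_def)
        then have mem: "?ws ! i \<in> S" "?ws ! j \<in> S" using F by (metis nth_mem)+
        show "i = j"
        proof (cases "i = k \<or> j = k")
          case True
          then show ?thesis using ij(3) lk lj ww(2) mem by metis
        next
          case False
          then show ?thesis using ij(3) lj F d by (simp add: nth_eq_iff_index_eq)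
        qed
      qed
      show "map (word_vec x) (?ws[k := w]) ! j = word_vec x (l j)" if "j \<in> K" for j
        using that k F by (auto simp: l_def K_def)
      show "l ` K \<subseteq> words m n" using im ww F by auto
      show "prefix_closed (l ` K)"
        unfolding im prefix_closed_def
      proof (intro allI impI)
        fix v i assume v: "v \<noteq> []" "v @ [i] \<in> insert w {s \<in> S. s < w}"
        have vl: "v < v @ [i]" by (rule less_snoc)
        show "v \<in> insert w {s \<in> S. s < w}"
        proof (cases "v @ [i] = w")
          case True
          then have "v \<in> S" using w v by (auto simp: critical_def)
          then show ?thesis using vl True by simp
        next
          case False
          then have "v @ [i] \<in> S" "v @ [i] < w" using v by auto
          then show ?thesis using F(4) v vl unfolding prefix_closed_def by (metis (mono_tags, lifting) insertCI mem_Collect_eq order_less_trans)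
        qed
      qed
    qed
    then obtain S' where S': "S' \<in> forests m n d" "l ` K \<subseteq> S'" "word_det d (sorted_list_of_set S') x \<noteq> 0" by blast
    note F' = forestsD[OF S'(1)]
    have "sorted_list_of_set S' < ?ws"
    proof (rule sorted_less_of_first_difference[OF F'(8) F(8)])
      show "length (sorted_list_of_set S') = length ?ws" using F F' by simp
      show "w \<in> set (sorted_list_of_set S')" "w \<notin> set ?ws" using F F' S'(2) im ww by auto
      fix v assume "v \<in> set ?ws" "v \<notin> set (sorted_list_of_set S')"
      then have v: "v \<in> S" "v \<notin> insert w {s \<in> S. s < w}" using F F' S'(2) im by auto
      then have "v \<noteq> w" "\<not> v < w" by auto
      then show "w < v" by (cases v w rule: linorder_cases) auto
    qed
    then show ?L using S' by blast
  }
qed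

section \<open>The complex topology of the charts\<close>

text \<open>Agreement is required on tuples only: polynomial functions live on the whole type, while
  for instance the Leibniz expansion of a determinant needs matrices of the right size.\<close>

definition polynomial_on :: "nat \<Rightarrow> nat \<Rightarrow> nat \<Rightarrow> (tuple \<Rightarrow> complex) \<Rightarrow> bool" where
  "polynomial_on m d n f \<longleftrightarrow> (\<exists>p\<in>polynomial_functions m d n. \<forall>x\<in>tuples m d n. p x = f x)"

lemma polynomial_on_const [intro]: "polynomial_on m d n (\<lambda>x. c)"
  unfolding polynomial_on_def by (rule bexI[OF _ polynomial_functions.const[of c]]) simp

lemma polynomial_on_add [intro]:
  assumes "polynomial_on m d n f" "polynomial_on m d n g"
  shows "polynomial_on m d n (\<lambda>x. f x + g x)"
proof -
  obtain p r where "p \<in> polynomial_functions m d n" "\<forall>x\<in>tuples m d n. p x = f x"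
    "r \<in> polynomial_functions m d n" "\<forall>x\<in>tuples m d n. r x = g x"
    using assms unfolding polynomial_on_def by blast
  then show ?thesis
    unfolding polynomial_on_def by (intro bexI[OF _ polynomial_functions.add[of p _ _ _ r]]) auto
qed

lemma polynomial_on_mult [intro]:
  assumes "polynomial_on m d n f" "polynomial_on m d n g"
  shows "polynomial_on m d n (\<lambda>x. f x * g x)"
proof -
  obtain p r where "p \<in> polynomial_functions m d n" "\<forall>x\<in>tuples m d n. p x = f x"
    "r \<in> polynomial_functions m d n" "\<forall>x\<in>tuples m d n. r x = g x"
    using assms unfolding polynomial_on_def by blast
  then show ?thesis
    unfolding polynomial_on_def by (intro bexI[OF _ polynomial_functions.mult[of p _ _ _ r]]) auto
qed

lemma polynomial_on_sum:
  "(\<And>i. i \<in> I \<Longrightarrow> polynomial_on m d n (f i)) \<Longrightarrow> polynomial_on m d n (\<lambda>x. \<Sum>i\<in>I. f i x)"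
  by (induction I rule: infinite_finite_induct) auto

lemma polynomial_on_prod:
  "(\<And>i. i \<in> I \<Longrightarrow> polynomial_on m d n (f i)) \<Longrightarrow> polynomial_on m d n (\<lambda>x. \<Prod>i\<in>I. f i x)"
  by (induction I rule: infinite_finite_induct) auto

lemma polynomial_on_cong:
  "polynomial_on m d n f \<Longrightarrow> (\<And>x. x \<in> tuples m d n \<Longrightarrow> f x = g x) \<Longrightarrow> polynomial_on m d n g"
  unfolding polynomial_on_def by auto

lemma polynomial_on_word_vec:
  assumes "w \<in> words m n" "i < d"
  shows "polynomial_on m d n (\<lambda>x. word_vec x w $ i)"
  using assms
proof (induction arbitrary: i rule: words_induct)
  case (single j)
  have "polynomial_on m d n (\<lambda>x. fst x $$ (i, j))"
    unfolding polynomial_on_def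
    by (rule bexI[of _ "\<lambda>x. fst x $$ (i, j)"], simp, rule polynomial_functions.coord_f[OF single(2,1)])
  then show ?case
  proof (rule polynomial_on_cong)
    fix x assume "x \<in> tuples m d n"
    from tuples_fst[OF this] show "fst x $$ (i, j) = word_vec x [j] $ i" using single by simp
  qed
next
  case (snoc w l)
  have "polynomial_on m d n (\<lambda>x. (snd x ! l) $$ (i, j))" if "j < d" for j
    unfolding polynomial_on_def 
    by (rule bexI[of _ "\<lambda>x. (snd x ! l) $$ (i, j)"], simp, rule polynomial_functions.coord_phi[OF snoc(2,4) that])
  then have "polynomial_on m d n (\<lambda>x. \<Sum>j<d. (snd x ! l) $$ (i, j) * word_vec x w $ j)"
    by (intro polynomial_on_sum polynomial_on_mult snoc.IH) auto
  then show ?case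
  proof (rule polynomial_on_cong)
    fix x assume x: "x \<in> tuples m d n"
    have "dim_vec (word_vec x w) = d" using word_vec_carrier[OF x snoc(1)] by simp
    then show "(\<Sum>j<d. (snd x ! l) $$ (i, j) * word_vec x w $ j) = word_vec x (w @ [l]) $ i"
      using tuples_snd[OF x snoc(2)] words_nonempty[OF snoc(1)] snoc.prems
      by (simp add: scalar_prod_def atLeast0LessThan)
  qed
qed

lemma polynomial_on_word_det:
  assumes us: "set us \<subseteq> words m n" "length us = d"
  shows "polynomial_on m d n (word_det d us)"
proof -
  have "polynomial_on m d n (\<lambda>x. \<Sum>p | p permutes {0..<d}. signof p * (\<Prod>i = 0..<d. word_vec x (us ! p i) $ i))"
  proof (intro polynomial_on_sum polynomial_on_mult polynomial_on_prod polynomial_on_const)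
    fix p i assume "p \<in> {p. p permutes {0..<d}}" "i \<in> {0..<d}"
    then have "p i < d" "i < d" using permutes_in_image[of p "{0..<d}" i] by auto
    then show "polynomial_on m d n (\<lambda>x. word_vec x (us ! p i) $ i)"
      using us nth_mem[of "p i" us] by (intro polynomial_on_word_vec) auto
  qed
  then show ?thesis
  proof (rule polynomial_on_cong)
    fix x assume "x \<in> tuples m d n"
    have "mat_of_cols d (map (word_vec x) us) \<in> carrier_mat d d"
      using us mat_of_cols_carrier(1)[of d "map (word_vec x) us"] by simp
    then have "word_det d us x = (\<Sum>p | p permutes {0..<d}. signof p *
        (\<Prod>i = 0..<d. mat_of_cols d (map (word_vec x) us) $$ (i, p i)))"
      unfolding word_det_def by (rule det_def')
    also have "\<dots> = (\<Sum>p | p permutes {0..<d}. signof p * (\<Prod>i = 0..<d. word_vec x (us ! p i) $ i))"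
    proof (intro sum.cong refl arg_cong2[where f = "(*)"] prod.cong)
      fix p i assume "p \<in> {p. p permutes {0..<d}}" "i \<in> {0..<d}"
      then have "p i < d" "i < d" using permutes_in_image[of p "{0..<d}" i] by auto
      then show "mat_of_cols d (map (word_vec x) us) $$ (i, p i) = word_vec x (us ! p i) $ i"
        using us by (simp add: mat_of_cols_index)
    qed
    finally show "(\<Sum>p | p permutes {0..<d}. signof p * (\<Prod>i = 0..<d. word_vec x (us ! p i) $ i)) = word_det d us x"
      by simp
  qed
qed

definition chart :: "nat \<Rightarrow> nat \<Rightarrow> nat \<Rightarrow> nat list set \<Rightarrow> tuple set set" where
  "chart m d n S = orbit (GL d) (act d) ` {x \<in> tuples m d n. word_det d (sorted_list_of_set S) x \<noteq> 0}"

lemma orbit_memE: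
  assumes "y \<in> orbit (GL d) (act d) x"
  obtains g where "g \<in> carrier (GL d)" "y = act d g x"
  using assms by (auto simp: orbit_def)

lemma orbit_eq:
  assumes "x \<in> tuples m d n" "y \<in> orbit (GL d) (act d) x"
  shows "orbit (GL d) (act d) y = orbit (GL d) (act d) x" "y \<in> tuples m d n"
proof -
  obtain g where "g \<in> carrier (GL d)" "y = act d g x" using assms(2) by (rule orbit_memE)
  then show "orbit (GL d) (act d) y = orbit (GL d) (act d) x" "y \<in> tuples m d n"
    using orbit_act[OF assms(1)] act_in_tuples[OF _ assms(1)] by simp_all
qed

lemma word_det_orbit:
  assumes S: "S \<in> forests m n d" and x: "x \<in> tuples m d n" and y: "y \<in> orbit (GL d) (act d) x"
  shows "word_det d (sorted_list_of_set S) y = 0 \<longleftrightarrow> word_det d (sorted_list_of_set S) x = 0"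
proof -
  obtain g where "g \<in> carrier (GL d)" "y = act d g x" using y by (rule orbit_memE)
  then show ?thesis
    using word_det_act[OF _ x, of g "sorted_list_of_set S"] forestsD(3,5,6)[OF S] by (simp add: carrier_GL)
qed

lemma Union_chart:
  assumes S: "S \<in> forests m n d"
  shows "\<Union>(chart m d n S) = {x \<in> tuples m d n. word_det d (sorted_list_of_set S) x \<noteq> 0}"
proof
  show "\<Union>(chart m d n S) \<subseteq> {x \<in> tuples m d n. word_det d (sorted_list_of_set S) x \<noteq> 0}"
  proof
    fix y assume "y \<in> \<Union>(chart m d n S)"
    then obtain x where x: "x \<in> tuples m d n" "word_det d (sorted_list_of_set S) x \<noteq> 0" "y \<in> orbit (GL d) (act d) x"
      unfolding chart_def by blast
    then show "y \<in> {x \<in> tuples m d n. word_det d (sorted_list_of_set S) x \<noteq> 0}"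
      using word_det_orbit[OF S x(1,3)] orbit_eq(2)[OF x(1,3)] by simp
  qed
  show "{x \<in> tuples m d n. word_det d (sorted_list_of_set S) x \<noteq> 0} \<subseteq> \<Union>(chart m d n S)"
    using orbit_self by (auto simp: chart_def)
qed

lemma orbit_in_chart_iff:
  assumes S: "S \<in> forests m n d" and x: "x \<in> tuples m d n"
  shows "orbit (GL d) (act d) x \<in> chart m d n S \<longleftrightarrow> word_det d (sorted_list_of_set S) x \<noteq> 0"
proof
  assume "orbit (GL d) (act d) x \<in> chart m d n S"
  then have "x \<in> \<Union>(chart m d n S)" using orbit_self[OF x] by blast
  then show "word_det d (sorted_list_of_set S) x \<noteq> 0" unfolding Union_chart[OF S] by simp
qed (use x in \<open>auto simp: chart_def\<close>)

lemma chart_subset_H_points: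
  assumes S: "S \<in> forests m n d"
  shows "chart m d n S \<subseteq> H_points m d n"
proof
  fix P assume "P \<in> chart m d n S"
  then obtain x where x: "x \<in> tuples m d n" "word_det d (sorted_list_of_set S) x \<noteq> 0" "P = orbit (GL d) (act d) x"
    unfolding chart_def by blast
  then show "P \<in> H_points m d n"
    unfolding H_points_def orbits_def
    using stable_of_word_basis[OF x(1) _ _ x(2)] forestsD(3,5,6)[OF S] by blast
qed

text \<open>Growing the empty forest, with the standard basis as initial basis, puts every stable
  orbit into a chart.\<close>

lemma H_points_eq_Union_charts: "H_points m d n = (\<Union>S\<in>forests m n d. chart m d n S)"
proof
  show "(\<Union>S\<in>forests m n d. chart m d n S) \<subseteq> H_points m d n" using chart_subset_H_points by blast
  show "H_points m d n \<subseteq> (\<Union>S\<in>forests m n d. chart m d n S)"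
  proof
    fix P assume "P \<in> H_points m d n"
    then obtain x where x: "x \<in> stable_tuples m d n" "P = orbit (GL d) (act d) x"
      by (auto simp: H_points_def orbits_def)
    have "mat_of_cols d (map (unit_vec d) [0..<d]) = (1\<^sub>m d :: complex mat)"
      by (rule eq_matI) (auto simp: mat_of_cols_index)
    then have "vec_basis d (map (unit_vec d) [0..<d])" by (auto simp: vec_basis_def)
    from extend_to_forest_basis[OF x(1) this, of "{}"]
    obtain S where "S \<in> forests m n d" "word_det d (sorted_list_of_set S) x \<noteq> 0"
      by (auto simp: prefix_closed_def)
    then show "P \<in> (\<Union>S\<in>forests m n d. chart m d n S)"
      using x by (auto simp: chart_def stable_tuples_def)
  qed
qed

lemma zariski_open_chart:
  assumes S: "S \<in> forests m n d"
  shows "zariski_open m d n (\<Union>(chart m d n S))"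
proof -
  obtain p where p: "p \<in> polynomial_functions m d n" "\<forall>x\<in>tuples m d n. p x = word_det d (sorted_list_of_set S) x"
    using polynomial_on_word_det[of "sorted_list_of_set S" m n d] forestsD[OF S] unfolding polynomial_on_def by auto
  show ?thesis
    unfolding Union_chart[OF S] zariski_open_def by (rule exI[of _ "{p}"]) (use p in auto)
qed

text \<open>The choice of representative is harmless because \<open>wcoord\<close> is
  invariant.\<close>

definition H_coord :: "nat \<Rightarrow> nat list list \<Rightarrow> nat list \<Rightarrow> nat \<Rightarrow> tuple set \<Rightarrow> complex" where
  "H_coord d ws w k P = wcoord d ws w k (SOME x. x \<in> P)"

lemma H_coord_orbit:
  assumes S: "S \<in> forests m n d" and x: "x \<in> tuples m d n" and w: "w \<in> words m n"
  shows "H_coord d (sorted_list_of_set S) w k (orbit (GL d) (act d) x) = wcoord d (sorted_list_of_set S) w k x"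
proof -
  have "(SOME y. y \<in> orbit (GL d) (act d) x) \<in> orbit (GL d) (act d) x" using orbit_self[OF x] by (rule someI)
  then obtain g where "g \<in> carrier (GL d)" "(SOME y. y \<in> orbit (GL d) (act d) x) = act d g x" by (rule orbit_memE)
  then show ?thesis
    unfolding H_coord_def using wcoord_act[OF _ x _ _ w] forestsD[OF S] by simp
qed

text \<open>On the chart the coordinate is a quotient of two polynomial functions with nonvanishing
  denominator, so its preimages of open sets are among the generators of the topology.\<close>

lemma openin_H_coord:
  assumes S: "S \<in> forests m n d" and w: "w \<in> words m n" and D: "open D"
  shows "openin (H_space m d n) {P \<in> chart m d n S. H_coord d (sorted_list_of_set S) w k P \<in> D}"
proof -
  note F = forestsD[OF S]
  let ?ws = "sorted_list_of_set S"
  have "set (?ws[k := w]) \<subseteq> words m n" using F w set_update_subset_insert[of ?ws k w] by auto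
  then have "polynomial_on m d n (word_det d (?ws[k := w]))" by (rule polynomial_on_word_det) (use F in simp)
  then obtain p where p: "p \<in> polynomial_functions m d n" "\<forall>x\<in>tuples m d n. p x = word_det d (?ws[k := w]) x"
    unfolding polynomial_on_def by blast
  have "polynomial_on m d n (word_det d ?ws)" by (rule polynomial_on_word_det) (use F in auto)
  then obtain r where r: "r \<in> polynomial_functions m d n" "\<forall>x\<in>tuples m d n. r x = word_det d ?ws x"
    unfolding polynomial_on_def by blast
  have "regular_on m d n (\<Union>(chart m d n S)) (\<lambda>x. H_coord d ?ws w k (orbit (GL d) (act d) x))"
    unfolding regular_on_def
  proof
    fix x assume x: "x \<in> \<Union>(chart m d n S)"
    have "\<forall>y\<in>\<Union>(chart m d n S). r y \<noteq> 0 \<and> H_coord d ?ws w k (orbit (GL d) (act d) y) = p y / r y"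
      using p r H_coord_orbit[OF S _ w] unfolding Union_chart[OF S] by (auto simp: wcoord_def)
    then show "\<exists>U'. zariski_open m d n U' \<and> x \<in> U' \<and> U' \<subseteq> \<Union>(chart m d n S) \<and>
        (\<exists>p\<in>polynomial_functions m d n. \<exists>r\<in>polynomial_functions m d n.
           \<forall>y\<in>U'. r y \<noteq> 0 \<and> H_coord d ?ws w k (orbit (GL d) (act d) y) = p y / r y)"
      using zariski_open_chart[OF S] x p r by blast
  qed
  then have "H_zariski_open m d n (chart m d n S) \<and> H_regular_on m d n (chart m d n S) (H_coord d ?ws w k) \<and> open D"
    using D zariski_open_chart[OF S] chart_subset_H_points[OF S]
    by (simp add: H_zariski_open_def H_regular_on_def)
  then show ?thesis
    unfolding H_space_def by (intro topology_generated_by_Basis) blast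
qed

lemma openin_chart:
  assumes S: "S \<in> forests m n d"
  shows "openin (H_space m d n) (chart m d n S)"
proof -
  have "H_zariski_open m d n (chart m d n S)"
    using zariski_open_chart[OF S] chart_subset_H_points[OF S] by (simp add: H_zariski_open_def)
  moreover have "H_regular_on m d n (chart m d n S) (\<lambda>P. 0)"
    unfolding H_regular_on_def regular_on_def
  proof
    fix x assume x: "x \<in> \<Union>(chart m d n S)"
    show "\<exists>U'. zariski_open m d n U' \<and> x \<in> U' \<and> U' \<subseteq> \<Union>(chart m d n S) \<and>
        (\<exists>p\<in>polynomial_functions m d n. \<exists>r\<in>polynomial_functions m d n. \<forall>y\<in>U'. r y \<noteq> 0 \<and> 0 = p y / r y)"
    proof (intro exI conjI)
      show "zariski_open m d n (\<Union>(chart m d n S))" by (rule zariski_open_chart[OF S])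
      show "\<exists>p\<in>polynomial_functions m d n. \<exists>r\<in>polynomial_functions m d n.
          \<forall>y\<in>\<Union>(chart m d n S). r y \<noteq> 0 \<and> 0 = p y / r y"
        by (rule bexI[of _ "\<lambda>x. 0"], rule bexI[of _ "\<lambda>x. 1"], simp, (rule polynomial_functions.const)+)
    qed (use x in auto)
  qed
  ultimately have "{P \<in> chart m d n S. (0::complex) \<in> UNIV} \<in> {{P \<in> \<U>. F P \<in> D} | \<U> F D.
        H_zariski_open m d n \<U> \<and> H_regular_on m d n \<U> F \<and> open D}"
    by (intro CollectI exI[of _ "chart m d n S"] exI[of _ "\<lambda>P. 0"] exI[of _ UNIV]) simp
  then have "openin (H_space m d n) {P \<in> chart m d n S. (0::complex) \<in> UNIV}"
    unfolding H_space_def by (rule topology_generated_by_Basis)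
  then show ?thesis by simp
qed

lemma topspace_H_space: "topspace (H_space m d n) = H_points m d n"
proof
  show "topspace (H_space m d n) \<subseteq> H_points m d n"
    unfolding H_space_def topology_generated_by_topspace by (auto simp: H_zariski_open_def)
  show "H_points m d n \<subseteq> topspace (H_space m d n)"
    unfolding H_points_eq_Union_charts using openin_chart openin_subset by blast
qed

lemma continuous_on_polynomial_normal_form:
  assumes p: "p \<in> polynomial_functions m d n"
    and c: "\<And>w k. continuous_on UNIV (\<lambda>y. c y (w, k))"
  shows "continuous_on UNIV (\<lambda>y. p (normal_form m d n ws (c y)))"
  using p
proof induction
  case (coord_f i j)
  have "continuous_on UNIV (\<lambda>y. coordvec d ws (c y) [j] $ i)"
    using coord_f c by (cases "[j] \<in> set ws") (auto simp: coordvec_def)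
  then show ?case using coord_f by (simp add: normal_form_def)
next
  case (coord_phi l i j)
  have "continuous_on UNIV (\<lambda>y. coordvec d ws (c y) (ws ! j @ [l]) $ i)"
    using coord_phi c by (cases "ws ! j @ [l] \<in> set ws") (auto simp: coordvec_def)
  then show ?case using coord_phi by (simp add: normal_form_def)
qed (auto intro: continuous_intros)

lemma openin_Euclidean_space_Int: "open G \<Longrightarrow> openin (Euclidean_space M) (topspace (Euclidean_space M) \<inter> G)"
  unfolding Euclidean_space_def
  by (auto simp: openin_subtopology euclidean_product_topology open_openin[symmetric] topspace_subtopology intro!: exI[of _ G])

text \<open>A generator of the topology comes from a function that is regular only locally. Near
  each point its pullback is a quotient of polynomials in the entries of the normal form, which
  depend continuously on the parameters.\<close>

lemma continuous_map_orbit_normal_form: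
  assumes S: "S \<in> forests m n d" and c: "\<And>w k. continuous_on UNIV (\<lambda>y :: nat \<Rightarrow> real. c y (w, k))"
  shows "continuous_map (Euclidean_space M) (H_space m d n)
           (\<lambda>y. orbit (GL d) (act d) (normal_form m d n (sorted_list_of_set S) (c y)))"
  unfolding H_space_def
proof (rule continuous_on_generated_topo)
  let ?E = "Euclidean_space M" and ?orb = "orbit (GL d) (act d)"
  let ?nf = "\<lambda>y. normal_form m d n (sorted_list_of_set S) (c y)"
  note F = forestsD[OF S]
  have nft: "?nf y \<in> tuples m d n" for y by (rule normal_form_in_tuples)
  show "(\<lambda>y. ?orb (?nf y)) ` topspace ?E \<subseteq> \<Union>{{P \<in> \<U>. F P \<in> D} | \<U> F D.
        H_zariski_open m d n \<U> \<and> H_regular_on m d n \<U> F \<and> open D}"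
  proof -
    have "?orb (?nf y) \<in> topspace (H_space m d n)" for y
      using orbit_in_chart_iff[OF S nft] word_det_normal_form[OF S] chart_subset_H_points[OF S]
      by (auto simp: topspace_H_space)
    then show ?thesis unfolding H_space_def topology_generated_by_topspace by blast
  qed
  fix V assume "V \<in> {{P \<in> \<U>. F P \<in> D} | \<U> F D. H_zariski_open m d n \<U> \<and> H_regular_on m d n \<U> F \<and> open D}"
  then obtain \<U> G D where V: "V = {P \<in> \<U>. G P \<in> D}" and U: "H_zariski_open m d n \<U>"
    and reg: "H_regular_on m d n \<U> G" and D: "open D" by blast
  show "openin ?E ((\<lambda>y. ?orb (?nf y)) -` V \<inter> topspace ?E)"
  proof (subst openin_subopen, intro ballI)
    fix y assume y: "y \<in> (\<lambda>y. ?orb (?nf y)) -` V \<inter> topspace ?E"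
    then have "?orb (?nf y) \<in> \<U>" using V by simp
    then have "?nf y \<in> \<Union>\<U>" using orbit_self[OF nft] by blast
    then obtain U' p r where U': "zariski_open m d n U'" "?nf y \<in> U'" "U' \<subseteq> \<Union>\<U>"
      and pr: "p \<in> polynomial_functions m d n" "r \<in> polynomial_functions m d n"
        "\<And>x. x \<in> U' \<Longrightarrow> r x \<noteq> 0 \<and> G (?orb x) = p x / r x"
      using reg unfolding H_regular_on_def regular_on_def by meson
    obtain Q where Q: "Q \<subseteq> polynomial_functions m d n" "U' = {x \<in> tuples m d n. \<exists>p\<in>Q. p x \<noteq> 0}"
      using U'(1) unfolding zariski_open_def by blast
    then obtain p0 where p0: "p0 \<in> Q" "p0 (?nf y) \<noteq> 0" using U'(2) by auto
    \<comment> \<open>\<open>p0\<close> is one of the polynomials defining the Zariski open set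
      \<open>U'\<close>; where it does not vanish, the local expression \<open>p / r\<close> is
      valid.\<close>
    define A where "A = {z. p0 (?nf z) \<noteq> 0}"
    have cont: "continuous_on UNIV (\<lambda>z. f (?nf z))" if "f \<in> polynomial_functions m d n" for f
      by (rule continuous_on_polynomial_normal_form[OF that]) (rule c)
    have OU: "?nf z \<in> U'" if "z \<in> A" for z using that nft Q p0 by (auto simp: A_def)
    \<comment> \<open>Members of \<open>\<U>\<close> are orbits, so the orbit of a tuple in their
      union is itself a member.\<close>
    have orbU: "?orb (?nf z) \<in> \<U>" if z: "z \<in> A" for z
    proof -
      obtain P where P: "P \<in> \<U>" "?nf z \<in> P" using OU[OF z] U' by blast
      then have "P \<in> H_points m d n" using U by (auto simp: H_zariski_open_def)
      then obtain x where "x \<in> tuples m d n" "P = ?orb x" by (auto simp: H_points_def orbits_def stable_tuples_def)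
      then show ?thesis using orbit_eq(1)[of x m d n "?nf z"] P by simp
    qed
    have "open A" unfolding A_def using p0 Q by (intro open_Collect_neq cont continuous_on_const) auto
    moreover have "continuous_on A (\<lambda>z. p (?nf z) / r (?nf z))"
      using OU pr by (intro continuous_on_divide continuous_on_subset[OF cont]) auto
    ultimately have opn: "open (A \<inter> (\<lambda>z. p (?nf z) / r (?nf z)) -` D)"
      using D by (intro continuous_open_preimage)
    show "\<exists>T. openin ?E T \<and> y \<in> T \<and> T \<subseteq> (\<lambda>y. ?orb (?nf y)) -` V \<inter> topspace ?E"
    proof (intro exI conjI)
      show "openin ?E (topspace ?E \<inter> (A \<inter> (\<lambda>z. p (?nf z) / r (?nf z)) -` D))"
        by (rule openin_Euclidean_space_Int[OF opn])
      have "G (?orb (?nf y)) \<in> D" using y V by simp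
      then show "y \<in> topspace ?E \<inter> (A \<inter> (\<lambda>z. p (?nf z) / r (?nf z)) -` D)"
        using y p0 pr(3)[OF U'(2)] by (simp add: A_def)
      show "topspace ?E \<inter> (A \<inter> (\<lambda>z. p (?nf z) / r (?nf z)) -` D) \<subseteq> (\<lambda>y. ?orb (?nf y)) -` V \<inter> topspace ?E"
      proof
        fix z assume z: "z \<in> topspace ?E \<inter> (A \<inter> (\<lambda>z. p (?nf z) / r (?nf z)) -` D)"
        then have "z \<in> A" by blast
        from pr(3)[OF OU[OF this]] orbU[OF this] show "z \<in> (\<lambda>y. ?orb (?nf y)) -` V \<inter> topspace ?E"
          using z by (simp add: V)
      qed
    qed
  qed
qed

text \<open>Used to number the coordinates of a chart so that those cutting out the stratum come
  first.\<close>

lemma bij_betw_nat_with_initial_segment: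
  assumes I: "finite I" and J: "J \<subseteq> I"
  obtains e where "bij_betw e {..<card I} I" "e ` {..<card J} = J"
proof -
  have fin: "finite J" "finite (I - J)" using I J finite_subset by auto
  have card: "card I = card J + card (I - J)" using card_Un_disjoint[OF fin] J by (simp add: Un_absorb1)
  obtain a where a: "bij_betw a {0..<card J} J" using ex_bij_betw_nat_finite[OF fin(1)] by blast
  obtain b where b: "bij_betw b {0..<card (I - J)} (I - J)" using ex_bij_betw_nat_finite[OF fin(2)] by blast
  define e where "e i = (if i < card J then a i else b (i - card J))" for i
  have "bij_betw e {..<card J} J \<longleftrightarrow> bij_betw a {..<card J} J"
    by (rule bij_betw_cong) (simp add: e_def)
  then have 1: "bij_betw e {..<card J} J" using a by (simp add: lessThan_atLeast0)
  have "bij_betw (\<lambda>i. i - card J) {card J..<card I} {0..<card (I - J)}"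
    by (rule bij_betw_byWitness[where f' = "\<lambda>i. i + card J"]) (auto simp: card)
  then have "bij_betw (b \<circ> (\<lambda>i. i - card J)) {card J..<card I} (I - J)" using b by (rule bij_betw_trans)
  moreover have "bij_betw e {card J..<card I} (I - J) \<longleftrightarrow>
      bij_betw (b \<circ> (\<lambda>i. i - card J)) {card J..<card I} (I - J)"
    by (rule bij_betw_cong) (simp add: e_def)
  ultimately have 2: "bij_betw e {card J..<card I} (I - J)" by simp
  have "bij_betw e ({..<card J} \<union> {card J..<card I}) (J \<union> (I - J))"
    by (rule bij_betw_combine[OF 1 2]) auto
  moreover have "{..<card J} \<union> {card J..<card I} = {..<card I}" using card by auto
  ultimately have "bij_betw e {..<card I} I" using J by (simp add: Un_absorb1)
  then show thesis using 1 that by (simp add: bij_betw_def)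
qed

text \<open>Each pair is a coordinate of a critical word along a larger forest word. By
  \<open>smaller_forest_iff\<close> these coordinates cut out the part of the chart outside all
  smaller charts, so this is its complex codimension.\<close>

definition codim :: "nat \<Rightarrow> nat \<Rightarrow> nat list set \<Rightarrow> nat" where
  "codim m n S = card {(w, v). w \<in> critical m n S \<and> v \<in> S \<and> w < v}"

text \<open>There is one complex coordinate for each critical word and basis position. Reading the
  coordinates off an orbit is inverse to taking the orbit of a normal form; the last property fits
  \<open>smaller_forest_iff\<close> to the first real coordinates.\<close>

lemma chart_homeomorphic_Euclidean_space:
  assumes S: "S \<in> forests m n d"
  obtains N f where "homeomorphic_map (subtopology (H_space m d n) (chart m d n S)) (Euclidean_space N) f"
    "2 * codim m n S \<le> N"
    "\<And>x. x \<in> tuples m d n \<Longrightarrow> word_det d (sorted_list_of_set S) x \<noteq> 0 \<Longrightarrow>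
       (\<exists>i<2 * codim m n S. f (orbit (GL d) (act d) x) i \<noteq> 0) \<longleftrightarrow>
       (\<exists>w\<in>critical m n S. \<exists>k<d. w < sorted_list_of_set S ! k \<and> wcoord d (sorted_list_of_set S) w k x \<noteq> 0)"
proof -
  note F = forestsD[OF S]
  let ?ws = "sorted_list_of_set S" and ?X = "subtopology (H_space m d n) (chart m d n S)"
  let ?orb = "orbit (GL d) (act d)"
  define I where "I = critical m n S \<times> {..<d}"
  define J where "J = {(w, k). w \<in> critical m n S \<and> k < d \<and> w < ?ws ! k}"
  define K where "K = card I"
  have finI: "finite I" and JI: "J \<subseteq> I" using finite_critical[OF F(1)] by (auto simp: I_def J_def)
  have cardJ: "card J = codim m n S"
    unfolding codim_def
  proof (rule bij_betw_same_card)
    show "bij_betw (\<lambda>(w, k). (w, ?ws ! k)) J {(w, v). w \<in> critical m n S \<and> v \<in> S \<and> w < v}"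
      unfolding bij_betw_def
    proof
      show "inj_on (\<lambda>(w, k). (w, ?ws ! k)) J"
        using F by (auto simp: J_def inj_on_def nth_eq_iff_index_eq)
      show "(\<lambda>(w, k). (w, ?ws ! k)) ` J = {(w, v). w \<in> critical m n S \<and> v \<in> S \<and> w < v}"
      proof (intro equalityI subsetI)
        fix q assume "q \<in> (\<lambda>(w, k). (w, ?ws ! k)) ` J"
        then obtain w k where q: "q = (w, ?ws ! k)" "w \<in> critical m n S" "k < d" "w < ?ws ! k"
          by (auto simp: J_def)
        then have "?ws ! k \<in> S" using F by (metis nth_mem)
        then show "q \<in> {(w, v). w \<in> critical m n S \<and> v \<in> S \<and> w < v}" using q by simp
      next
        fix q assume "q \<in> {(w, v). w \<in> critical m n S \<and> v \<in> S \<and> w < v}"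
        then obtain w v where q: "q = (w, v)" "w \<in> critical m n S" "v \<in> S" "w < v" by auto
        then obtain k where "k < d" "?ws ! k = v" using F by (metis in_set_conv_nth)
        then show "q \<in> (\<lambda>(w, k). (w, ?ws ! k)) ` J" using q by (intro image_eqI[of _ _ "(w, k)"]) (auto simp: J_def)
      qed
    qed
  qed
  obtain e where e: "bij_betw e {..<K} I" "e ` {..<card J} = J"
    using bij_betw_nat_with_initial_segment[OF finI JI] unfolding K_def by blast
  have JK: "card J \<le> K" unfolding K_def by (rule card_mono[OF finI JI])
  define e' where "e' = inv_into {..<K} e"
  have e': "e' q < K" "e (e' q) = q" if "q \<in> I" for q
    using that e(1) inv_into_into[of q e "{..<K}"] f_inv_into_f[of q e "{..<K}"] by (auto simp: e'_def bij_betw_def)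
  have e'e: "e' (e i) = i" if "i < K" for i
    using that e(1) by (auto simp: e'_def bij_betw_def inv_into_f_f)
  define z where "z P q = H_coord d ?ws (fst q) (snd q) P" for P q
  \<comment> \<open>The \<open>i\<close>-th complex coordinate occupies the real places
    \<open>2 * i\<close> and \<open>2 * i + 1\<close>, so the first \<open>card J\<close> complex
    coordinates are the first \<open>2 * card J\<close> real ones.\<close>
  define f where "f P = (\<lambda>i. if i < 2 * K then (if even i then Re (z P (e (i div 2))) else Im (z P (e (i div 2)))) else 0)" for P
  define c where "c y q = Complex (y (2 * e' q)) (y (2 * e' q + 1))" for y :: "nat \<Rightarrow> real" and q
  define h where "h y = ?orb (normal_form m d n ?ws (c y))" for y
  have z_orb: "z (?orb x) (w, k) = wcoord d ?ws w k x" if "x \<in> tuples m d n" "w \<in> critical m n S" for x w k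
    using H_coord_orbit[OF S that(1)] that(2) by (simp add: z_def critical_def)
  have topX: "topspace ?X = chart m d n S"
    using chart_subset_H_points[OF S] by (auto simp: topspace_H_space)
  have eI: "e i \<in> I" if "i < K" for i using that e(1) by (auto simp: bij_betw_def)
  have f_cont: "continuous_map ?X (Euclidean_space (2 * K)) f"
  proof -
    have cz: "continuous_map ?X euclidean (\<lambda>P. z P q)" if "q \<in> I" for q
      unfolding continuous_map_def topX
    proof (intro conjI allI impI)
      fix D :: "complex set" assume "openin euclidean D"
      then have "open D" by simp
      moreover have "fst q \<in> words m n" using that by (auto simp: I_def critical_def)
      ultimately have "openin (H_space m d n) {P \<in> chart m d n S. z P q \<in> D}"
        unfolding z_def by (intro openin_H_coord[OF S])
      then show "openin ?X {P \<in> chart m d n S. z P q \<in> D}"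
        using openin_chart[OF S] by (simp add: openin_open_subtopology)
    qed simp
    have "continuous_map ?X euclideanreal (\<lambda>P. Re (z P q))" "continuous_map ?X euclideanreal (\<lambda>P. Im (z P q))" if "q \<in> I" for q
      using continuous_map_compose[OF cz[OF that], of euclideanreal Re] continuous_map_compose[OF cz[OF that], of euclideanreal Im]
      by (auto simp: o_def continuous_on_Re continuous_on_Im)
    then show ?thesis
      unfolding f_def continuous_map_componentwise_Euclidean_space
      using eI by auto
  qed
  have h_cont: "continuous_map (Euclidean_space (2 * K)) ?X h"
  proof -
    have "continuous_on UNIV (\<lambda>y. c y (w, k))" for w k
      unfolding c_def Complex_eq
      by (intro continuous_intros continuous_on_product_coordinates)
    then have "continuous_map (Euclidean_space (2 * K)) (H_space m d n) h"
      unfolding h_def by (rule continuous_map_orbit_normal_form[OF S])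
    moreover have "h y \<in> chart m d n S" for y
      using orbit_in_chart_iff[OF S normal_form_in_tuples] word_det_normal_form[OF S] by (simp add: h_def)
    ultimately show ?thesis by (simp add: continuous_map_in_subtopology image_subset_iff Pi_iff)
  qed
  have fh: "f (h y) = y" if y: "y \<in> topspace (Euclidean_space (2 * K))" for y
  proof
    fix i
    show "f (h y) i = y i"
    proof (cases "i < 2 * K")
      case True
      then have i: "i div 2 < K" by simp
      have eq: "z (h y) (e (i div 2)) = c y (e (i div 2))"
      proof -
        obtain w k where wk: "e (i div 2) = (w, k)" "w \<in> critical m n S" "k < d"
          using eI[OF i] by (auto simp: I_def)
        have "z (h y) (w, k) = c y (w, k)"
          unfolding h_def z_orb[OF normal_form_in_tuples wk(2)] by (rule wcoord_normal_form[OF S wk(2,3)])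
        then show ?thesis unfolding wk(1) .
      qed
      show ?thesis
      proof (cases "even i")
        case True
        then show ?thesis using \<open>i < 2 * K\<close> by (simp add: f_def eq c_def e'e[OF i])
      next
        case False
        then have "2 * (i div 2) + 1 = i" by presburger
        then show ?thesis using \<open>i < 2 * K\<close> False by (simp add: f_def eq c_def e'e[OF i])
      qed
    next
      case False
      then show ?thesis using y by (simp add: f_def topspace_Euclidean_space)
    qed
  qed
  have hf: "h (f P) = P" if P: "P \<in> chart m d n S" for P
  proof -
    obtain x where x: "x \<in> tuples m d n" "word_det d ?ws x \<noteq> 0" "P = ?orb x" using P by (auto simp: chart_def)
    have "c (f P) (w, k) = wcoord d ?ws w k x" if wk: "w \<in> critical m n S" "k < d" for w k
    proof -
      have "(w, k) \<in> I" using wk by (simp add: I_def)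
      then have "c (f P) (w, k) = z P (w, k)"
        using e'[of "(w, k)"] by (simp add: c_def f_def complex_eq_iff)
      then show ?thesis using z_orb[OF x(1) wk(1)] x(3) by simp
    qed
    note act = act_normal_form[OF S x(1,2), of "c (f P)", OF this]
    show ?thesis
      unfolding h_def x(3) using orbit_act[OF normal_form_in_tuples act(1), of m n ?ws "c (f P)"] act(2) x(3) by simp
  qed
  have "homeomorphic_maps ?X (Euclidean_space (2 * K)) f h"
    unfolding homeomorphic_maps_def using f_cont h_cont fh hf by (auto simp: topX)
  then have 1: "homeomorphic_map ?X (Euclidean_space (2 * K)) f"
    using homeomorphic_map_maps by blast
  have 2: "2 * codim m n S \<le> 2 * K" using JK cardJ by simp
  have 3: "(\<exists>i<2 * codim m n S. f (?orb x) i \<noteq> 0) \<longleftrightarrow>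
       (\<exists>w\<in>critical m n S. \<exists>k<d. w < ?ws ! k \<and> wcoord d ?ws w k x \<noteq> 0)" (is "?L \<longleftrightarrow> ?R")
    if x: "x \<in> tuples m d n" for x
  proof -
    have "?L \<longleftrightarrow> (\<exists>i<card J. z (?orb x) (e i) \<noteq> 0)"
    proof
      assume ?L
      then obtain i where i: "i < 2 * card J" "f (?orb x) i \<noteq> 0" using cardJ by auto
      have "f (?orb x) i = 0" if "z (?orb x) (e (i div 2)) = 0" unfolding f_def that by simp
      then have "z (?orb x) (e (i div 2)) \<noteq> 0" using i(2) by blast
      then show "\<exists>i<card J. z (?orb x) (e i) \<noteq> 0" using i by (intro exI[of _ "i div 2"]) auto
    next
      assume "\<exists>i<card J. z (?orb x) (e i) \<noteq> 0"
      then obtain i where i: "i < card J" "z (?orb x) (e i) \<noteq> 0" by blast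
      have "f (?orb x) (2 * i) = Re (z (?orb x) (e i))" "f (?orb x) (2 * i + 1) = Im (z (?orb x) (e i))"
        using i(1) JK by (simp_all add: f_def)
      then have "f (?orb x) (2 * i) \<noteq> 0 \<or> f (?orb x) (2 * i + 1) \<noteq> 0"
        using i(2) by (metis complex_eq_iff zero_complex.simps)
      moreover have "2 * i < 2 * codim m n S" "2 * i + 1 < 2 * codim m n S" using i cardJ by auto
      ultimately show ?L by blast
    qed
    also have "\<dots> \<longleftrightarrow> (\<exists>q\<in>e ` {..<card J}. z (?orb x) q \<noteq> 0)" by auto
    also have "\<dots> \<longleftrightarrow> (\<exists>q\<in>J. z (?orb x) q \<noteq> 0)" by (simp only: e(2))
    also have "\<dots> \<longleftrightarrow> (\<exists>w k. w \<in> critical m n S \<and> k < d \<and> w < ?ws ! k \<and> z (?orb x) (w, k) \<noteq> 0)"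
      by (auto simp: J_def)
    also have "\<dots> \<longleftrightarrow> (\<exists>w k. w \<in> critical m n S \<and> k < d \<and> w < ?ws ! k \<and> wcoord d ?ws w k x \<noteq> 0)"
      by (simp add: z_orb[OF x] cong: conj_cong)
    also have "\<dots> \<longleftrightarrow> ?R" by blast
    finally show ?thesis .
  qed
  show thesis by (rule that[OF 1 2 3])
qed

section \<open>Decomposition of forests\<close>

definition shift_root :: "nat \<Rightarrow> nat list \<Rightarrow> nat list" where
  "shift_root n w = n # tl w"

text \<open>The tree \<open>T\<close> is placed behind the \<open>n\<close> trees of
  \<open>S\<close>, its root letter 0 becoming \<open>n\<close>.\<close>

definition juxtapose :: "nat \<Rightarrow> nat list set \<Rightarrow> nat list set \<Rightarrow> nat list set" where
  "juxtapose n S T = S \<union> shift_root n ` T"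

text \<open>A new root below the forest \<open>F\<close>. The root letters of \<open>F\<close>
  become the letters of the children of the new root, so \<open>F\<close> has as many roots as there
  are endomorphisms.\<close>

definition plant :: "nat list set \<Rightarrow> nat list set" where
  "plant F = insert [0] ((#) 0 ` F)"

lemma words_1_iff: "w \<in> words m (Suc 0) \<longleftrightarrow> (\<exists>v. w = 0 # v \<and> set v \<subseteq> {..<m})"
  by (cases w) (auto simp: words_def)

lemma words_1_cases: "w \<in> words m (Suc 0) \<longleftrightarrow> w = [0] \<or> (\<exists>v\<in>words m m. w = 0 # v)"
proof
  assume "w \<in> words m (Suc 0)"
  then obtain v where "w = 0 # v" "set v \<subseteq> {..<m}" by (auto simp: words_1_iff)
  then show "w = [0] \<or> (\<exists>v\<in>words m m. w = 0 # v)" by (cases v) (auto simp: words_def)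
next
  assume "w = [0] \<or> (\<exists>v\<in>words m m. w = 0 # v)"
  then show "w \<in> words m (Suc 0)"
  proof
    assume "\<exists>v\<in>words m m. w = 0 # v"
    then obtain v where "v \<in> words m m" "w = 0 # v" by blast
    then show ?thesis by (cases v) (auto simp: words_def)
  qed (simp add: words_def)
qed

lemma shift_root_snoc: "v \<noteq> [] \<Longrightarrow> shift_root n (v @ [i]) = shift_root n v @ [i]"
  by (cases v) (simp_all add: shift_root_def)

lemma shift_root_nonempty [simp]: "shift_root n w \<noteq> []" "hd (shift_root n w) = n"
  by (simp_all add: shift_root_def)

lemma shift_root_less_iff: "v \<in> words m (Suc 0) \<Longrightarrow> w \<in> words m (Suc 0) \<Longrightarrow> shift_root n v < shift_root n w \<longleftrightarrow> v < w"
  by (auto simp: words_1_iff shift_root_def)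

lemma inj_on_shift_root: "inj_on (shift_root n) (words m (Suc 0))"
  by (auto simp: inj_on_def words_1_iff shift_root_def)

lemma shift_root_in_words: "v \<in> words m (Suc 0) \<Longrightarrow> shift_root n v \<in> words m (Suc n)"
  by (auto simp: words_1_iff shift_root_def words_def)

lemma hd_less_words: "w \<in> words m n \<Longrightarrow> hd w < n"
  by (simp add: words_def)

lemma words_mono: "w \<in> words m n \<Longrightarrow> w \<in> words m (Suc n)"
  by (auto simp: words_def)

lemma words_Suc_cases:
  assumes "w \<in> words m (Suc n)"
  obtains "w \<in> words m n" "hd w < n" | v where "v \<in> words m (Suc 0)" "w = shift_root n v"
proof (cases "hd w < n")
  case True
  then show ?thesis using assms that(1) by (simp add: words_def)
next
  case False
  then have "w = shift_root n (0 # tl w)" "0 # tl w \<in> words m (Suc 0)"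
    using assms by (cases w; auto simp: words_def shift_root_def)+
  then show ?thesis using that(2) by blast
qed

text \<open>All words of the earlier trees precede all words of the new one; this governs the cross
  term in \<open>codim_juxtapose\<close>.\<close>

lemma less_shift_root: "v \<in> words m n \<Longrightarrow> v < shift_root n w"
  by (cases v) (auto simp: words_def shift_root_def)

text \<open>A word of more than one letter lies in the same tree as its parent, so critical words of
  the union are critical words of a part. The last two conclusions recover the parts and give
  injectivity.\<close>

lemma juxtapose_forest:
  assumes S: "S \<in> forests m n a" and T: "T \<in> forests m (Suc 0) b"
  shows "juxtapose n S T \<in> forests m (Suc n) (a + b)"
    and "critical m (Suc n) (juxtapose n S T) = critical m n S \<union> shift_root n ` critical m (Suc 0) T"
    and "S = {w \<in> juxtapose n S T. hd w < n}" and "T = {w \<in> words m (Suc 0). shift_root n w \<in> juxtapose n S T}"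
proof -
  note F = forestsD(1-4)[OF S] and F' = forestsD(1-4)[OF T]
  have mem_S: "w \<in> juxtapose n S T \<longleftrightarrow> w \<in> S" if "hd w < n" for w
    using that F(3) by (auto simp: juxtapose_def)
  have mem_T: "shift_root n w \<in> juxtapose n S T \<longleftrightarrow> w \<in> T" if "w \<in> words m (Suc 0)" for w
  proof -
    have "shift_root n w \<notin> S" using F(3) hd_less_words by fastforce
    then show ?thesis using that F'(3) inj_on_shift_root[of n m]
      by (auto simp: juxtapose_def dest: inj_onD)
  qed
  show S_eq: "S = {w \<in> juxtapose n S T. hd w < n}"
    using F(3) hd_less_words by (auto simp: juxtapose_def)
  show T_eq: "T = {w \<in> words m (Suc 0). shift_root n w \<in> juxtapose n S T}"
    using mem_T F'(3) by auto
  have disj: "S \<inter> shift_root n ` T = {}" using F(3) hd_less_words by fastforce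
  have "card (shift_root n ` T) = b"
    using F' inj_on_subset[OF inj_on_shift_root F'(3)] by (simp add: card_image)
  then have card: "card (juxtapose n S T) = a + b"
    unfolding juxtapose_def using F F' disj by (simp add: card_Un_disjoint)
  have sub: "juxtapose n S T \<subseteq> words m (Suc n)"
    using F(3) F'(3) words_mono shift_root_in_words by (auto simp: juxtapose_def)
  have closed: "prefix_closed (juxtapose n S T)"
    unfolding prefix_closed_def
  proof (intro allI impI)
    fix w i assume w: "w \<noteq> []" "w @ [i] \<in> juxtapose n S T"
    then have "w @ [i] \<in> words m (Suc n)" using sub by blast
    then have "w \<in> words m (Suc n)" using w by simp
    then show "w \<in> juxtapose n S T"
    proof (cases rule: words_Suc_cases)
      case 1
      then have "w @ [i] \<in> S" using w mem_S[of "w @ [i]"] by simp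
      then show ?thesis using F(4) w mem_S[OF 1(2)] unfolding prefix_closed_def by blast
    next
      case (2 v)
      have v: "v \<noteq> []" using 2 by (auto simp: words_def)
      have "w @ [i] = shift_root n (v @ [i])" using 2 v by (simp add: shift_root_snoc)
      moreover have "v @ [i] \<in> words m (Suc 0)" using \<open>w @ [i] \<in> words m (Suc n)\<close> 2 v w(1) by simp
      ultimately have "v @ [i] \<in> T" using mem_T w by simp
      then have "v \<in> T" using F'(4) v unfolding prefix_closed_def by blast
      then show ?thesis using mem_T 2 by simp
    qed
  qed
  show U: "juxtapose n S T \<in> forests m (Suc n) (a + b)"
    using F F' card sub closed by (auto simp: forests_def juxtapose_def)
  show "critical m (Suc n) (juxtapose n S T) = critical m n S \<union> shift_root n ` critical m (Suc 0) T"
  proof (intro equalityI subsetI)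
    fix w assume w: "w \<in> critical m (Suc n) (juxtapose n S T)"
    then have "w \<in> words m (Suc n)" by (simp add: critical_def)
    then show "w \<in> critical m n S \<union> shift_root n ` critical m (Suc 0) T"
    proof (cases rule: words_Suc_cases)
      case 1
      have "w \<in> critical m n S"
        unfolding critical_def
      proof (intro CollectI conjI allI impI)
        show "w \<notin> S" using w mem_S[OF 1(2)] by (simp add: critical_def)
        fix v i assume "v \<noteq> []" "w = v @ [i]"
        then show "v \<in> S" using w 1 mem_S[of v] by (auto simp: critical_def)
      qed (rule 1)
      then show ?thesis by simp
    next
      case (2 u)
      have "u \<in> critical m (Suc 0) T"
        unfolding critical_def
      proof (intro CollectI conjI allI impI)
        show "u \<notin> T" using w mem_T[OF 2(1)] 2 by (simp add: critical_def)
        fix v i assume vi: "v \<noteq> []" "u = v @ [i]"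
        then have "w = shift_root n v @ [i]" using 2 by (simp add: shift_root_snoc)
        then have "shift_root n v \<in> juxtapose n S T" using w by (simp add: critical_def)
        moreover have "v \<in> words m (Suc 0)" using 2(1) vi by simp
        ultimately show "v \<in> T" using mem_T by simp
      qed (rule 2)
      then show ?thesis using 2 by blast
    qed
  next
    fix w assume "w \<in> critical m n S \<union> shift_root n ` critical m (Suc 0) T"
    then consider "w \<in> critical m n S" | u where "u \<in> critical m (Suc 0) T" "w = shift_root n u" by blast
    then show "w \<in> critical m (Suc n) (juxtapose n S T)"
    proof cases
      case 1
      then have w: "w \<in> words m n" "w \<notin> S" by (auto simp: critical_def)
      show ?thesis
        unfolding critical_def
      proof (intro CollectI conjI allI impI)
        show "w \<in> words m (Suc n)" by (rule words_mono[OF w(1)])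
        show "w \<notin> juxtapose n S T" using w mem_S hd_less_words by blast
        fix v i assume "v \<noteq> []" "w = v @ [i]"
        then have "v \<in> S" using 1 by (auto simp: critical_def)
        then show "v \<in> juxtapose n S T" by (simp add: juxtapose_def)
      qed
    next
      case 2
      then have u: "u \<in> words m (Suc 0)" "u \<notin> T" by (auto simp: critical_def)
      show ?thesis
        unfolding critical_def
      proof (intro CollectI conjI allI impI)
        show "w \<in> words m (Suc n)" using shift_root_in_words[OF u(1)] 2 by simp
        show "w \<notin> juxtapose n S T" using u mem_T 2 by simp
        fix v i assume vi: "v \<noteq> []" "w = v @ [i]"
        have "u \<noteq> []" using u by (auto simp: words_def)
        then obtain u' j where u': "u = u' @ [j]" by (cases u rule: rev_cases) auto
        have "u' \<noteq> []"
        proof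
          assume "u' = []"
          then have "w = [n]" using u' 2 by (simp add: shift_root_def)
          then show False using vi by (simp add: append_eq_Cons_conv)
        qed
        then have "v = shift_root n u'" using u' vi 2 by (simp add: shift_root_snoc)
        moreover have "u' \<in> T" using 2(1) u' \<open>u' \<noteq> []\<close> by (simp add: critical_def)
        ultimately show "v \<in> juxtapose n S T" by (simp add: juxtapose_def)
      qed
    qed
  qed
qed

lemma split_forest:
  assumes U: "U \<in> forests m (Suc n) d"
  obtains a S T where "a \<le> d" "S \<in> forests m n a" "T \<in> forests m (Suc 0) (d - a)" "U = juxtapose n S T"
proof -
  note F = forestsD(1-4)[OF U]
  define S where "S = {w \<in> U. hd w < n}"
  define T where "T = {w \<in> words m (Suc 0). shift_root n w \<in> U}"
  have U_eq: "U = juxtapose n S T"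
  proof (intro equalityI subsetI)
    fix w assume w: "w \<in> U"
    then have "w \<in> words m (Suc n)" using F by blast
    then show "w \<in> juxtapose n S T"
      by (cases rule: words_Suc_cases) (use w in \<open>auto simp: juxtapose_def S_def T_def\<close>)
  qed (auto simp: juxtapose_def S_def T_def)
  have S: "S \<in> forests m n (card S)"
    unfolding forests_def prefix_closed_def
  proof (intro CollectI conjI allI impI)
    show "S \<subseteq> words m n" using F(3) by (auto simp: S_def words_def)
    fix w i assume "w \<noteq> []" "w @ [i] \<in> S"
    then show "w \<in> S" using F(4) by (auto simp: S_def prefix_closed_def)
  qed (use F(1) in \<open>auto simp: S_def\<close>)
  have inj: "inj_on (shift_root n) T" by (rule inj_on_subset[OF inj_on_shift_root]) (auto simp: T_def)
  have "shift_root n ` T \<subseteq> U" by (auto simp: T_def)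
  then have finT: "finite T" using F(1) inj finite_imageD finite_subset by metis
  have T: "T \<in> forests m (Suc 0) (card T)"
    unfolding forests_def prefix_closed_def
  proof (intro CollectI conjI allI impI)
    show "T \<subseteq> words m (Suc 0)" by (auto simp: T_def)
    fix w i assume w: "w \<noteq> []" "w @ [i] \<in> T"
    then have "shift_root n w @ [i] \<in> U" by (simp add: T_def shift_root_snoc)
    then have "shift_root n w \<in> U" using F(4) unfolding prefix_closed_def by (metis shift_root_nonempty(1))
    then show "w \<in> T" using w by (simp add: T_def)
  qed (use finT in auto)
  have "U \<in> forests m (Suc n) (card S + card T)" using juxtapose_forest(1)[OF S T] U_eq by simp
  then have "d = card S + card T" using U by (simp add: forests_def)
  then show thesis using that[of "card S" S T] S T U_eq by simp
qed

text \<open>The root \<open>[0]\<close> is present, so critical words have further letters, and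
  removing the leading 0 respects parents. The last conclusion gives injectivity.\<close>

lemma plant_forest:
  assumes F: "F \<in> forests m m d"
  shows "plant F \<in> forests m (Suc 0) (Suc d)"
    and "critical m (Suc 0) (plant F) = (#) 0 ` critical m m F"
    and "F = {v. v \<noteq> [] \<and> 0 # v \<in> plant F}"
proof -
  note f = forestsD(1-4)[OF F]
  have ne: "[] \<notin> F" using f(3) by (auto simp: words_def)
  then have nr: "[0] \<notin> (#) 0 ` F" by auto
  show "F = {v. v \<noteq> [] \<and> 0 # v \<in> plant F}" using ne by (auto simp: plant_def)
  have "card ((#) 0 ` F) = d" using f by (simp add: card_image)
  then have card: "card (plant F) = Suc d" unfolding plant_def using f nr by simp
  have sub: "plant F \<subseteq> words m (Suc 0)"
    using f(3) by (auto simp: plant_def words_1_cases)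
  have "prefix_closed (plant F)"
    unfolding prefix_closed_def
  proof (intro allI impI)
    fix w i assume w: "w \<noteq> []" "w @ [i] \<in> plant F"
    then have "w @ [i] \<in> words m (Suc 0)" using sub by blast
    then have "w \<in> words m (Suc 0)" using w by simp
    then show "w \<in> plant F"
      unfolding words_1_cases
    proof
      assume "\<exists>v\<in>words m m. w = 0 # v"
      then obtain v where v: "v \<in> words m m" "w = 0 # v" by blast
      then have "v @ [i] \<in> F" using w by (auto simp: plant_def)
      then have "v \<in> F" using f(4) v words_nonempty unfolding prefix_closed_def by blast
      then show ?thesis using v by (simp add: plant_def)
    qed (simp add: plant_def)
  qed
  then show "plant F \<in> forests m (Suc 0) (Suc d)" using card sub f by (auto simp: forests_def plant_def)
  show "critical m (Suc 0) (plant F) = (#) 0 ` critical m m F"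
  proof (intro equalityI subsetI)
    fix w assume w: "w \<in> critical m (Suc 0) (plant F)"
    then have "w \<noteq> [0]" "w \<in> words m (Suc 0)" by (auto simp: critical_def plant_def)
    then obtain v where v: "v \<in> words m m" "w = 0 # v" by (auto simp: words_1_cases)
    have "v \<in> critical m m F"
      unfolding critical_def
    proof (intro CollectI conjI allI impI)
      show "v \<notin> F" using w v by (auto simp: critical_def plant_def)
      fix u i assume u: "u \<noteq> []" "v = u @ [i]"
      then have "w = (0 # u) @ [i]" using v by simp
      then have "0 # u \<in> plant F" using w unfolding critical_def by blast
      then show "u \<in> F" using u by (auto simp: plant_def)
    qed (rule v)
    then show "w \<in> (#) 0 ` critical m m F" using v by blast
  next
    fix w assume "w \<in> (#) 0 ` critical m m F"
    then obtain v where v: "v \<in> critical m m F" "w = 0 # v" by blast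
    then have vw: "v \<in> words m m" "v \<notin> F" by (auto simp: critical_def)
    show "w \<in> critical m (Suc 0) (plant F)"
      unfolding critical_def
    proof (intro CollectI conjI allI impI)
      show "w \<in> words m (Suc 0)" using vw v by (auto simp: words_1_cases)
      show "w \<notin> plant F" using vw v words_nonempty by (auto simp: plant_def)
      fix u i assume u: "u \<noteq> []" "w = u @ [i]"
      then obtain u' where u': "u = 0 # u'" "v = u' @ [i]" using v by (cases u) auto
      then have "u' = [] \<or> u' \<in> F" using v by (auto simp: critical_def)
      then show "u \<in> plant F" using u' by (auto simp: plant_def)
    qed
  qed
qed

lemma unplant_forest:
  assumes U: "U \<in> forests m (Suc 0) (Suc d)"
  obtains F where "F \<in> forests m m d" "U = plant F"
proof -
  note f = forestsD(1-4)[OF U]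
  define F where "F = {v. v \<noteq> [] \<and> 0 # v \<in> U}"
  have "U \<noteq> {}" using f(2) by auto
  then obtain w where "w \<in> U" by blast
  have root: "w \<in> U \<Longrightarrow> [0] \<in> U" for w
  proof (induction w rule: rev_induct)
    case Nil
    then show ?case using f(3) by (auto simp: words_def)
  next
    case (snoc i w)
    show ?case
    proof (cases "w = []")
      case True
      then have "[i] \<in> words m (Suc 0)" using snoc f(3) by auto
      then show ?thesis using snoc True by simp
    next
      case False
      then show ?thesis using snoc f(4) unfolding prefix_closed_def by blast
    qed
  qed
  have U_eq: "U = plant F"
  proof (intro equalityI subsetI)
    fix w assume w: "w \<in> U"
    then have "w \<in> words m (Suc 0)" using f by blast
    then show "w \<in> plant F" using w words_nonempty by (auto simp: words_1_cases plant_def F_def)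
  qed (use root[OF \<open>w \<in> U\<close>] in \<open>auto simp: plant_def F_def\<close>)
  have "(#) 0 ` F \<subseteq> U" by (auto simp: F_def)
  then have finF: "finite F" using f(1) finite_imageD[of "(#) 0" F] finite_subset by (metis inj_on_Cons1)
  have F: "F \<in> forests m m (card F)"
    unfolding forests_def prefix_closed_def
  proof (intro CollectI conjI allI impI)
    show "F \<subseteq> words m m"
    proof
      fix v assume v: "v \<in> F"
      then have "0 # v \<in> words m (Suc 0)" "v \<noteq> []" using f(3) by (auto simp: F_def)
      then show "v \<in> words m m" by (auto simp: words_1_cases)
    qed
    fix w i assume w: "w \<noteq> []" "w @ [i] \<in> F"
    then have "(0 # w) @ [i] \<in> U" by (simp add: F_def)
    then have "0 # w \<in> U" using f(4) unfolding prefix_closed_def by blast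
    then show "w \<in> F" using w by (simp add: F_def)
  qed (use finF in auto)
  have "Suc (card F) = Suc d" using plant_forest(1)[OF F] U unfolding U_eq[symmetric] by (simp add: forests_def)
  then show thesis using that F U_eq by simp
qed

lemma forests_0_roots: "forests m 0 d = (if d = 0 then {{}} else {})"
proof -
  have "words m 0 = {}" by (auto simp: words_def)
  then show ?thesis by (auto simp: forests_def prefix_closed_def)
qed

lemma forests_0_nodes: "forests m n 0 = {{}}"
  by (auto simp: forests_def prefix_closed_def)

text \<open>Nested induction: on the number of nodes, which planting increases, and inside it on the
  number of roots, which juxtaposing increases. The case \<open>root\<close> is a single tree
  without nodes.\<close>

lemma forest_induct [consumes 1, case_names empty root plant juxtapose]:
  assumes "S \<in> forests m n d"
    and "P 0 {}" and "P (Suc 0) {}"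
    and plant: "\<And>F d. F \<in> forests m m d \<Longrightarrow> P m F \<Longrightarrow> P (Suc 0) (plant F)"
    and juxt: "\<And>n S T a b. S \<in> forests m n a \<Longrightarrow> T \<in> forests m (Suc 0) b \<Longrightarrow> P n S \<Longrightarrow> P (Suc 0) T \<Longrightarrow> P (Suc n) (juxtapose n S T)"
  shows "P n S"
  using assms(1)
proof (induction d arbitrary: n S rule: less_induct)
  case (less d)
  have one: "P (Suc 0) T" if T: "T \<in> forests m (Suc 0) b" and b: "b \<le> d" for T b
  proof (cases b)
    case 0
    then show ?thesis using T assms(3) by (simp add: forests_0_nodes)
  next
    case (Suc b')
    then obtain F where "F \<in> forests m m b'" "T = plant F" using T unplant_forest by metis
    then show ?thesis using plant less.IH[of b'] b Suc by simp
  qed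
  have "P n S" if "S \<in> forests m n a" "a \<le> d" for S a
    using that
  proof (induction n arbitrary: S a)
    case 0
    then show ?case using assms(2) by (auto simp: forests_0_roots split: if_splits)
  next
    case (Suc n)
    obtain a' S' T where st: "a' \<le> a" "S' \<in> forests m n a'" "T \<in> forests m (Suc 0) (a - a')" "S = juxtapose n S' T"
      using split_forest[OF Suc.prems(1)] .
    have "P n S'" by (rule Suc.IH[OF st(2)]) (use st Suc.prems in simp)
    moreover have "P (Suc 0) T" by (rule one[OF st(3)]) (use Suc.prems in simp)
    ultimately show ?case unfolding st(4) by (rule juxt[OF st(2,3)])
  qed
  then show ?case using less.prems by blast
qed

lemma bij_betw_juxtapose:
  "bij_betw (\<lambda>(a, S, T). juxtapose n S T) (SIGMA a:{..d}. forests m n a \<times> forests m (Suc 0) (d - a)) (forests m (Suc n) d)"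
  unfolding bij_betw_def
proof
  show "inj_on (\<lambda>(a, S, T). juxtapose n S T) (SIGMA a:{..d}. forests m n a \<times> forests m (Suc 0) (d - a))"
  proof (rule inj_onI)
    fix p q assume "p \<in> (SIGMA a:{..d}. forests m n a \<times> forests m (Suc 0) (d - a))"
      "q \<in> (SIGMA a:{..d}. forests m n a \<times> forests m (Suc 0) (d - a))"
      and eq: "(\<lambda>(a, S, T). juxtapose n S T) p = (\<lambda>(a, S, T). juxtapose n S T) q"
    then obtain a S T a' S' T' where p: "p = (a, S, T)" "S \<in> forests m n a" "T \<in> forests m (Suc 0) (d - a)"
      and q: "q = (a', S', T')" "S' \<in> forests m n a'" "T' \<in> forests m (Suc 0) (d - a')" by auto
    have eq': "juxtapose n S T = juxtapose n S' T'" using eq p q by simp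
    have "S = {w \<in> juxtapose n S T. hd w < n}" by (rule juxtapose_forest(3)[OF p(2,3)])
    also have "\<dots> = S'" unfolding eq' by (rule juxtapose_forest(3)[OF q(2,3), symmetric])
    finally have "S = S'" .
    have "T = {w \<in> words m (Suc 0). shift_root n w \<in> juxtapose n S T}" by (rule juxtapose_forest(4)[OF p(2,3)])
    also have "\<dots> = T'" unfolding eq' by (rule juxtapose_forest(4)[OF q(2,3), symmetric])
    finally have "T = T'" .
    have "a = a'" using p(2) q(2) \<open>S = S'\<close> by (simp add: forests_def)
    with \<open>S = S'\<close> \<open>T = T'\<close> show "p = q" using p q by simp
  qed
  show "(\<lambda>(a, S, T). juxtapose n S T) ` (SIGMA a:{..d}. forests m n a \<times> forests m (Suc 0) (d - a)) = forests m (Suc n) d"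
  proof (intro equalityI subsetI)
    fix U assume "U \<in> forests m (Suc n) d"
    then obtain a S T where "a \<le> d" "S \<in> forests m n a" "T \<in> forests m (Suc 0) (d - a)" "U = juxtapose n S T"
      by (rule split_forest)
    then show "U \<in> (\<lambda>(a, S, T). juxtapose n S T) ` (SIGMA a:{..d}. forests m n a \<times> forests m (Suc 0) (d - a))"
      by (intro image_eqI[of _ _ "(a, S, T)"]) auto
  next
    fix U assume "U \<in> (\<lambda>(a, S, T). juxtapose n S T) ` (SIGMA a:{..d}. forests m n a \<times> forests m (Suc 0) (d - a))"
    then obtain a S T where st: "a \<le> d" "S \<in> forests m n a" "T \<in> forests m (Suc 0) (d - a)" "U = juxtapose n S T" by auto
    show "U \<in> forests m (Suc n) d" using juxtapose_forest(1)[OF st(2,3)] st by simp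
  qed
qed

lemma bij_betw_plant: "bij_betw plant (forests m m d) (forests m (Suc 0) (Suc d))"
  unfolding bij_betw_def
proof
  show "inj_on plant (forests m m d)"
  proof (rule inj_onI)
    fix F G assume "F \<in> forests m m d" "G \<in> forests m m d" "plant F = plant G"
    then show "F = G" using plant_forest(3)[of F m d] plant_forest(3)[of G m d] by simp
  qed
  show "plant ` forests m m d = forests m (Suc 0) (Suc d)"
    using plant_forest(1) unplant_forest by blast
qed

lemma finite_forests: "finite (forests m n d)"
proof (induction d arbitrary: n rule: less_induct)
  case (less d)
  have one: "finite (forests m (Suc 0) b)" if "b \<le> d" for b
  proof (cases b)
    case (Suc b')
    then show ?thesis using less.IH[of b' m] bij_betw_finite[OF bij_betw_plant[of m b']] that by simp
  qed (simp add: forests_0_nodes)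
  have "finite (forests m n a)" if "a \<le> d" for a
    using that
  proof (induction n arbitrary: a)
    case (Suc n)
    have "finite (SIGMA b:{..a}. forests m n b \<times> forests m (Suc 0) (a - b))"
      using Suc one by (intro finite_SigmaI finite_cartesian_product) auto
    then show ?case using bij_betw_finite[OF bij_betw_juxtapose[of n a m]] by simp
  qed (simp add: forests_0_roots)
  then show ?case by simp
qed

section \<open>Cohomology of the noncommutative Hilbert scheme\<close>

text \<open>With the forests numbered in the order of their sorted word lists, the charts before the
  \<open>l\<close>-th are those of the smaller forests, and \<open>smaller_forest_iff\<close>
  describes their overlap with it as \<open>cycle_basis_even_cells\<close> demands.\<close>

lemma H_space_cycle_basis:
  "\<exists>z. cycle_basis k (H_space m d n) (card {S \<in> forests m n d. 2 * codim m n S = k}) z"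
proof -
  let ?Fs = "forests m n d" and ?orb = "orbit (GL d) (act d)"
  define L where "L = sorted_list_of_set (sorted_list_of_set ` ?Fs)"
  have finFs: "finite (sorted_list_of_set ` ?Fs)" using finite_forests by blast
  have setL: "set L = sorted_list_of_set ` ?Fs" using finFs by (simp add: L_def)
  have distL: "distinct L" by (simp add: L_def)
  have sortedL: "sorted_wrt (<) L" by (simp add: L_def)
  have lessL: "L ! i < L ! j \<longleftrightarrow> i < j" if "i < length L" "j < length L" for i j
    using sortedL that
    by (metis linorder_neqE_nat order_less_asym order_less_irrefl sorted_wrt_nth_less)
  define S where "S l = set (L ! l)" for l
  have S: "S l \<in> ?Fs" "sorted_list_of_set (S l) = L ! l" if "l < length L" for l
  proof -
    have "L ! l \<in> sorted_list_of_set ` ?Fs" using that setL nth_mem by blast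
    then obtain F where "F \<in> ?Fs" "L ! l = sorted_list_of_set F" by blast
    then show "S l \<in> ?Fs" "sorted_list_of_set (S l) = L ! l" using forestsD(5) by (simp_all add: S_def)
  qed
  have S_surj: "\<exists>l<length L. F = S l" if F: "F \<in> ?Fs" for F
  proof -
    have "sorted_list_of_set F \<in> set L" using F setL by blast
    then obtain l where "l < length L" "L ! l = sorted_list_of_set F" by (metis in_set_conv_nth)
    then show ?thesis using forestsD(5)[OF F] by (auto simp: S_def)
  qed
  have S_inj: "inj_on S {..<length L}"
  proof (rule inj_onI)
    fix i j assume ij: "i \<in> {..<length L}" "j \<in> {..<length L}" "S i = S j"
    then have "L ! i = L ! j" using S(2) by (metis lessThan_iff)
    then show "i = j" using ij distL by (simp add: nth_eq_iff_index_eq)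
  qed
  define U where "U l = chart m d n (S l)" for l
  define c where "c l = codim m n (S l)" for l
  \<comment> \<open>Bundled so that \<open>N\<close> and \<open>f\<close> can be chosen for all
    charts simultaneously.\<close>
  define good where "good l N f \<longleftrightarrow>
      homeomorphic_map (subtopology (H_space m d n) (U l)) (Euclidean_space N) f \<and> 2 * c l \<le> N \<and>
      (\<forall>x \<in> tuples m d n. word_det d (L ! l) x \<noteq> 0 \<longrightarrow>
       (\<exists>i<2 * c l. f (?orb x) i \<noteq> 0) \<longleftrightarrow>
       (\<exists>w\<in>critical m n (S l). \<exists>k<d. w < L ! l ! k \<and> wcoord d (L ! l) w k x \<noteq> 0))" for l N f
  have "\<exists>N f. good l N f" if "l < length L" for l
    using chart_homeomorphic_Euclidean_space[OF S(1)[OF that]] unfolding S(2)[OF that] good_def U_def c_def by metis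
  then obtain N f where Nf: "\<And>l. l < length L \<Longrightarrow> good l (N l) (f l)" by metis
  have f: "homeomorphic_map (subtopology (H_space m d n) (U l)) (Euclidean_space (N l)) (f l)"
    and cN: "2 * c l \<le> N l"
    and f_nz: "\<And>x. x \<in> tuples m d n \<Longrightarrow> word_det d (L ! l) x \<noteq> 0 \<Longrightarrow>
       (\<exists>i<2 * c l. f l (?orb x) i \<noteq> 0) \<longleftrightarrow>
       (\<exists>w\<in>critical m n (S l). \<exists>k<d. w < L ! l ! k \<and> wcoord d (L ! l) w k x \<noteq> 0)"
    if "l < length L" for l
    using Nf[OF that] by (simp_all add: good_def)
  have top: "topspace (H_space m d n) = (\<Union>l<length L. U l)"
  proof -
    have "?Fs = S ` {..<length L}" using S(1) S_surj by blast
    then show ?thesis unfolding topspace_H_space H_points_eq_Union_charts U_def by simp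
  qed
  have "\<exists>z. cycle_basis k (H_space m d n) (card {l. l < length L \<and> 2 * c l = k}) z"
  proof (rule cycle_basis_even_cells[OF top _ f _ cN])
    show "openin (H_space m d n) (U l)" if "l < length L" for l
      unfolding U_def by (rule openin_chart[OF S(1)[OF that]])
    fix l assume l: "l < length L"
    have top_U: "U l \<subseteq> topspace (H_space m d n)" using openin_subset[OF openin_chart[OF S(1)[OF l]]] by (simp add: U_def)
    have im: "f l ` U l = topspace (Euclidean_space (N l))"
      using homeomorphic_imp_surjective_map[OF f[OF l]] top_U by (simp add: Int_absorb1)
    have "P \<in> (\<Union>j<l. U j) \<longleftrightarrow> (\<exists>i<2 * c l. f l P i \<noteq> 0)" if P: "P \<in> U l" for P
    proof -
      obtain x where x: "x \<in> tuples m d n" "word_det d (L ! l) x \<noteq> 0" "P = ?orb x"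
        using P S(2)[OF l] by (auto simp: U_def chart_def)
      have "P \<in> U j \<longleftrightarrow> word_det d (L ! j) x \<noteq> 0" if "j < length L" for j
        using orbit_in_chart_iff[OF S(1)[OF that] x(1)] S(2)[OF that] x(3) by (simp add: U_def)
      then have "P \<in> (\<Union>j<l. U j) \<longleftrightarrow> (\<exists>j<l. word_det d (L ! j) x \<noteq> 0)" using l by auto
      also have "\<dots> \<longleftrightarrow> (\<exists>S'\<in>?Fs. sorted_list_of_set S' < L ! l \<and> word_det d (sorted_list_of_set S') x \<noteq> 0)"
      proof
        assume "\<exists>j<l. word_det d (L ! j) x \<noteq> 0"
        then obtain j where j: "j < l" "word_det d (L ! j) x \<noteq> 0" by blast
        then have "j < length L" using l by simp
        then show "\<exists>S'\<in>?Fs. sorted_list_of_set S' < L ! l \<and> word_det d (sorted_list_of_set S') x \<noteq> 0"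
          using S[of j] lessL[of j l] l j by (intro bexI[of _ "S j"]) auto
      next
        assume "\<exists>S'\<in>?Fs. sorted_list_of_set S' < L ! l \<and> word_det d (sorted_list_of_set S') x \<noteq> 0"
        then obtain S' where S': "S' \<in> ?Fs" "sorted_list_of_set S' < L ! l" "word_det d (sorted_list_of_set S') x \<noteq> 0"
          by blast
        obtain j where j: "j < length L" "S' = S j" using S_surj[OF S'(1)] by blast
        then have "j < l" using S' S(2)[OF j(1)] lessL[of j l] l by simp
        then show "\<exists>j<l. word_det d (L ! j) x \<noteq> 0" using S'(3) S(2)[OF j(1)] j(2) by auto
      qed
      also have "\<dots> \<longleftrightarrow> (\<exists>w\<in>critical m n (S l). \<exists>k<d. w < L ! l ! k \<and> wcoord d (L ! l) w k x \<noteq> 0)"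
        using smaller_forest_iff[OF S(1)[OF l] x(1)] x(2) unfolding S(2)[OF l] by blast
      also have "\<dots> \<longleftrightarrow> (\<exists>i<2 * c l. f l P i \<noteq> 0)" using f_nz[OF l x(1,2)] x(3) by simp
      finally show ?thesis .
    qed
    then have "f l ` (U l \<inter> (\<Union>j<l. U j)) = {y \<in> f l ` U l. \<exists>i<2 * c l. y i \<noteq> 0}" by blast
    then show "f l ` (U l \<inter> (\<Union>j<l. U j)) = {y \<in> topspace (Euclidean_space (N l)). \<exists>i<2 * c l. y i \<noteq> 0}"
      unfolding im .
  qed
  moreover have "card {l. l < length L \<and> 2 * c l = k} = card {F \<in> ?Fs. 2 * codim m n F = k}"
  proof (rule bij_betw_same_card)
    show "bij_betw S {l. l < length L \<and> 2 * c l = k} {F \<in> ?Fs. 2 * codim m n F = k}"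
      unfolding bij_betw_def
    proof
      show "inj_on S {l. l < length L \<and> 2 * c l = k}" using S_inj by (rule inj_on_subset) auto
      show "S ` {l. l < length L \<and> 2 * c l = k} = {F \<in> ?Fs. 2 * codim m n F = k}"
        using S(1) S_surj by (auto simp: c_def)
    qed
  qed
  ultimately show ?thesis by simp
qed

lemma fin_dim_cohomology_H_space: "vectorspace.fin_dim class_ring (cohomology k (H_space m d n))"
  using H_space_cycle_basis[of k m d n] cohomology_of_cycle_basis(1) by blast

lemma dim_H_eq: "dim_H m d n k = card {S \<in> forests m n d. 2 * codim m n S = k}"
  using H_space_cycle_basis[of k m d n] cohomology_of_cycle_basis(2) unfolding dim_H_def by blast

text \<open>Makes the sums over degrees genuine; over an infinite support \<open>Sum_any\<close>
  would take its default value 0.\<close>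

lemma finite_dim_H: "finite {k. dim_H m d n k \<noteq> 0}"
proof (rule finite_subset)
  show "{k. dim_H m d n k \<noteq> 0} \<subseteq> (\<lambda>S. 2 * codim m n S) ` forests m n d"
  proof
    fix k assume k: "k \<in> {k. dim_H m d n k \<noteq> 0}"
    have "{S \<in> forests m n d. 2 * codim m n S = k} \<noteq> {}"
    proof
      assume "{S \<in> forests m n d. 2 * codim m n S = k} = {}"
      then show False using k by (simp only: dim_H_eq card.empty mem_Collect_eq)
    qed
    then show "k \<in> (\<lambda>S. 2 * codim m n S) ` forests m n d" by blast
  qed
qed (use finite_forests in blast)

section \<open>Generating functions\<close>

lemma codim_empty [simp]: "codim m n {} = 0"
  by (simp add: codim_def)

lemma finite_inversions:
  "finite S \<Longrightarrow> finite {(w, v). w \<in> critical m n S \<and> v \<in> S \<and> w < v}"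
  by (rule finite_subset[of _ "critical m n S \<times> S"]) (auto simp: finite_critical)

text \<open>Pairs within one part keep their order. A critical word of \<open>S\<close> precedes
  every node of \<open>T\<close>, which yields the product; a critical word of \<open>T\<close>
  precedes no node of \<open>S\<close>.\<close>

lemma codim_juxtapose:
  assumes S: "S \<in> forests m n a" and T: "T \<in> forests m (Suc 0) b"
  shows "codim m (Suc n) (juxtapose n S T) = codim m n S + codim m (Suc 0) T + card (critical m n S) * b"
proof -
  note F = forestsD(1-4)[OF S] and F' = forestsD(1-4)[OF T]
  let ?I = "\<lambda>n S. {(w, v). w \<in> critical m n S \<and> v \<in> S \<and> w < v}"
  let ?s = "shift_root n"
  have critS: "critical m n S \<subseteq> words m n" and critT: "critical m (Suc 0) T \<subseteq> words m (Suc 0)"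
    by (auto simp: critical_def)
  have less: "v < ?s w" if "v \<in> words m n" for v w by (rule less_shift_root[OF that])
  have eq: "?I (Suc n) (juxtapose n S T) =
      ?I n S \<union> map_prod ?s ?s ` ?I (Suc 0) T \<union> critical m n S \<times> ?s ` T"
  proof (intro equalityI subsetI)
    fix p assume "p \<in> ?I (Suc n) (juxtapose n S T)"
    then obtain w v where p: "p = (w, v)" "w < v" "w \<in> critical m n S \<union> ?s ` critical m (Suc 0) T" "v \<in> S \<union> ?s ` T"
      unfolding juxtapose_forest(2)[OF S T] by (auto simp: juxtapose_def)
    show "p \<in> ?I n S \<union> map_prod ?s ?s ` ?I (Suc 0) T \<union> critical m n S \<times> ?s ` T"
    proof (cases "w \<in> critical m n S")
      case True
      then show ?thesis using p by auto
    next
      case False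
      then obtain u where u: "u \<in> critical m (Suc 0) T" "w = ?s u" using p by blast
      have "v \<notin> S" using less[of v u] F(3) p u by (auto dest: order_less_asym)
      then obtain t where t: "t \<in> T" "v = ?s t" using p by blast
      have "u < t" using p u t shift_root_less_iff[of u m t n] critT F'(3) by auto
      then have "(u, t) \<in> ?I (Suc 0) T" using u t by simp
      then have "map_prod ?s ?s (u, t) \<in> map_prod ?s ?s ` ?I (Suc 0) T" by (rule imageI)
      then show ?thesis using p u t by simp
    qed
  next
    fix p assume "p \<in> ?I n S \<union> map_prod ?s ?s ` ?I (Suc 0) T \<union> critical m n S \<times> ?s ` T"
    then consider "p \<in> ?I n S" | u t where "p = (?s u, ?s t)" "u \<in> critical m (Suc 0) T" "t \<in> T" "u < t"
      | w t where "p = (w, ?s t)" "w \<in> critical m n S" "t \<in> T"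
      by auto
    then show "p \<in> ?I (Suc n) (juxtapose n S T)"
    proof cases
      case 1
      then show ?thesis unfolding juxtapose_forest(2)[OF S T] by (auto simp: juxtapose_def)
    next
      case 2
      then have "?s u < ?s t" using shift_root_less_iff[of u m t n] critT F'(3) by auto
      then show ?thesis using 2 unfolding juxtapose_forest(2)[OF S T] by (auto simp: juxtapose_def)
    next
      case 3
      then have "w < ?s t" using less critS by blast
      then show ?thesis using 3 unfolding juxtapose_forest(2)[OF S T] by (auto simp: juxtapose_def)
    qed
  qed
  have hdS: "w \<in> words m n \<Longrightarrow> w \<noteq> ?s v" for v w using hd_less_words[of w m n] by auto
  have fin: "finite (?I n S)" "finite (map_prod ?s ?s ` ?I (Suc 0) T)" "finite (critical m n S \<times> ?s ` T)"
    using F F' finite_inversions finite_critical by auto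
  have disj: "?I n S \<inter> map_prod ?s ?s ` ?I (Suc 0) T = {}"
    "(?I n S \<union> map_prod ?s ?s ` ?I (Suc 0) T) \<inter> (critical m n S \<times> ?s ` T) = {}"
    using hdS critS F(3) by auto
  have "card (map_prod ?s ?s ` ?I (Suc 0) T) = card (?I (Suc 0) T)"
  proof (rule card_image)
    have "inj_on (map_prod ?s ?s) (words m (Suc 0) \<times> words m (Suc 0))"
      by (rule map_prod_inj_on[OF inj_on_shift_root inj_on_shift_root])
    then show "inj_on (map_prod ?s ?s) (?I (Suc 0) T)"
      by (rule inj_on_subset) (use critT F'(3) in auto)
  qed
  moreover have "card (critical m n S \<times> ?s ` T) = card (critical m n S) * b"
    using card_image[OF inj_on_subset[OF inj_on_shift_root F'(3)]] F' by (simp add: card_cartesian_product)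
  ultimately show ?thesis
    unfolding codim_def eq using fin disj by (simp add: card_Un_disjoint)
qed

text \<open>Putting 0 in front preserves the order, and no critical word lies below the new
  root.\<close>

lemma codim_plant:
  assumes F: "F \<in> forests m m d"
  shows "codim m (Suc 0) (plant F) = codim m m F"
  unfolding codim_def
proof (rule bij_betw_same_card[symmetric])
  note f = forestsD(1-4)[OF F]
  have "[] \<notin> F" using f(3) by (auto simp: words_def)
  show "bij_betw (map_prod ((#) 0) ((#) 0)) {(w, v). w \<in> critical m m F \<and> v \<in> F \<and> w < v}
     {(w, v). w \<in> critical m (Suc 0) (plant F) \<and> v \<in> plant F \<and> w < v}"
    unfolding bij_betw_def
  proof
    show "inj_on (map_prod ((#) 0) ((#) 0)) {(w, v). w \<in> critical m m F \<and> v \<in> F \<and> w < v}"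
      by (auto simp: inj_on_def)
    show "map_prod ((#) 0) ((#) 0) ` {(w, v). w \<in> critical m m F \<and> v \<in> F \<and> w < v} =
      {(w, v). w \<in> critical m (Suc 0) (plant F) \<and> v \<in> plant F \<and> w < v}"
      unfolding plant_forest(2)[OF F] by (auto simp: plant_def image_iff)
  qed
qed

text \<open>There are \<open>n\<close> places for roots and \<open>m\<close> places for children of
  each node, and each place is either occupied or critical. The sum on the left avoids a
  subtraction.\<close>

lemma card_critical:
  assumes "S \<in> forests m n d"
  shows "card (critical m n S) + card S = n + m * card S"
  using assms
proof (induction rule: forest_induct)
  case empty
  have "critical m 0 {} = {}" by (auto simp: critical_def words_def)
  then show ?case by simp
next
  case root
  have "critical m (Suc 0) {} = {[0]}"
  proof (intro equalityI subsetI)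
    fix w assume w: "w \<in> critical m (Suc 0) {}"
    then have ww: "w \<in> words m (Suc 0)" by (simp add: critical_def)
    then obtain v i where vi: "w = v @ [i]" by (cases w rule: rev_cases) (auto simp: words_def)
    have "v = []"
    proof (rule ccontr)
      assume "v \<noteq> []"
      then have "v \<in> {}" using w vi unfolding critical_def by blast
      then show False by simp
    qed
    then show "w \<in> {[0]}" using ww vi by simp
  qed (auto simp: critical_def append_eq_Cons_conv)
  then show ?case by simp
next
  case (plant F d)
  note f = forestsD(1-4)[OF plant(1)] and f' = forestsD(1-4)[OF plant_forest(1)[OF plant(1)]]
  have "card (critical m (Suc 0) (plant F)) = card (critical m m F)"
    unfolding plant_forest(2)[OF plant(1)] by (simp add: card_image)
  then show ?case using plant(2) f(2) f'(2) by simp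
next
  case (juxtapose n S T a b)
  note F = forestsD(1-4)[OF juxtapose(1)] and F' = forestsD(1-4)[OF juxtapose(2)]
    and J = juxtapose_forest[OF juxtapose(1,2)]
  have critT: "critical m (Suc 0) T \<subseteq> words m (Suc 0)" and critS: "critical m n S \<subseteq> words m n"
    by (auto simp: critical_def)
  have disj: "critical m n S \<inter> shift_root n ` critical m (Suc 0) T = {}"
    using critS hd_less_words by fastforce
  have "card (shift_root n ` critical m (Suc 0) T) = card (critical m (Suc 0) T)"
    by (rule card_image[OF inj_on_subset[OF inj_on_shift_root critT]])
  then have "card (critical m (Suc n) (juxtapose n S T)) = card (critical m n S) + card (critical m (Suc 0) T)"
    unfolding J(2) using disj finite_critical F F' by (simp add: card_Un_disjoint)
  moreover have "card (juxtapose n S T) = card S + card T" using forestsD(2)[OF J(1)] F F' by simp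
  ultimately show ?case using juxtapose(3,4) by (simp add: distrib_left)
qed

text \<open>The exponent of q in front of the \<open>d\<close>-th coefficient of
  \<open>zeta_bar\<close>. It bounds the codimension of each forest with \<open>d\<close> nodes,
  which makes the coefficient a polynomial in q.\<close>

definition top_exponent :: "nat \<Rightarrow> nat \<Rightarrow> nat \<Rightarrow> nat" where
  "top_exponent m n d = (m - 1) * (d * (d - 1) div 2) + (n - 1) * d"

text \<open>A pair of elements of a disjoint union lies in one part or across the two.\<close>

lemma triangle_add: "(a + b) * (a + b - 1) div 2 = a * (a - 1) div 2 + b * (b - 1) div 2 + a * b" for a b :: nat
proof -
  have even: "even (a * (a - 1))" for a :: nat by (cases a) auto
  have dbl: "2 * (a * (a - 1) div 2) + a = a * a" for a :: nat
    using even[of a] by (cases a) (auto simp: algebra_simps)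
  have "(a + b) * (a + b) = a * a + b * b + 2 * (a * b)" by (simp add: algebra_simps)
  then show ?thesis using dbl[of "a + b"] dbl[of a] dbl[of b] by linarith
qed

text \<open>The final product is the cross term of \<open>codim_juxtapose\<close>, by
  \<open>card_critical_eq\<close>; it cancels against the codimension and leaves the extra
  \<open>a\<close>. For \<open>n = 0\<close> the truncated \<open>n - 1\<close> would make the right
  side too large by \<open>a\<close>, whence the second assumption.\<close>

lemma top_exponent_add:
  assumes "m \<ge> 1" "n \<ge> 1 \<or> a = 0"
  shows "top_exponent m (Suc n) (a + b) =
    top_exponent m n a + a + top_exponent m (Suc 0) b + (n + (m - 1) * a) * b"
proof -
  define x y k where "x = a * (a - 1) div 2" and "y = b * (b - 1) div 2" and "k = m - 1"
  have "top_exponent m (Suc n) (a + b) = k * (x + y + a * b) + n * (a + b)"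
    unfolding top_exponent_def triangle_add x_def y_def k_def by simp
  moreover have "top_exponent m n a = k * x + (n - 1) * a" "top_exponent m (Suc 0) b = k * y"
    by (simp_all add: top_exponent_def x_def y_def k_def)
  ultimately show ?thesis
    using assms(2) unfolding k_def[symmetric] by (cases n) (auto simp: algebra_simps)
qed

text \<open>Passing from d choose 2 to d + 1 choose 2 adds \<open>d\<close>, which has the same
  effect as passing from one root to \<open>m\<close> roots.\<close>

lemma top_exponent_Suc: "m \<ge> 1 \<Longrightarrow> top_exponent m (Suc 0) (Suc d) = top_exponent m m d"
  using triangle_add[of d 1] by (simp add: top_exponent_def algebra_simps)

lemma card_critical_eq:
  assumes "m \<ge> 1" "S \<in> forests m n d"
  shows "card (critical m n S) = n + (m - 1) * d"
proof -
  have "m * d = (m - 1) * d + d" using assms(1) by (cases m) auto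
  then show ?thesis using card_critical[OF assms(2)] forestsD(2)[OF assms(2)] by simp
qed

lemma forest_no_roots: "S \<in> forests m n a \<Longrightarrow> n \<ge> 1 \<or> a = 0"
  by (cases n) (auto simp: forests_0_roots split: if_splits)

lemma codim_le_top_exponent:
  assumes m: "m \<ge> 1" and S: "S \<in> forests m n d"
  shows "codim m n S \<le> top_exponent m n (card S)"
  using S
proof (induction rule: forest_induct)
  case (plant F d)
  then show ?case
    using codim_plant[OF plant(1)] top_exponent_Suc[OF m, of d] forestsD(2)[OF plant(1)]
      forestsD(2)[OF plant_forest(1)[OF plant(1)]] by simp
next
  case (juxtapose n S T a b)
  have card: "card S = a" "card T = b" "card (juxtapose n S T) = a + b"
    using forestsD(2)[OF juxtapose(1)] forestsD(2)[OF juxtapose(2)]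
      forestsD(2)[OF juxtapose_forest(1)[OF juxtapose(1,2)]] by auto
  show ?case
    using codim_juxtapose[OF juxtapose(1,2)] card_critical_eq[OF m juxtapose(1)]
      top_exponent_add[OF m forest_no_roots[OF juxtapose(1)], of b] juxtapose(3,4) card by simp
qed auto

text \<open>The power of q contributed by a forest. For forests with \<open>d\<close> nodes and
  \<open>m \<ge> 1\<close> the subtraction is not truncated, by
  \<open>codim_le_top_exponent\<close>.\<close>

definition forest_exponent :: "nat \<Rightarrow> nat \<Rightarrow> nat \<Rightarrow> nat list set \<Rightarrow> nat" where
  "forest_exponent m n d S = top_exponent m n d - codim m n S"

lemma forest_exponent_juxtapose:
  assumes m: "m \<ge> 1" and S: "S \<in> forests m n a" and T: "T \<in> forests m (Suc 0) b"
  shows "forest_exponent m (Suc n) (a + b) (juxtapose n S T) =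
    forest_exponent m n a S + a + forest_exponent m (Suc 0) b T"
  using codim_juxtapose[OF S T] card_critical_eq[OF m S] top_exponent_add[OF m forest_no_roots[OF S], of b]
    codim_le_top_exponent[OF m S] codim_le_top_exponent[OF m T] forestsD(2)[OF S] forestsD(2)[OF T]
  by (simp add: forest_exponent_def)

lemma forest_exponent_plant:
  assumes m: "m \<ge> 1" and F: "F \<in> forests m m d"
  shows "forest_exponent m (Suc 0) (Suc d) (plant F) = forest_exponent m m d F"
  using codim_plant[OF F] top_exponent_Suc[OF m, of d] by (simp add: forest_exponent_def)

section \<open>The generating function of forests and its functional equations\<close>

definition forest_gf :: "nat \<Rightarrow> nat \<Rightarrow> rat poly fps" where
  "forest_gf m n = Abs_fps (\<lambda>d. \<Sum>S\<in>forests m n d. monom 1 (forest_exponent m n d S))"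

lemma subst_t_nth: "fps_nth (subst_t i Z) d = monom 1 (i * d) * fps_nth Z d"
  by (simp add: subst_t_def monom_power)

lemma subst_t_mult: "subst_t i (Y * Z) = subst_t i Y * subst_t i Z"
  unfolding subst_t_def by (rule fps_compose_mult_distrib) simp

lemma subst_t_1 [simp]: "subst_t i 1 = 1"
  by (simp add: subst_t_def)

lemma subst_t_0 [simp]: "subst_t 0 Z = Z"
  by (rule fps_ext) (simp add: subst_t_nth monom_0 one_pCons[symmetric])

lemma subst_t_subst_t: "subst_t i (subst_t j Z) = subst_t (i + j) Z"
  by (rule fps_ext) (simp add: subst_t_nth mult_monom algebra_simps flip: mult.assoc)

lemma subst_t_prod: "subst_t i (\<Prod>j\<in>J. f j) = (\<Prod>j\<in>J. subst_t i (f j))"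
  by (induction J rule: infinite_finite_induct) (auto simp: subst_t_mult)

text \<open>Summation along \<open>bij_betw_juxtapose\<close>. The surplus \<open>a\<close> in
  \<open>forest_exponent_juxtapose\<close> is the factor that \<open>subst_t 1\<close> puts on the
  coefficient of t^a.\<close>

lemma forest_gf_Suc:
  assumes m: "m \<ge> 1"
  shows "forest_gf m (Suc n) = subst_t 1 (forest_gf m n) * forest_gf m (Suc 0)"
proof (rule fps_ext)
  fix d
  let ?M = "\<lambda>n d S. monom (1::rat) (forest_exponent m n d S)"
  have "fps_nth (forest_gf m (Suc n)) d = (\<Sum>U\<in>forests m (Suc n) d. ?M (Suc n) d U)"
    by (simp add: forest_gf_def)
  also have "\<dots> = (\<Sum>p\<in>(SIGMA a:{..d}. forests m n a \<times> forests m (Suc 0) (d - a)).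
      ?M (Suc n) d (case p of (a, S, T) \<Rightarrow> juxtapose n S T))"
    by (rule sum.reindex_bij_betw[OF bij_betw_juxtapose, symmetric])
  also have "\<dots> = (\<Sum>(a, p)\<in>(SIGMA a:{..d}. forests m n a \<times> forests m (Suc 0) (d - a)).
      case p of (S, T) \<Rightarrow> monom 1 a * ?M n a S * ?M (Suc 0) (d - a) T)"
  proof (rule sum.cong[OF refl])
    fix p assume "p \<in> (SIGMA a:{..d}. forests m n a \<times> forests m (Suc 0) (d - a))"
    then obtain a S T where p: "p = (a, S, T)" "a \<le> d" "S \<in> forests m n a" "T \<in> forests m (Suc 0) (d - a)" by auto
    have "forest_exponent m (Suc n) d (juxtapose n S T) =
        a + forest_exponent m n a S + forest_exponent m (Suc 0) (d - a) T"
      using forest_exponent_juxtapose[OF m p(3,4)] p(2) by simp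
    then show "?M (Suc n) d (case p of (a, S, T) \<Rightarrow> juxtapose n S T) =
        (case p of (a, p) \<Rightarrow> case p of (S, T) \<Rightarrow> monom 1 a * ?M n a S * ?M (Suc 0) (d - a) T)"
      by (simp add: p(1) mult_monom)
  qed
  also have "\<dots> = (\<Sum>a\<le>d. \<Sum>p\<in>forests m n a \<times> forests m (Suc 0) (d - a).
      case p of (S, T) \<Rightarrow> monom 1 a * ?M n a S * ?M (Suc 0) (d - a) T)"
    by (rule sum.Sigma[symmetric]) (use finite_forests in auto)
  also have "\<dots> = (\<Sum>a\<le>d. \<Sum>S\<in>forests m n a. \<Sum>T\<in>forests m (Suc 0) (d - a).
      monom 1 a * ?M n a S * ?M (Suc 0) (d - a) T)"
    by (simp add: sum.cartesian_product)
  also have "\<dots> = (\<Sum>a\<le>d. (monom 1 a * (\<Sum>S\<in>forests m n a. ?M n a S)) *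
      (\<Sum>T\<in>forests m (Suc 0) (d - a). ?M (Suc 0) (d - a) T))"
  proof (rule sum.cong[OF refl])
    fix a
    have "(\<Sum>S\<in>forests m n a. \<Sum>T\<in>forests m (Suc 0) (d - a). monom 1 a * ?M n a S * ?M (Suc 0) (d - a) T) =
        (\<Sum>S\<in>forests m n a. monom 1 a * ?M n a S) * (\<Sum>T\<in>forests m (Suc 0) (d - a). ?M (Suc 0) (d - a) T)"
      by (rule sum_product[symmetric])
    also have "(\<Sum>S\<in>forests m n a. monom 1 a * ?M n a S) = monom 1 a * (\<Sum>S\<in>forests m n a. ?M n a S)"
      by (rule sum_distrib_left[symmetric])
    finally show "(\<Sum>S\<in>forests m n a. \<Sum>T\<in>forests m (Suc 0) (d - a). monom 1 a * ?M n a S * ?M (Suc 0) (d - a) T) =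
        (monom 1 a * (\<Sum>S\<in>forests m n a. ?M n a S)) * (\<Sum>T\<in>forests m (Suc 0) (d - a). ?M (Suc 0) (d - a) T)" .
  qed
  also have "\<dots> = fps_nth (subst_t 1 (forest_gf m n) * forest_gf m (Suc 0)) d"
    by (simp add: fps_mult_nth subst_t_nth forest_gf_def atLeast0AtMost)
  finally show "fps_nth (forest_gf m (Suc n)) d = fps_nth (subst_t 1 (forest_gf m n) * forest_gf m (Suc 0)) d" .
qed

lemma forest_gf_0: "forest_gf m 0 = 1"
  by (rule fps_ext) (simp add: forest_gf_def forests_0_roots forest_exponent_def top_exponent_def one_pCons monom_0)

text \<open>Each tree split off at the end carries no shift, while all trees in front of it pick up
  one more factor q per node.\<close>

lemma forest_gf_prod:
  assumes m: "m \<ge> 1"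
  shows "forest_gf m n = (\<Prod>i<n. subst_t i (forest_gf m 1))"
proof (induction n)
  case (Suc n)
  have "forest_gf m (Suc n) = (\<Prod>i<n. subst_t (Suc i) (forest_gf m 1)) * forest_gf m 1"
    unfolding forest_gf_Suc[OF m, of n] Suc subst_t_prod subst_t_subst_t by simp
  also have "\<dots> = (\<Prod>i<Suc n. subst_t i (forest_gf m 1))"
    by (subst prod.lessThan_Suc_shift) (simp add: mult.commute)
  finally show ?case .
qed (simp add: forest_gf_0)

text \<open>A nonempty tree is a root with a forest of \<open>m\<close> subtrees, and planting
  leaves the exponent unchanged.\<close>

lemma forest_gf_1:
  assumes m: "m \<ge> 1"
  shows "forest_gf m 1 = 1 + fps_X * forest_gf m m"
proof (rule fps_ext)
  fix d
  show "fps_nth (forest_gf m 1) d = fps_nth (1 + fps_X * forest_gf m m) d"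
  proof (cases d)
    case 0
    then show ?thesis by (simp add: forest_gf_def forests_0_nodes forest_exponent_def top_exponent_def monom_0 one_pCons)
  next
    case (Suc d')
    have "(\<Sum>U\<in>forests m (Suc 0) (Suc d'). monom (1::rat) (forest_exponent m (Suc 0) (Suc d') U)) =
        (\<Sum>F\<in>forests m m d'. monom 1 (forest_exponent m (Suc 0) (Suc d') (plant F)))"
      by (rule sum.reindex_bij_betw[OF bij_betw_plant, symmetric])
    also have "\<dots> = (\<Sum>F\<in>forests m m d'. monom 1 (forest_exponent m m d' F))"
      by (intro sum.cong refl) (simp add: forest_exponent_plant[OF m])
    finally show ?thesis by (simp add: forest_gf_def Suc)
  qed
qed

lemma functional_equations_forest_gf:
  assumes "m \<ge> 1"
  shows "functional_equations m (forest_gf m)"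
  unfolding functional_equations_def
  using forest_gf_prod[OF assms] forest_gf_1[OF assms] by metis

text \<open>Substitution and multiplication never let higher coefficients influence lower ones; with
  the factor \<open>fps_X\<close>, the second functional equation is therefore a recursion.\<close>

lemma prod_subst_t_nth_cong:
  assumes "\<And>k. k \<le> d \<Longrightarrow> fps_nth f k = fps_nth g k"
  shows "k \<le> d \<Longrightarrow> fps_nth (\<Prod>i<n. subst_t i f) k = fps_nth (\<Prod>i<n. subst_t i g) k"
proof (induction n arbitrary: k)
  case (Suc n)
  have "fps_nth ((\<Prod>i<n. subst_t i f) * subst_t n f) k = fps_nth ((\<Prod>i<n. subst_t i g) * subst_t n g) k"
    unfolding fps_mult_nth using Suc assms by (intro sum.cong refl) (simp add: subst_t_nth)
  then show ?case by simp
qed simp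

text \<open>The second equation determines \<open>Z 1\<close> coefficient by coefficient, and the
  first then gives the other series. The equations say nothing about \<open>Z 0\<close>.\<close>

lemma functional_equations_unique:
  assumes Y: "functional_equations m Y" and Z: "functional_equations m Z" and n: "n \<ge> 1"
  shows "Y n = Z n"
proof -
  have "fps_nth (Y 1) d = fps_nth (Z 1) d" for d
  proof (induction d rule: less_induct)
    case (less d)
    have Y1: "Y 1 = 1 + fps_X * (\<Prod>i<m. subst_t i (Y 1))" and Z1: "Z 1 = 1 + fps_X * (\<Prod>i<m. subst_t i (Z 1))"
      using Y Z unfolding functional_equations_def by blast+
    show ?case
    proof (cases d)
      case 0
      then show ?thesis by (subst Y1, subst Z1) simp
    next
      case (Suc d')
      have "fps_nth (\<Prod>i<m. subst_t i (Y 1)) d' = fps_nth (\<Prod>i<m. subst_t i (Z 1)) d'"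
        by (rule prod_subst_t_nth_cong[of d']) (use less Suc in auto)
      then show ?thesis using Suc by (subst Y1, subst Z1) simp
    qed
  qed
  then have "Y 1 = Z 1" by (rule fps_ext)
  then show ?thesis using Y Z n unfolding functional_equations_def by metis
qed

section \<open>From dimensions of cohomology to sums over forests\<close>

lemma Sum_any_card_fibres:
  fixes f :: "nat \<Rightarrow> 'a::comm_ring_1"
  assumes A: "finite A"
  shows "Sum_any (\<lambda>k. of_nat (card {S \<in> A. h S = k}) * f k) = (\<Sum>S\<in>A. f (h S))"
proof -
  have "Sum_any (\<lambda>k. of_nat (card {S \<in> A. h S = k}) * f k) = (\<Sum>k\<in>h ` A. of_nat (card {S \<in> A. h S = k}) * f k)"
  proof (rule Sum_any.expand_superset)
    show "{k. of_nat (card {S \<in> A. h S = k}) * f k \<noteq> 0} \<subseteq> h ` A"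
    proof
      fix k assume k: "k \<in> {k. of_nat (card {S \<in> A. h S = k}) * f k \<noteq> 0}"
      have "{S \<in> A. h S = k} \<noteq> {}"
      proof
        assume "{S \<in> A. h S = k} = {}"
        then show False using k by (simp only: mem_Collect_eq card.empty of_nat_0 mult_zero_left) simp
      qed
      then show "k \<in> h ` A" by blast
    qed
  qed (use A in simp)
  also have "\<dots> = (\<Sum>k\<in>h ` A. \<Sum>S\<in>{S \<in> A. h S = k}. f (h S))"
    by (intro sum.cong refl) simp
  also have "\<dots> = (\<Sum>S\<in>A. f (h S))"
    using sum.image_gen[OF A, of "\<lambda>S. f (h S)" h] by simp
  finally show ?thesis .
qed

lemma poly_map_poly_fls_const_add:
  fixes p r :: "rat poly"
  shows "poly (map_poly fls_const (p + r)) x = poly (map_poly fls_const p) x + poly (map_poly fls_const r) x"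
proof -
  have "map_poly fls_const (p + r) = map_poly fls_const p + map_poly fls_const r"
    by (rule poly_eqI) (simp add: coeff_map_poly fls_plus_const)
  then show ?thesis by simp
qed

lemma poly_map_poly_fls_const_sum:
  fixes p :: "'i \<Rightarrow> rat poly"
  shows "poly (map_poly fls_const (\<Sum>i\<in>I. p i)) x = (\<Sum>i\<in>I. poly (map_poly fls_const (p i)) x)"
  by (induction I rule: infinite_finite_induct) (auto simp: poly_map_poly_fls_const_add)

lemma poly_map_poly_fls_const_monom: "poly (map_poly fls_const (monom (1 :: rat) e)) x = x ^ e"
  by (simp add: map_poly_monom Polynomial.poly_monom)

text \<open>With q = s^2, a class of degree \<open>2 * codim m n S\<close> contributes an even
  negative power of s, that is, q to the power minus the codimension, and the prefactor makes the
  exponent nonnegative.\<close>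

lemma zeta_bar_eq_forest_gf:
  assumes m: "m \<ge> 1"
  shows "zeta_bar m n = embed_gf (forest_gf m n)"
proof (rule fps_ext)
  fix d
  let ?E = "top_exponent m n d"
  have "Sum_any (\<lambda>k. of_nat (card {S \<in> forests m n d. 2 * codim m n S = k}) * fls_X_intpow (- int k)) =
      (\<Sum>S\<in>forests m n d. fls_X_intpow (- int (2 * codim m n S)) :: rat fls)"
    by (rule Sum_any_card_fibres[OF finite_forests])
  then have "fps_nth (zeta_bar m n) d = q_var ^ ?E * (\<Sum>S\<in>forests m n d. fls_X_intpow (- int (2 * codim m n S)))"
    by (simp only: zeta_bar_def dim_H_eq fps_nth_Abs_fps top_exponent_def)
  also have "\<dots> = (\<Sum>S\<in>forests m n d. q_var ^ forest_exponent m n d S)"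
    unfolding sum_distrib_left
  proof (rule sum.cong[OF refl])
    fix S assume S: "S \<in> forests m n d"
    have le: "codim m n S \<le> ?E" using codim_le_top_exponent[OF m S] forestsD(2)[OF S] by simp
    have q: "(q_var :: rat fls) ^ e = fls_X_intpow (int (2 * e))" for e
    proof -
      have "(q_var :: rat fls) ^ e = fls_X ^ (2 * e)" by (simp only: q_var_def power_mult)
      then show ?thesis by (simp only: fls_X_power_conv_shift_1)
    qed
    have "q_var ^ ?E * fls_X_intpow (- int (2 * codim m n S)) = (fls_X_intpow (int (2 * ?E) + (- int (2 * codim m n S))) :: rat fls)"
      unfolding q by (rule fls_X_intpow_times_fls_X_intpow)
    also have "int (2 * ?E) + (- int (2 * codim m n S)) = int (2 * forest_exponent m n d S)"
      using le by (simp add: forest_exponent_def of_nat_diff)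
    finally show "q_var ^ ?E * fls_X_intpow (- int (2 * codim m n S)) = (q_var :: rat fls) ^ forest_exponent m n d S"
      unfolding q .
  qed
  also have "\<dots> = fps_nth (embed_gf (forest_gf m n)) d"
    by (simp add: embed_gf_def forest_gf_def poly_map_poly_fls_const_sum poly_map_poly_fls_const_monom)
  finally show "fps_nth (zeta_bar m n) d = fps_nth (embed_gf (forest_gf m n)) d" .
qed

text \<open>Cohomology lives in even degrees, so every forest counts with sign +1.\<close>

lemma euler_char_eq_card: "euler_char m d n = int (card (forests m n d))"
proof -
  have "euler_char m d n = Sum_any (\<lambda>k. of_nat (card {S \<in> forests m n d. 2 * codim m n S = k}) * (-1) ^ k)"
    unfolding euler_char_def dim_H_eq by (simp add: mult.commute)
  also have "\<dots> = (\<Sum>S\<in>forests m n d. (-1) ^ (2 * codim m n S))"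
    by (rule Sum_any_card_fibres[OF finite_forests])
  finally show ?thesis by simp
qed

section \<open>Counting forests\<close>

lemma card_forests_Suc:
  "card (forests m (Suc n) d) = (\<Sum>a\<le>d. card (forests m n a) * card (forests m (Suc 0) (d - a)))"
proof -
  have "card (forests m (Suc n) d) = card (SIGMA a:{..d}. forests m n a \<times> forests m (Suc 0) (d - a))"
    by (rule bij_betw_same_card[OF bij_betw_juxtapose, symmetric])
  also have "\<dots> = (\<Sum>a\<le>d. card (forests m n a \<times> forests m (Suc 0) (d - a)))"
    by (rule card_SigmaI) (use finite_forests in auto)
  finally show ?thesis by (simp add: card_cartesian_product)
qed

text \<open>The value of \<open>forest_gf\<close> at q = 1, where the shifts of t disappear.\<close>

definition count_gf :: "nat \<Rightarrow> nat \<Rightarrow> rat fps" where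
  "count_gf m n = Abs_fps (\<lambda>d. of_nat (card (forests m n d)))"

lemma count_gf_power: "count_gf m n = count_gf m 1 ^ n"
proof (induction n)
  case 0
  show ?case by (rule fps_ext) (simp add: count_gf_def forests_0_roots)
next
  case (Suc n)
  have "count_gf m (Suc n) = count_gf m n * count_gf m 1"
    by (rule fps_ext) (simp add: count_gf_def card_forests_Suc[of m n] fps_mult_nth atLeast0AtMost)
  then show ?case using Suc by simp
qed

lemma count_gf_1: "count_gf m 1 = 1 + fps_X * count_gf m m"
proof (rule fps_ext)
  fix d
  show "fps_nth (count_gf m 1) d = fps_nth (1 + fps_X * count_gf m m) d"
    using bij_betw_same_card[OF bij_betw_plant, of m "d - 1"]
    by (cases d) (simp_all add: count_gf_def forests_0_nodes)
qed

text \<open>With F for \<open>count_gf m 1\<close>, this is the coefficient of F^(n+1) = F^n + t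
  F^(n+m), the equation F = 1 + t F^m multiplied by F^n.\<close>

lemma card_forests_rec:
  "card (forests m (Suc n) (Suc d)) = card (forests m n (Suc d)) + card (forests m (n + m) d)"
proof -
  have "count_gf m (Suc n) = count_gf m n * count_gf m 1" by (simp add: count_gf_power[of m "Suc n"] count_gf_power[of m n])
  also have "\<dots> = count_gf m n * (1 + fps_X * count_gf m m)" unfolding count_gf_1[of m] ..
  also have "\<dots> = count_gf m n + fps_X * count_gf m (n + m)"
  proof -
    have "count_gf m (n + m) = count_gf m n * count_gf m m"
      unfolding count_gf_power[of m "n + m"] count_gf_power[of m n] count_gf_power[of m m] by (rule power_add)
    then show ?thesis by (simp add: algebra_simps)
  qed
  finally have "fps_nth (count_gf m (Suc n)) (Suc d) = fps_nth (count_gf m n + fps_X * count_gf m (n + m)) (Suc d)"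
    by simp
  then have "(of_nat (card (forests m (Suc n) (Suc d))) :: rat) =
      of_nat (card (forests m n (Suc d)) + card (forests m (n + m) d))"
    by (simp add: count_gf_def)
  then show ?thesis by (simp only: of_nat_eq_iff)
qed

text \<open>These are the Raney numbers, which generalise the Fuss-Catalan numbers. Induction on
  \<open>d\<close>, and inside it on \<open>n\<close> by \<open>card_forests_rec\<close>, whose
  second term has one node less but \<open>n + m\<close> roots.\<close>

lemma card_forests_binomial:
  assumes m: "m \<ge> 1"
  shows "n \<ge> 1 \<Longrightarrow> (of_nat (card (forests m n d)) :: rat) * of_nat (m * d + n) = of_nat n * of_nat ((m * d + n) choose d)"
proof (induction d arbitrary: n)
  case 0
  then show ?case by (simp add: forests_0_nodes)
next
  case (Suc d)
  note IH = Suc.IH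
  \<comment> \<open>The same count after absorption into the binomial coefficient. The denominator
    \<open>Suc d\<close> does not depend on \<open>n\<close>, and the formula holds at
    \<open>n = 0\<close>, where the inner induction starts.\<close>
  have claim: "(of_nat (card (forests m n (Suc d))) :: rat) * of_nat (Suc d) = of_nat n * of_nat ((m * Suc d + n - 1) choose d)" for n
  proof (induction n)
    case 0
    then show ?case by (simp add: forests_0_roots)
  next
    case (Suc n)
    \<comment> \<open>\<open>M\<close> is the upper entry of the binomial coefficient for
      \<open>Suc n\<close> roots and equals \<open>m * d + (n + m)\<close>, as the outer hypothesis
      for \<open>n + m\<close> roots demands.\<close>
    define M where "M = m * Suc d + n"
    have Mpos: "M \<ge> 1" using m by (simp add: M_def)
    have dM: "d \<le> M - 1" using m by (cases m) (auto simp: M_def)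
    have IH1: "(of_nat (card (forests m n (Suc d))) :: rat) * of_nat (Suc d) = of_nat n * of_nat ((M - 1) choose d)"
      using Suc by (simp add: M_def)
    have "m * d + (n + m) = M" by (simp add: M_def algebra_simps)
    then have IH2: "(of_nat (card (forests m (n + m) d)) :: rat) * of_nat M = of_nat (n + m) * of_nat (M choose d)"
      using IH[of "n + m"] m by simp
    have "(M - d) * (M choose d) = M * ((M - 1) choose d)"
      by (rule binomial_absorb_comp)
    then have "of_nat ((M - d) * (M choose d)) = (of_nat (M * ((M - 1) choose d)) :: rat)" by simp
    then have B: "of_nat M * of_nat ((M - 1) choose d) = ((of_nat M - of_nat d) * of_nat (M choose d) :: rat)"
      using dM by (simp add: of_nat_diff)
    have "(of_nat (card (forests m (Suc n) (Suc d))) :: rat) * of_nat (Suc d) * of_nat M =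
        of_nat (card (forests m n (Suc d))) * of_nat (Suc d) * of_nat M +
        of_nat (card (forests m (n + m) d)) * of_nat M * of_nat (Suc d)"
      by (simp add: card_forests_rec algebra_simps)
    also have "\<dots> = of_nat n * (of_nat M * of_nat ((M - 1) choose d)) + of_nat (n + m) * of_nat (M choose d) * of_nat (Suc d)"
      unfolding IH1 IH2 by (simp add: algebra_simps)
    also have "\<dots> = of_nat (M choose d) * (of_nat n * (of_nat M - of_nat d) + of_nat (n + m) * of_nat (Suc d))"
      unfolding B by (simp add: algebra_simps)
    also have "of_nat n * (of_nat M - of_nat d) + of_nat (n + m) * of_nat (Suc d) = (of_nat (Suc n) * of_nat M :: rat)"
      by (simp add: M_def algebra_simps)
    finally have "(of_nat (card (forests m (Suc n) (Suc d))) :: rat) * of_nat (Suc d) * of_nat M =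
        of_nat (Suc n) * of_nat (M choose d) * of_nat M" by (simp add: algebra_simps)
    then have "(of_nat (card (forests m (Suc n) (Suc d))) :: rat) * of_nat (Suc d) = of_nat (Suc n) * of_nat (M choose d)"
      using Mpos by simp
    then show ?case by (simp add: M_def)
  qed
  have "Suc d * ((m * Suc d + n) choose Suc d) = (m * Suc d + n) * ((m * Suc d + n - 1) choose d)"
    using binomial_absorption[of d "m * Suc d + n"] by simp
  then have "of_nat (Suc d) * of_nat ((m * Suc d + n) choose Suc d) =
      (of_nat (m * Suc d + n) * of_nat ((m * Suc d + n - 1) choose d) :: rat)"
    by (metis of_nat_mult)
  then have "of_nat n * (of_nat (Suc d) * of_nat ((m * Suc d + n) choose Suc d)) =
      (of_nat n * of_nat ((m * Suc d + n - 1) choose d) * of_nat (m * Suc d + n) :: rat)"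
    by (simp only: mult.assoc mult.commute[of "of_nat (m * Suc d + n)"])
  also have "\<dots> = of_nat (card (forests m n (Suc d))) * of_nat (Suc d) * of_nat (m * Suc d + n)"
    unfolding claim[of n, symmetric] ..
  finally have "of_nat (Suc d) * ((of_nat (card (forests m n (Suc d))) :: rat) * of_nat (m * Suc d + n)) =
      of_nat (Suc d) * (of_nat n * of_nat ((m * Suc d + n) choose Suc d))"
    by (simp only: mult_ac)
  then show ?case by (simp del: of_nat_Suc)
qed

text \<open>Put N = m d + n, so that N - d = (m - 1) d + n. Absorption, (N - d) (N choose d) = N (N
  - 1 choose d), converts the previous formula into the closed form.\<close>

lemma card_forests:
  assumes m: "m \<ge> 1" and n: "n \<ge> 1"
  shows "(of_nat (card (forests m n d)) :: rat) =
    of_nat n / of_nat ((m - 1) * d + n) * of_nat ((m * d + n - 1) choose d)"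
proof -
  define N where "N = m * d + n"
  obtain k where k: "m = Suc k" using m by (cases m) auto
  have N: "N \<ge> 1" "N - d = (m - 1) * d + n" using n by (simp_all add: N_def k)
  have "(N - d) * (N choose d) = N * ((N - 1) choose d)" by (rule binomial_absorb_comp)
  then have absorb: "of_nat (N - d) * of_nat (N choose d) = (of_nat N * of_nat ((N - 1) choose d) :: rat)"
    by (metis of_nat_mult)
  have card_N: "(of_nat (card (forests m n d)) :: rat) * of_nat N = of_nat n * of_nat (N choose d)"
    unfolding N_def by (rule card_forests_binomial[OF m n])
  have "of_nat (card (forests m n d)) * of_nat N * of_nat (N - d) = (of_nat n * of_nat (N choose d) * of_nat (N - d) :: rat)"
    unfolding card_N ..
  also have "\<dots> = of_nat n * (of_nat (N - d) * of_nat (N choose d))" by (simp only: mult_ac)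
  also have "\<dots> = of_nat n * (of_nat N * of_nat ((N - 1) choose d))" unfolding absorb ..
  finally have "of_nat (card (forests m n d)) * of_nat N * of_nat (N - d) =
      (of_nat n * (of_nat N * of_nat ((N - 1) choose d)) :: rat)" .
  then have "of_nat N * ((of_nat (card (forests m n d)) :: rat) * of_nat (N - d)) =
      of_nat N * (of_nat n * of_nat ((N - 1) choose d))"
    by (simp only: mult_ac)
  then have "(of_nat (card (forests m n d)) :: rat) * of_nat (N - d) = of_nat n * of_nat ((N - 1) choose d)"
    using N by simp
  moreover have "(of_nat (N - d) :: rat) \<noteq> 0" unfolding of_nat_eq_0_iff using N n by simp
  ultimately show ?thesis unfolding N(2)[symmetric] N_def[symmetric] by (simp add: field_simps)
qed

text \<open>The first conjunct secures the meaning of the others: for an infinite-dimensional space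
  or infinitely many nonzero degrees, \<open>dim_H\<close> or the sums over k would no longer be the
  intended quantities.\<close>

theorem theorem1p4:
  fixes m :: nat
  assumes "m \<ge> 1"
  shows "(\<forall>d. \<forall>n\<ge>1.
            (\<forall>k. vectorspace.fin_dim class_ring (cohomology k (H_space m d n))) \<and>
            finite {k. dim_H m d n k \<noteq> 0}) \<and>
         (\<exists>Z :: nat \<Rightarrow> rat poly fps.
            (\<forall>n\<ge>1. zeta_bar m n = embed_gf (Z n)) \<and>
            functional_equations m Z \<and>
            (\<forall>Y. functional_equations m Y \<longrightarrow> (\<forall>n\<ge>1. Y n = Z n))) \<and>
         (\<forall>d. \<forall>n\<ge>1.
            of_int (euler_char m d n) =
              (of_nat n / of_nat ((m - 1) * d + n) * of_nat ((m * d + n - 1) choose d) :: rat))"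
proof (intro conjI)
  show "\<forall>d. \<forall>n\<ge>1. (\<forall>k. vectorspace.fin_dim class_ring (cohomology k (H_space m d n))) \<and>
      finite {k. dim_H m d n k \<noteq> 0}"
    using fin_dim_cohomology_H_space finite_dim_H by blast
  show "\<exists>Z :: nat \<Rightarrow> rat poly fps. (\<forall>n\<ge>1. zeta_bar m n = embed_gf (Z n)) \<and> functional_equations m Z \<and>
      (\<forall>Y. functional_equations m Y \<longrightarrow> (\<forall>n\<ge>1. Y n = Z n))"
    using zeta_bar_eq_forest_gf[OF assms] functional_equations_forest_gf[OF assms] functional_equations_unique
    by blast
  show "\<forall>d. \<forall>n\<ge>1. of_int (euler_char m d n) =
      (of_nat n / of_nat ((m - 1) * d + n) * of_nat ((m * d + n - 1) choose d) :: rat)"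
    using card_forests[OF assms] by (simp add: euler_char_eq_card)
qed

end
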